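(* Let $f:M\to M$ be a continuous map which is a $C^2$ local diffeomorphism on $M\setminus\mathcal S$ and behaves like a power of the distance to the exceptional set $\mathcal S$. Suppose that for some $0<\sigma<1$ and $\delta>0$ Lebesgue almost every point of $M$ has a $(\sigma,\delta)$-hyperbolic time, and that the first $(\sigma,\delta)$-hyperbolic time map $h$ is Lebesgue integrable, i.e. $\int_M h\,dm<\infty$. Then $f$ has an absolutely continuous (with respect to $m$) invariant probability measure $\mu$.
   Context: $M$ is a compact Riemannian manifold with induced distance $\operatorname{dist}$, and $m$ is a fixed normalized Riemannian volume on $M$, called Lebesgue measure. $\mathcal S\subset M$ is a compact submanifold with $\dim(\mathcal S)<\dim(M)$ (so $m(\mathcal S)=0$); $\mathcal S=\emptyset$ is allowed. "$f$ behaves like a power of the distance to $\mathcal S$" means: there are constants $B>1$ and $\beta>0$ such that for all $x,y\in M\setminus\mathcal S$ with $\operatorname{dist}(x,y)<\operatorname{dist}(x,\mathcal S)/2$ and all $v\in T_xM\setminus\{0\}$: (i) $\frac1B\operatorname{dist}(x,\mathcal S)^{\beta}\le \frac{\|Df(x)v\|}{\|v\|}\le B\operatorname{dist}(x,\mathcal S)^{-\beta}$; (ii) $\big|\log\|Df(x)^{-1}\|-\log\|Df(y)^{-1}\|\big|\le B\,\frac{\operatorname{dist}(x,y)}{\operatorname{dist}(x,\mathcal S)^{\beta}}$; (iii) $\big|\log|\det Df(x)^{-1}|-\log|\det Df(y)^{-1}|\big|\le B\,\frac{\operatorname{dist}(x,y)}{\operatorname{dist}(x,\mathcal S)^{\beta}}$.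 (If $\mathcal S=\emptyset$ this condition is void and $f$ is simply a $C^2$ local diffeomorphism.) For $\delta>0$ let $\operatorname{dist}_\delta(x,\mathcal S)=\operatorname{dist}(x,\mathcal S)$ if $\operatorname{dist}(x,\mathcal S)\le\delta$, and $\operatorname{dist}_\delta(x,\mathcal S)=1$ otherwise. Fix once and for all $b$ with $0<b<\min\{1/2,1/(4\beta)\}$. Given $0<\sigma<1$ and $\delta>0$, an integer $n\ge1$ is a $(\sigma,\delta)$-hyperbolic time for $x\in M$ if for every $1\le k\le n$ $$\prod_{j=n-k}^{n-1}\|Df(f^j(x))^{-1}\|\le\sigma^k\quad\text{and}\quad \operatorname{dist}_\delta(f^{n-k}(x),\mathcal S)\ge\sigma^{bk}$$ (in particular $f^j(x)\notin\mathcal S$ for $0\le j<n$). If $\mathcal S=\emptyset$ only the first condition is required. $h(x)\in\mathbb N$ denotes the first (smallest) $(\sigma,\delta)$-hyperbolic time of $x$; it is defined for Lebesgue almost every $x$. *)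

theory Defs
  imports "HOL-Probability.Probability"
begin

section \<open>Maps of class C^k between Euclidean spaces\<close>

text \<open>To be used on open sets only.\<close>

primrec Ck_on :: "nat \<Rightarrow> ('a::euclidean_space \<Rightarrow> 'b::euclidean_space) \<Rightarrow> 'a set \<Rightarrow> bool" where
  "Ck_on 0 F U \<longleftrightarrow> continuous_on U F"
| "Ck_on (Suc k) F U \<longleftrightarrow>
     F differentiable_on U \<and> (\<forall>v. Ck_on k (\<lambda>x. frechet_derivative F (at x) v) U)"

definition smooth_on :: "('a::euclidean_space \<Rightarrow> 'b::euclidean_space) \<Rightarrow> 'a set \<Rightarrow> bool" where
  "smooth_on F U \<longleftrightarrow> (\<forall>k. Ck_on k F U)"


section \<open>Smooth manifolds without boundary\<close>

text \<open>
  The points of the manifold are the elements of a metric space type \<open>'m\<close>; that its distance is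
  the one induced by the Riemannian metric is the predicate \<open>induced_distance\<close> below.
  The dimension is \<open>CARD('n)\<close>. A chart is a pair of a domain and a coordinate map, whose values
  off the domain are irrelevant.
\<close>

type_synonym ('m, 'n) chart = "'m set \<times> ('m \<Rightarrow> real ^ 'n)"

definition chart_inv :: "('m, 'n::finite) chart \<Rightarrow> real ^ 'n \<Rightarrow> 'm" where
  "chart_inv c = inv_into (fst c) (snd c)"

definition topological_chart :: "('m::topological_space, 'n::finite) chart \<Rightarrow> bool" where
  "topological_chart c \<longleftrightarrow>
     open (fst c) \<and> open (snd c ` fst c) \<and>
     homeomorphism (fst c) (snd c ` fst c) (snd c) (chart_inv c)"

definition smoothly_compatible :: "('m, 'n::finite) chart \<Rightarrow> ('m, 'n) chart \<Rightarrow> bool" where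
  "smoothly_compatible c d \<longleftrightarrow>
     smooth_on (snd d \<circ> chart_inv c) (snd c ` (fst c \<inter> fst d)) \<and>
     smooth_on (snd c \<circ> chart_inv d) (snd d ` (fst c \<inter> fst d))"

definition smooth_atlas :: "('m::topological_space, 'n::finite) chart set \<Rightarrow> bool" where
  "smooth_atlas A \<longleftrightarrow>
     (\<Union>c\<in>A. fst c) = UNIV \<and>
     (\<forall>c\<in>A. topological_chart c) \<and>
     (\<forall>c\<in>A. \<forall>d\<in>A. smoothly_compatible c d)"

text \<open>The charts of the maximal atlas generated by \<open>A\<close>.\<close>

definition admissible_chart ::
    "('m::topological_space, 'n::finite) chart set \<Rightarrow> ('m, 'n) chart \<Rightarrow> bool" where
  "admissible_chart A c \<longleftrightarrow> topological_chart c \<and> (\<forall>d\<in>A. smoothly_compatible c d)"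

text \<open>Embedded submanifolds of dimension \<open>k\<close>, by slice charts. The empty set is one, for every \<open>k\<close>.\<close>

definition embedded_submanifold ::
    "('m::topological_space, 'n::finite) chart set \<Rightarrow> nat \<Rightarrow> 'm set \<Rightarrow> bool" where
  "embedded_submanifold A k S \<longleftrightarrow>
     (\<forall>x\<in>S. \<exists>c E. admissible_chart A c \<and> x \<in> fst c \<and> subspace E \<and> dim E = k \<and>
        snd c ` (fst c \<inter> S) = snd c ` fst c \<inter> E)"

definition Ck_map_on ::
    "('m::topological_space, 'n::finite) chart set \<Rightarrow> nat \<Rightarrow> ('m \<Rightarrow> 'm) \<Rightarrow> 'm set \<Rightarrow> bool" where
  "Ck_map_on A k f W \<longleftrightarrow>
     continuous_on W f \<and>
     (\<forall>c\<in>A. \<forall>d\<in>A. Ck_on k (snd d \<circ> f \<circ> chart_inv c) (snd c ` (fst c \<inter> W \<inter> f -` fst d)))"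

definition Ck_local_diffeo_on ::
    "('m::topological_space, 'n::finite) chart set \<Rightarrow> nat \<Rightarrow> ('m \<Rightarrow> 'm) \<Rightarrow> 'm set \<Rightarrow> bool" where
  "Ck_local_diffeo_on A k f W \<longleftrightarrow>
     (\<forall>x\<in>W. \<exists>V. open V \<and> x \<in> V \<and> V \<subseteq> W \<and> open (f ` V) \<and> inj_on f V \<and>
        Ck_map_on A k f V \<and> Ck_map_on A k (inv_into V f) (f ` V))"


section \<open>Tangent spaces and derivatives\<close>

text \<open>
  The tangent space at \<open>x\<close> is \<open>real ^ 'n\<close>: a tangent vector is given by its coordinates in one
  chart selected at \<open>x\<close>. The selected chart need not depend continuously on \<open>x\<close>; norms of
  derivatives, Jacobians, lengths and volumes below do not depend on the selection.
\<close>

definition chart_at :: "('m, 'n::finite) chart set \<Rightarrow> 'm \<Rightarrow> ('m, 'n) chart" where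
  "chart_at A x = (SOME c. c \<in> A \<and> x \<in> fst c)"

definition differential ::
    "('m, 'n::finite) chart set \<Rightarrow> ('m \<Rightarrow> 'm) \<Rightarrow> 'm \<Rightarrow> real ^ 'n \<Rightarrow> real ^ 'n" where
  "differential A f x =
     frechet_derivative (snd (chart_at A (f x)) \<circ> f \<circ> chart_inv (chart_at A x))
       (at (snd (chart_at A x) x))"

definition velocity :: "('m, 'n::finite) chart set \<Rightarrow> (real \<Rightarrow> 'm) \<Rightarrow> real \<Rightarrow> real ^ 'n" where
  "velocity A \<gamma> t = vector_derivative (snd (chart_at A (\<gamma> t)) \<circ> \<gamma>) (at t)"


section \<open>Riemannian metrics\<close>

type_synonym ('m, 'n) metric_field = "'m \<Rightarrow> real ^ 'n \<Rightarrow> real ^ 'n \<Rightarrow> real"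

text \<open>
  The coordinate expression of \<open>g\<close> in an arbitrary chart \<open>c\<close> at the coordinate point \<open>p\<close>: vectors
  are first carried from the coordinates \<open>c\<close> to those of the chart selected at the point.
\<close>

definition metric_in_chart ::
    "('m, 'n::finite) chart set \<Rightarrow> ('m, 'n) metric_field \<Rightarrow> ('m, 'n) chart \<Rightarrow>
     real ^ 'n \<Rightarrow> real ^ 'n \<Rightarrow> real ^ 'n \<Rightarrow> real" where
  "metric_in_chart A g c p v w =
     (let x = chart_inv c p;
          T = frechet_derivative (snd (chart_at A x) \<circ> chart_inv c) (at p)
      in g x (T v) (T w))"

definition riemannian_metric ::
    "('m, 'n::finite) chart set \<Rightarrow> ('m, 'n) metric_field \<Rightarrow> bool" where
  "riemannian_metric A g \<longleftrightarrow>
     (\<forall>x. bilinear (g x) \<and> (\<forall>v w. g x v w = g x w v) \<and> (\<forall>v. v \<noteq> 0 \<longrightarrow> g x v v > 0)) \<and>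
     (\<forall>c\<in>A. \<forall>v w. smooth_on (\<lambda>p. metric_in_chart A g c p v w) (snd c ` fst c))"

definition tangent_norm :: "('m, 'n::finite) metric_field \<Rightarrow> 'm \<Rightarrow> real ^ 'n \<Rightarrow> real" where
  "tangent_norm g x v = sqrt (g x v v)"

definition piecewise_C1_curve ::
    "('m::topological_space, 'n::finite) chart set \<Rightarrow> (real \<Rightarrow> 'm) \<Rightarrow> bool" where
  "piecewise_C1_curve A \<gamma> \<longleftrightarrow>
     continuous_on {0..1} \<gamma> \<and>
     (\<forall>c\<in>A. \<forall>a b. 0 \<le> a \<and> a \<le> b \<and> b \<le> 1 \<and> \<gamma> ` {a..b} \<subseteq> fst c \<longrightarrow>
        (snd c \<circ> \<gamma>) piecewise_C1_differentiable_on {a..b})"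

definition curve_length ::
    "('m, 'n::finite) chart set \<Rightarrow> ('m, 'n) metric_field \<Rightarrow> (real \<Rightarrow> 'm) \<Rightarrow> ennreal" where
  "curve_length A g \<gamma> = (\<integral>\<^sup>+t\<in>{0..1}. ennreal (tangent_norm g (\<gamma> t) (velocity A \<gamma> t)) \<partial>lborel)"

text \<open>
  Connectedness is not assumed. Points of different components are joined by no curve, and the
  distance between them is left free; on a connected manifold \<open>dist\<close> is completely determined.
\<close>

definition induced_distance ::
    "('m::metric_space, 'n::finite) chart set \<Rightarrow> ('m, 'n) metric_field \<Rightarrow> bool" where
  "induced_distance A g \<longleftrightarrow>
     (\<forall>x y. connected_component UNIV x y \<longrightarrow>
        ennreal (dist x y) =
          (INF \<gamma>\<in>{\<gamma>. piecewise_C1_curve A \<gamma> \<and> \<gamma> 0 = x \<and> \<gamma> 1 = y}. curve_length A g \<gamma>))"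

definition gram_det :: "(real ^ 'n::finite \<Rightarrow> real ^ 'n \<Rightarrow> real) \<Rightarrow> real" where
  "gram_det G = det (\<chi> i j. G (axis i 1) (axis j 1))"

text \<open>
  In a chart the Riemannian volume has density \<open>sqrt (det g)\<close> with respect to Lebesgue measure;
  \<open>K\<close> is the normalizing constant.
\<close>

definition normalized_riemannian_volume ::
    "('m::metric_space, 'n::finite) chart set \<Rightarrow> ('m, 'n) metric_field \<Rightarrow> 'm measure \<Rightarrow> bool" where
  "normalized_riemannian_volume A g m \<longleftrightarrow>
     sets m = sets borel \<and> emeasure m UNIV = 1 \<and>
     (\<exists>K>0. \<forall>c\<in>A. \<forall>X\<in>sets borel. X \<subseteq> fst c \<longrightarrow>
        emeasure m X =
          ennreal K * (\<integral>\<^sup>+p\<in>snd c ` X. ennreal (sqrt (gram_det (metric_in_chart A g c p))) \<partial>lborel))"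


section \<open>Size of the inverse derivative\<close>

text \<open>The operator norm of \<open>Df(x)\<^sup>-\<^sup>1\<close>, which maps the tangent space at \<open>f x\<close> to that at \<open>x\<close>.\<close>

definition inv_deriv_norm ::
    "('m, 'n::finite) chart set \<Rightarrow> ('m, 'n) metric_field \<Rightarrow> ('m \<Rightarrow> 'm) \<Rightarrow> 'm \<Rightarrow> real" where
  "inv_deriv_norm A g f x =
     (SUP w\<in>-{0}. tangent_norm g x (inv (differential A f x) w) / tangent_norm g (f x) w)"

text \<open>
  The absolute value of the determinant of \<open>Df(x)\<^sup>-\<^sup>1\<close> with respect to orthonormal bases of both
  tangent spaces; the Gram determinants account for the standard basis not being orthonormal.
\<close>

definition inv_deriv_abs_det ::
    "('m, 'n::finite) chart set \<Rightarrow> ('m, 'n) metric_field \<Rightarrow> ('m \<Rightarrow> 'm) \<Rightarrow> 'm \<Rightarrow> real" where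
  "inv_deriv_abs_det A g f x =
     \<bar>det (matrix (inv (differential A f x)))\<bar> * sqrt (gram_det (g x)) / sqrt (gram_det (g (f x)))"


section \<open>The exceptional set and hyperbolic times\<close>

text \<open>Since \<open>infdist x {} = 0\<close>, the condition is void for \<open>S = {}\<close>, as intended.\<close>

definition behaves_like_power_of_dist ::
    "('m::metric_space, 'n::finite) chart set \<Rightarrow> ('m, 'n) metric_field \<Rightarrow> ('m \<Rightarrow> 'm) \<Rightarrow> 'm set \<Rightarrow>
     real \<Rightarrow> real \<Rightarrow> bool" where
  "behaves_like_power_of_dist A g f S B \<beta> \<longleftrightarrow>
     (\<forall>x y v. x \<notin> S \<and> y \<notin> S \<and> dist x y < infdist x S / 2 \<and> v \<noteq> 0 \<longrightarrow>
        1 / B * infdist x S powr \<beta>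
          \<le> tangent_norm g (f x) (differential A f x v) / tangent_norm g x v \<and>
        tangent_norm g (f x) (differential A f x v) / tangent_norm g x v
          \<le> B * infdist x S powr (- \<beta>) \<and>
        \<bar>ln (inv_deriv_norm A g f x) - ln (inv_deriv_norm A g f y)\<bar>
          \<le> B * (dist x y / infdist x S powr \<beta>) \<and>
        \<bar>ln (inv_deriv_abs_det A g f x) - ln (inv_deriv_abs_det A g f y)\<bar>
          \<le> B * (dist x y / infdist x S powr \<beta>))"

definition trunc_dist :: "real \<Rightarrow> 'm::metric_space \<Rightarrow> 'm set \<Rightarrow> real" where
  "trunc_dist \<delta> x S = (if infdist x S \<le> \<delta> then infdist x S else 1)"

definition hyperbolic_time ::
    "('m::metric_space, 'n::finite) chart set \<Rightarrow> ('m, 'n) metric_field \<Rightarrow> ('m \<Rightarrow> 'm) \<Rightarrow> 'm set \<Rightarrow>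
     real \<Rightarrow> real \<Rightarrow> real \<Rightarrow> 'm \<Rightarrow> nat \<Rightarrow> bool" where
  "hyperbolic_time A g f S b \<sigma> \<delta> x n \<longleftrightarrow>
     n \<ge> 1 \<and>
     (\<forall>k\<in>{1..n}.
        (\<Prod>j=n-k..<n. inv_deriv_norm A g f ((f ^^ j) x)) \<le> \<sigma> ^ k \<and>
        (S \<noteq> {} \<longrightarrow> trunc_dist \<delta> ((f ^^ (n - k)) x) S \<ge> \<sigma> powr (b * real k)))"

text \<open>Meaningful only at points that have a hyperbolic time.\<close>

definition first_hyperbolic_time ::
    "('m::metric_space, 'n::finite) chart set \<Rightarrow> ('m, 'n) metric_field \<Rightarrow> ('m \<Rightarrow> 'm) \<Rightarrow> 'm set \<Rightarrow>
     real \<Rightarrow> real \<Rightarrow> real \<Rightarrow> 'm \<Rightarrow> nat" where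
  "first_hyperbolic_time A g f S b \<sigma> \<delta> x = (LEAST n. hyperbolic_time A g f S b \<sigma> \<delta> x n)"

end

theory Submission
  imports Defs
begin

text \<open>
  The invariant measure is a limit of the averages of the push-forwards \<open>f\<^sup>j\<^sub>*m\<close>; the point is that
  all of them are bounded by one finite measure which is absolutely continuous with respect to \<open>m\<close>.

  At a hyperbolic time \<open>n\<close> of \<open>x\<close> the backward contraction wins over the singularity: the condition
  on the distance to \<open>S\<close> makes the variation of \<open>ln \<parallel>Df\<^sup>-\<^sup>1\<parallel>\<close> on the ball of radius
  \<open>\<rho> \<sigma>\<^sup>k\<^sup>/\<^sup>2\<close> about \<open>f\<^sup>n\<^sup>-\<^sup>k(x)\<close> at most \<open>ln \<sigma>\<^sup>-\<^sup>1\<^sup>/\<^sup>2\<close>, and that of \<open>ln |det Df\<^sup>-\<^sup>1|\<close> at most a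
  multiple of \<open>\<sigma>\<^sup>k\<^sup>/\<^sup>4\<close> (\<open>control_along_hyperbolic_time\<close>). Paths near \<open>f\<^sup>n(x)\<close> therefore lift through
  \<open>f\<^sup>n\<close> to paths starting at \<open>x\<close> that never leave these balls, so that \<open>f\<^sup>n\<close> has an inverse branch
  over a set of fixed size about \<open>f\<^sup>n(x)\<close> (\<open>inverse_branch\<close>). The variations of the Jacobian along the
  branch form a convergent geometric series, hence the branch distorts volume by a bounded factor.
  Different branches over the same set have disjoint images, whose volumes add up to at most one.
  Together this gives a constant \<open>C\<close> with \<open>m(E \<inter> f\<^sup>-\<^sup>n X) \<le> C m(X)\<close> for all \<open>n\<close>, if \<open>n\<close> is a
  hyperbolic time of every point of \<open>E\<close> (\<open>transfer_bound_over\<close>).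

  Hyperbolic times concatenate: if \<open>n\<close> is one for \<open>x\<close> and \<open>k\<close> is one for \<open>f\<^sup>n(x)\<close>, then \<open>n + k\<close> is one
  for \<open>x\<close>. So each time \<open>j\<close> is preceded by a hyperbolic time \<open>n\<close> of \<open>x\<close> (or by \<open>n = 0\<close>) with
  \<open>h(f\<^sup>n(x)) > j - n\<close>, and the transfer bound at time \<open>n\<close> yields
  \<open>f\<^sup>j\<^sub>*m \<le> C (\<Sum>k. f\<^sup>k\<^sub>*(m|{h > k}))\<close>. The measure on the right has total mass \<open>C \<integral>h dm\<close>, which is
  finite, and it is absolutely continuous because \<open>f\<close> is nonsingular
  (\<open>invariant_measure_of_integrable_return_time\<close>). A cluster point of the averages, taken on all sets
  simultaneously, inherits the bound, which makes it countably additive and absolutely continuous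
  (\<open>invariant_measure_of_dominated_averages\<close>).

  The geometry enters through three facts. Near a point the distance is, up to a factor close to
  one, the norm of the metric at that point in coordinates (\<open>dist_in_chart\<close>); consequently \<open>f\<close> expands
  distances from a point at an infinitesimal rate of at least \<open>1 / \<parallel>Df\<^sup>-\<^sup>1\<parallel>\<close> (\<open>locally_expands\<close>), and
  Lipschitz constants of lifted paths can be estimated in the metric space itself, without
  differentiating them. Volume changes by \<open>|det Df\<^sup>-\<^sup>1|\<close> (\<open>local_jacobian_bounds\<close>). If \<open>S\<close> is
  empty, the required regularity of \<open>Df\<close> comes from \<open>f\<close> being of class C2 on a compact space.
\<close>

section \<open>Invariant measures from integrable return times\<close>

text \<open>
  By Tychonoff's theorem the set functions with values in the unit interval form a compact space
  under pointwise convergence. The filter \<open>G\<close> takes the place of a subsequence along which the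
  values converge on all sets at once.
\<close>

lemma cesaro_cluster_set_function:
  fixes a :: "nat \<Rightarrow> 'a set \<Rightarrow> real"
  assumes "\<And>n X. a n X \<in> {0..1}"
  obtains \<phi> G where "G \<noteq> bot" "G \<le> filtermap a sequentially"
    "\<And>X. ((\<lambda>\<psi>. \<psi> X) \<longlongrightarrow> \<phi> X) G"
proof -
  define K where "K = (UNIV \<rightarrow>\<^sub>E {0..1} :: ('a set \<Rightarrow> real) set)"
  have "compactin (product_topology (\<lambda>_. euclidean) UNIV) K"
    unfolding K_def by (subst compactin_PiE) auto
  then have K: "compact K"
    by (simp add: euclidean_product_topology)
  have "eventually (\<lambda>\<psi>. \<psi> \<in> K) (filtermap a sequentially)"
    using assms by (auto simp: eventually_filtermap K_def PiE_def extensional_def)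
  then obtain \<phi> where \<phi>: "inf (nhds \<phi>) (filtermap a sequentially) \<noteq> bot"
    using K[unfolded compact_filter, rule_format, of "filtermap a sequentially"]
    by (auto simp: filtermap_bot_iff)
  define G where "G = inf (nhds \<phi>) (filtermap a sequentially)"
  have "((\<lambda>\<psi>. \<psi> X) \<longlongrightarrow> \<phi> X) G" for X
  proof -
    have "((\<lambda>\<psi>. \<psi> X) \<longlongrightarrow> \<phi> X) (nhds \<phi>)"
    proof (rule topological_tendstoI)
      fix T :: "real set" assume "open T" "\<phi> X \<in> T"
      moreover have "open ((\<lambda>\<psi>. \<psi> X) -` T)"
        by (rule open_vimage[OF \<open>open T\<close> continuous_on_product_coordinates])
      ultimately show "eventually (\<lambda>\<psi>. \<psi> X \<in> T) (nhds \<phi>)"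
        unfolding eventually_nhds by (intro exI[of _ "(\<lambda>\<psi>. \<psi> X) -` T"]) auto
    qed
    then show ?thesis unfolding G_def by (rule tendsto_mono[rotated]) simp
  qed
  then show thesis using \<phi> that[of G \<phi>] unfolding G_def by auto
qed


text \<open>
  A cluster point of the averages is finitely additive, and invariant because applying \<open>f\<close> changes
  the \<open>n\<close>-th average by at most \<open>1 / n\<close>. Being bounded by \<open>\<nu>\<close> it is continuous from above at the empty
  set, hence countably additive, and it vanishes on null sets.
\<close>

theorem invariant_measure_of_dominated_averages:
  fixes M :: "'a measure" and f :: "'a \<Rightarrow> 'a" and \<nu> :: "'a set \<Rightarrow> real"
  assumes "prob_space M" and f [measurable]: "f \<in> M \<rightarrow>\<^sub>M M"
    and dom: "\<And>j X. X \<in> sets M \<Longrightarrow> measure M ((f ^^ j) -` X \<inter> space M) \<le> \<nu> X"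
    and null: "\<And>X. X \<in> null_sets M \<Longrightarrow> \<nu> X = 0"
    and cont: "\<And>A. range A \<subseteq> sets M \<Longrightarrow> decseq A \<Longrightarrow> (\<Inter>i. A i) = {} \<Longrightarrow> (\<lambda>i. \<nu> (A i)) \<longlonglongrightarrow> 0"
  shows "\<exists>\<mu>. prob_space \<mu> \<and> sets \<mu> = sets M \<and> absolutely_continuous M \<mu> \<and> distr \<mu> \<mu> f = \<mu>"
proof -
  interpret prob_space M by fact
  have fj [measurable]: "f ^^ j \<in> M \<rightarrow>\<^sub>M M" for j by (induction j) (auto intro: measurable_comp f)
  define p where "p j X = measure M ((f ^^ j) -` X \<inter> space M)" for j X
  define a where "a n X = (\<Sum>j<Suc n. p j X) / real (Suc n)" for n X
  have p01: "0 \<le> p j X" "p j X \<le> 1" for j X by (auto simp: p_def)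
  have a01: "a n X \<in> {0..1}" for n X
  proof -
    have "(\<Sum>j<Suc n. p j X) \<le> real (Suc n)"
      using sum_bounded_above[of "{..<Suc n}" "\<lambda>j. p j X" 1] p01 by simp
    moreover have "0 \<le> (\<Sum>j<Suc n. p j X)" by (intro sum_nonneg p01)
    ultimately show ?thesis unfolding a_def by (simp add: divide_simps del: sum.lessThan_Suc)
  qed
  obtain \<phi> G where G: "G \<noteq> bot" "G \<le> filtermap a sequentially"
    and lim: "\<And>X. ((\<lambda>\<psi>. \<psi> X) \<longlongrightarrow> \<phi> X) G"
    by (rule cesaro_cluster_set_function[of a, OF a01]) (rule that)
  have evG: "eventually P G" if "\<And>n. P (a n)" for P
    using G(2) that unfolding le_filter_def eventually_filtermap by (auto intro: always_eventually)
  have \<phi>_nonneg: "0 \<le> \<phi> X" for X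
    by (rule tendsto_lowerbound[OF lim evG G(1)]) (use a01 in auto)
  have \<phi>_dom: "\<phi> X \<le> \<nu> X" if "X \<in> sets M" for X
  proof (rule tendsto_upperbound[OF lim evG G(1)])
    fix n
    have "(\<Sum>j<Suc n. p j X) \<le> real (Suc n) * \<nu> X"
      using sum_bounded_above[of "{..<Suc n}" "\<lambda>j. p j X" "\<nu> X"] dom[OF that] by (simp add: p_def)
    then show "a n X \<le> \<nu> X" by (simp add: a_def divide_simps mult.commute)
  qed
  have \<phi>_space: "\<phi> (space M) = 1"
  proof (rule tendsto_unique[OF G(1) lim])
    have "p j (space M) = 1" for j
    proof -
      have "(f ^^ j) -` space M \<inter> space M = space M" using measurable_space[OF fj] by auto
      then show ?thesis by (simp add: p_def prob_space)
    qed
    then have "a n (space M) = 1" for n by (simp add: a_def del: sum.lessThan_Suc)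
    then show "((\<lambda>\<psi>. \<psi> (space M)) \<longlongrightarrow> 1) G"
      by (intro tendsto_eventually evG)
  qed
  have \<phi>_add: "\<phi> (X \<union> Y) = \<phi> X + \<phi> Y" if "X \<in> sets M" "Y \<in> sets M" "X \<inter> Y = {}" for X Y
  proof (rule tendsto_unique[OF G(1) lim])
    have "p j (X \<union> Y) = p j X + p j Y" for j
    proof -
      have "(f ^^ j) -` (X \<union> Y) \<inter> space M = ((f ^^ j) -` X \<inter> space M) \<union> ((f ^^ j) -` Y \<inter> space M)" by auto
      then show ?thesis unfolding p_def using that
        by (simp only:) (rule finite_measure_Union, auto)
    qed
    then have "a n (X \<union> Y) = a n X + a n Y" for n
      by (simp add: a_def sum.distrib add_divide_distrib del: sum.lessThan_Suc)
    then have "eventually (\<lambda>\<psi>. \<psi> X + \<psi> Y = \<psi> (X \<union> Y)) G" by (intro evG) simp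
    then show "((\<lambda>\<psi>. \<psi> (X \<union> Y)) \<longlongrightarrow> \<phi> X + \<phi> Y) G"
      by (rule Lim_transform_eventually[OF tendsto_add[OF lim lim]])
  qed
  have \<phi>_inv: "\<phi> (f -` X \<inter> space M) = \<phi> X" if X: "X \<in> sets M" for X
  proof -
    have shift: "p j (f -` X \<inter> space M) = p (Suc j) X" for j
    proof -
      have "(f ^^ j) -` (f -` X \<inter> space M) \<inter> space M = (f ^^ Suc j) -` X \<inter> space M"
        using measurable_space[OF fj] by auto
      then show ?thesis by (simp only: p_def)
    qed
    have diff: "\<bar>a n (f -` X \<inter> space M) - a n X\<bar> \<le> 1 / real (Suc n)" for n
    proof -
      have "(\<Sum>j<Suc n. p (Suc j) X) - (\<Sum>j<Suc n. p j X) = p (Suc n) X - p 0 X"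
        unfolding sum_subtractf[symmetric] by (rule sum_lessThan_telescope)
      then have "a n (f -` X \<inter> space M) - a n X = (p (Suc n) X - p 0 X) / real (Suc n)"
        by (simp only: a_def shift diff_divide_distrib[symmetric])
      then show ?thesis using p01[of "Suc n" X] p01[of 0 X]
        by (simp add: abs_le_iff divide_simps)
    qed
    have "((\<lambda>n. 1 / real (Suc n)) \<longlongrightarrow> 0) sequentially"
      by (rule LIMSEQ_Suc) (rule lim_1_over_n)
    then have z: "((\<lambda>n. a n (f -` X \<inter> space M) - a n X) \<longlongrightarrow> 0) sequentially"
      by (rule Lim_null_comparison[rotated]) (use diff in auto)
    have "((\<lambda>\<psi>. \<psi> (f -` X \<inter> space M) - \<psi> X) \<longlongrightarrow> 0) (filtermap a sequentially)"
      using z by (simp add: filterlim_filtermap)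
    then have "((\<lambda>\<psi>. \<psi> (f -` X \<inter> space M) - \<psi> X) \<longlongrightarrow> 0) G"
      using G(2) tendsto_mono by blast
    moreover have "((\<lambda>\<psi>. \<psi> (f -` X \<inter> space M) - \<psi> X) \<longlongrightarrow> \<phi> (f -` X \<inter> space M) - \<phi> X) G"
      by (intro tendsto_diff lim)
    ultimately have "\<phi> (f -` X \<inter> space M) - \<phi> X = 0" using tendsto_unique[OF G(1)] by blast
    then show ?thesis by simp
  qed
  define \<mu> where "\<mu> = measure_of (space M) (sets M) (\<lambda>X. ennreal (\<phi> X))"
  have \<phi>0: "\<phi> {} = 0" using \<phi>_add[of "{}" "{}"] by simp
  have ca: "countably_additive (sets M) (\<lambda>X. ennreal (\<phi> X))"
  proof (rule sets.empty_continuous_imp_countably_additive)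
    show "positive (sets M) (\<lambda>X. ennreal (\<phi> X))" by (auto simp: positive_def \<phi>0)
    show "additive (sets M) (\<lambda>X. ennreal (\<phi> X))"
      unfolding additive_def using \<phi>_add \<phi>_nonneg by (simp add: ennreal_plus)
    fix A assume A: "range A \<subseteq> sets M" "decseq A" "(\<Inter>i. A i) = {}"
    have "(\<lambda>i. \<phi> (A i)) \<longlonglongrightarrow> 0"
      by (rule tendsto_sandwich[OF _ _ tendsto_const cont[OF A]])
         (use \<phi>_nonneg \<phi>_dom A(1) in \<open>auto intro!: always_eventually\<close>)
    then show "(\<lambda>i. ennreal (\<phi> (A i))) \<longlonglongrightarrow> 0"
      by (metis ennreal_0 tendsto_ennrealI)
  qed auto
  have sets\<mu> [simp]: "sets \<mu> = sets M" and space\<mu> [simp]: "space \<mu> = space M"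
    unfolding \<mu>_def by (auto simp: sets.space_closed sets.sigma_sets_eq)
  have em: "emeasure \<mu> X = ennreal (\<phi> X)" if "X \<in> sets M" for X
    unfolding \<mu>_def
    by (rule emeasure_measure_of_sigma[OF sets.sigma_algebra_axioms _ ca that]) (simp add: positive_def \<phi>0)
  have "prob_space \<mu>"
    by (rule prob_spaceI) (simp add: em \<phi>_space)
  moreover have "absolutely_continuous M \<mu>"
    unfolding absolutely_continuous_def
  proof
    fix X assume X: "X \<in> null_sets M"
    then have "\<phi> X \<le> 0" using \<phi>_dom[of X] null[of X] by auto
    then show "X \<in> null_sets \<mu>" using X em[of X] by (auto simp: null_sets_def ennreal_neg)
  qed
  moreover have "distr \<mu> \<mu> f = \<mu>"
  proof (rule measure_eqI)
    have fm: "f \<in> \<mu> \<rightarrow>\<^sub>M \<mu>" using f by (simp add: measurable_def)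
    fix X assume "X \<in> sets (distr \<mu> \<mu> f)"
    then have X: "X \<in> sets M" by simp
    then show "emeasure (distr \<mu> \<mu> f) X = emeasure \<mu> X"
      using measurable_sets[OF f X] by (simp add: emeasure_distr[OF fm] em \<phi>_inv)
  qed simp
  ultimately show ?thesis using sets\<mu> by blast
qed

text \<open>
  The orbit of \<open>0\<close> under \<open>n \<mapsto> n + h(f\<^sup>n x)\<close>. By concatenation all its positive
  members are hyperbolic times if \<open>h\<close> is the first one, and it depends measurably on \<open>x\<close> through \<open>h\<close>
  and \<open>f\<close>.
\<close>

inductive return_time :: "('a \<Rightarrow> 'a) \<Rightarrow> ('a \<Rightarrow> nat) \<Rightarrow> 'a \<Rightarrow> nat \<Rightarrow> bool" for f h x where
  zero: "return_time f h x 0"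
| step: "return_time f h x n \<Longrightarrow> return_time f h x (n + h ((f ^^ n) x))"

text \<open>
  A time \<open>j\<close> lies between two consecutive return times \<open>n\<close> and \<open>n + h(f\<^sup>n x)\<close> of \<open>x\<close>. Summing the
  transfer bounds over \<open>n\<close> shows \<open>f\<^sup>j\<^sub>*M \<le> C (\<Sum>k. f\<^sup>k\<^sub>*(M|{h > k}))\<close>. The value at \<open>X\<close> of the measure on
  the right is the integral of \<open>\<Sum>k<h x. indicator X (f\<^sup>k x)\<close>, so that integrability of \<open>h\<close> gives
  its continuity at the empty set by dominated convergence.
\<close>

theorem invariant_measure_of_integrable_return_time:
  fixes M :: "'a measure" and f :: "'a \<Rightarrow> 'a" and H :: "'a \<Rightarrow> nat \<Rightarrow> bool" and C :: real
  assumes "prob_space M" and f [measurable]: "f \<in> M \<rightarrow>\<^sub>M M"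
    and nonsingular: "\<And>X. X \<in> null_sets M \<Longrightarrow> f -` X \<inter> space M \<in> null_sets M"
    and concat: "\<And>x n k. H x n \<Longrightarrow> H ((f ^^ n) x) k \<Longrightarrow> H x (n + k)"
    and pos: "\<And>x n. H x n \<Longrightarrow> 0 < n"
    and transfer: "\<And>n E X. E \<in> sets M \<Longrightarrow> (\<And>x. x \<in> E \<Longrightarrow> H x n) \<Longrightarrow> X \<in> sets M \<Longrightarrow>
          measure M (E \<inter> (f ^^ n) -` X) \<le> C * measure M X"
    and ae: "AE x in M. \<exists>n. H x n"
    and int: "integrable M (\<lambda>x. real (LEAST n. H x n))"
  shows "\<exists>\<mu>. prob_space \<mu> \<and> sets \<mu> = sets M \<and> absolutely_continuous M \<mu> \<and> distr \<mu> \<mu> f = \<mu>"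
proof -
  interpret prob_space M by fact
  define h where "h x = (LEAST n. H x n)" for x
  have H_h: "H x (h x)" if "\<exists>n. H x n" for x using that unfolding h_def by (metis LeastI)
  have inth: "integrable M (\<lambda>x. real (h x))" using int unfolding h_def .
  then have [measurable]: "(\<lambda>x. real (h x)) \<in> borel_measurable M" by simp
  have "(\<lambda>x. nat \<lfloor>real (h x)\<rfloor>) \<in> M \<rightarrow>\<^sub>M count_space UNIV" by measurable
  then have h [measurable]: "h \<in> M \<rightarrow>\<^sub>M count_space UNIV" by simp
  have fj [measurable]: "f ^^ j \<in> M \<rightarrow>\<^sub>M M" for j by (induction j) (auto intro: measurable_comp f)
  have fsp: "(f ^^ j) x \<in> space M" if "x \<in> space M" for j x
    using measurable_space[OF fj that] .
  have null_pre: "(f ^^ j) -` X \<inter> space M \<in> null_sets M" if "X \<in> null_sets M" for j X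
  proof (induction j)
    case 0 
    have "X \<subseteq> space M" using that by (meson null_setsD2 sets.sets_into_space)
    then show ?case using that by (simp add: Int_absorb2)
  next
    case (Suc j)
    have eq: "(f ^^ Suc j) -` X \<inter> space M = f -` ((f ^^ j) -` X \<inter> space M) \<inter> space M"
      using measurable_space[OF f] by (auto simp: funpow_Suc_right simp del: funpow.simps)
    show ?case using nonsingular[OF Suc] unfolding eq .
  qed
  obtain N where N: "\<And>x. x \<in> space M - N \<Longrightarrow> \<exists>n. H x n" "N \<in> null_sets M"
    using AE_E3[OF ae] by blast
  \<comment> \<open>outside \<open>Z\<close> every point of the orbit has a hyperbolic time\<close>
  define Z where "Z = (\<Union>j. (f ^^ j) -` N \<inter> space M)"
  have Z: "Z \<in> null_sets M" unfolding Z_def by (rule null_sets_UN) (rule null_pre[OF N(2)])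
  define G where "G = space M - Z"
  have [measurable]: "G \<in> sets M" using Z by (auto simp: G_def)
  have G: "H ((f ^^ j) x) (h ((f ^^ j) x))" "0 < h ((f ^^ j) x)" if "x \<in> G" for j x
  proof -
    have "(f ^^ j) x \<in> space M - N" using that fsp by (auto simp: G_def Z_def)
    then show "H ((f ^^ j) x) (h ((f ^^ j) x))" using N(1) H_h by blast
    then show "0 < h ((f ^^ j) x)" using pos by blast
  qed
  define E where "E n = {x \<in> G. return_time f h x n}" for n
  have return_H: "n = 0 \<or> H x n" if "return_time f h x n" "x \<in> G" for x n
    using that(1)
  proof induction
    case (step n)
    then show ?case using G(1)[OF that(2), of n] concat[of x n] by auto
  qed simp
  have E_step: "E n = (\<Union>k<n. E k \<inter> {x \<in> space M. h ((f ^^ k) x) = n - k})" if "0 < n" for n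
  proof -
    have "\<exists>k<n. return_time f h x k \<and> h ((f ^^ k) x) = n - k" if "return_time f h x n" "x \<in> G" for x
      using that(1)
    proof cases
      case (step k)
      then show ?thesis using G(2)[OF that(2), of k] by (intro exI[of _ k]) simp
    qed (use \<open>0 < n\<close> in simp)
    moreover have "return_time f h x n" if "return_time f h x k" "k < n" "h ((f ^^ k) x) = n - k" for x k
      using return_time.step[OF that(1)] that by simp
    ultimately show ?thesis unfolding E_def G_def by blast
  qed
  have E [measurable]: "E n \<in> sets M" for n
  proof (induction n rule: less_induct)
    case (less n)
    show ?case
    proof (cases "n = 0")
      case True
      have "E 0 = G" by (auto simp: E_def return_time.zero)
      then show ?thesis using True by simp
    next
      case False
      have "E k \<inter> {x \<in> space M. h ((f ^^ k) x) = n - k} \<in> sets M" if "k < n" for k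
        using less[OF that] by (intro sets.Int) auto
      then show ?thesis using E_step[of n] False by (auto intro!: sets.finite_UN)
    qed
  qed
  have last_return: "\<exists>n\<le>j. x \<in> E n \<and> j - n < h ((f ^^ n) x)" if "x \<in> G" for x j
  proof -
    define n where "n = Max {n. n \<le> j \<and> return_time f h x n}"
    have fin: "finite {n. n \<le> j \<and> return_time f h x n}" by simp
    have "0 \<in> {n. n \<le> j \<and> return_time f h x n}" by (auto intro: return_time.zero)
    then have "n \<in> {n. n \<le> j \<and> return_time f h x n}"
      unfolding n_def by (intro Max_in[OF fin]) blast
    then have n: "n \<le> j" "return_time f h x n" by auto
    have mx: "k \<le> n" if "k \<le> j" "return_time f h x k" for k
      unfolding n_def using that by (intro Max_ge[OF fin]) auto
    have "j - n < h ((f ^^ n) x)"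
    proof (rule ccontr)
      assume "\<not> j - n < h ((f ^^ n) x)"
      then have "n + h ((f ^^ n) x) \<le> n"
        using n by (intro mx return_time.step) auto
      then show False using G(2)[OF that, of n] by simp
    qed
    then show ?thesis using n that by (auto simp: E_def)
  qed
  define u where "u X x = (\<Sum>k<h x. indicator X ((f ^^ k) x) :: real)" for X x
  have u_meas [measurable]: "u X \<in> borel_measurable M" if [measurable]: "X \<in> sets M" for X
    unfolding u_def
    by (rule measurable_compose_countable[OF _ h, of "\<lambda>n x. \<Sum>k<n. indicator X ((f ^^ k) x)"]) measurable
  have u_bound: "0 \<le> u X x" "u X x \<le> real (h x)" for X x
    using sum_bounded_above[of "{..<h x}" "\<lambda>k. indicator X ((f ^^ k) x) :: real" 1]
    by (auto simp: u_def intro!: sum_nonneg)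
  have u_int: "integrable M (u X)" if "X \<in> sets M" for X
    by (rule Bochner_Integration.integrable_bound[OF inth]) (use that u_bound in auto)
  \<comment> \<open>the maximum covers the return time \<open>0\<close>, for which nothing is transferred\<close>
  define C' where "C' = max 1 C"
  define \<nu> where "\<nu> X = C' * (LINT x|M. u X x)" for X
  show ?thesis
  proof (rule invariant_measure_of_dominated_averages[where \<nu>=\<nu>])
    fix j X assume X [measurable]: "X \<in> sets M"
    define Y where "Y k = {y \<in> space M. k < h y \<and> (f ^^ k) y \<in> X}" for k
    have Y [measurable]: "Y k \<in> sets M" for k unfolding Y_def by measurable
    have Yint: "integrable M (indicator (Y k) :: _ \<Rightarrow> real)" for k
      by (rule integrable_real_indicator[OF Y]) (simp add: less_top[symmetric])
    have sub: "(f ^^ j) -` X \<inter> space M \<subseteq> (\<Union>n\<le>j. E n \<inter> (f ^^ n) -` Y (j - n)) \<union> Z"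
    proof
      fix x assume x: "x \<in> (f ^^ j) -` X \<inter> space M"
      show "x \<in> (\<Union>n\<le>j. E n \<inter> (f ^^ n) -` Y (j - n)) \<union> Z"
      proof (cases "x \<in> Z")
        case False
        then have "x \<in> G" using x by (auto simp: G_def)
        then obtain n where n: "n \<le> j" "x \<in> E n" "j - n < h ((f ^^ n) x)"
          using last_return by blast
        have "(f ^^ (j - n)) ((f ^^ n) x) = (f ^^ j) x"
          using n(1) by (metis comp_apply funpow_add le_add_diff_inverse2)
        then have "(f ^^ n) x \<in> Y (j - n)" using n x fsp[of x n] by (auto simp: Y_def)
        then show ?thesis using n by auto
      qed simp
    qed
    have EY [measurable]: "E n \<inter> (f ^^ n) -` Y k \<in> sets M" for n k
    proof -
      have "E n \<inter> (f ^^ n) -` Y k = E n \<inter> ((f ^^ n) -` Y k \<inter> space M)"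
        using sets.sets_into_space[OF E] by auto
      then show ?thesis by (simp only:) measurable
    qed
    have "(\<Sum>k\<le>j. measure M (Y k)) = (\<Sum>k\<le>j. LINT x|M. indicator (Y k) x)"
      by simp
    also have "\<dots> = (LINT x|M. (\<Sum>k\<le>j. indicator (Y k) x))"
      by (rule Bochner_Integration.integral_sum[symmetric]) (simp_all add: Yint)
    also have "\<dots> \<le> (LINT x|M. u X x)"
    proof (rule integral_mono)
      fix x assume x: "x \<in> space M"
      have "(\<Sum>k\<le>j. indicator (Y k) x) = (\<Sum>k\<le>j. if k \<in> {..<h x} then indicator X ((f ^^ k) x) else 0 :: real)"
        by (rule sum.cong) (use x in \<open>auto simp: Y_def indicator_def\<close>)
      also have "\<dots> = (\<Sum>k\<in>{..j} \<inter> {..<h x}. indicator X ((f ^^ k) x))"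
        by (rule sum.inter_restrict[symmetric]) simp
      also have "\<dots> \<le> u X x" unfolding u_def by (rule sum_mono2) auto
      finally show "(\<Sum>k\<le>j. indicator (Y k) x) \<le> u X x" .
    qed (use u_int X Yint in \<open>simp_all add: Bochner_Integration.integrable_sum\<close>)
    finally have le: "(\<Sum>k\<le>j. measure M (Y k)) \<le> (LINT x|M. u X x)" .
    have "measure M ((f ^^ j) -` X \<inter> space M) \<le> measure M ((\<Union>n\<le>j. E n \<inter> (f ^^ n) -` Y (j - n)) \<union> Z)"
      using sub Z by (intro finite_measure_mono sets.Un sets.finite_UN) auto
    also have "\<dots> = measure M (\<Union>n\<le>j. E n \<inter> (f ^^ n) -` Y (j - n))"
      by (rule measure_Un_null_set[OF _ Z]) (auto intro!: sets.finite_UN)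
    also have "\<dots> \<le> (\<Sum>n\<le>j. measure M (E n \<inter> (f ^^ n) -` Y (j - n)))"
      by (rule finite_measure_subadditive_finite) auto
    also have "\<dots> \<le> (\<Sum>n\<le>j. C' * measure M (Y (j - n)))"
    proof (rule sum_mono)
      fix n
      show "measure M (E n \<inter> (f ^^ n) -` Y (j - n)) \<le> C' * measure M (Y (j - n))"
      proof (cases "n = 0")
        case True
        have "measure M (E n \<inter> (f ^^ n) -` Y (j - n)) \<le> 1 * measure M (Y (j - n))"
          using True by (auto intro!: finite_measure_mono)
        also have "\<dots> \<le> C' * measure M (Y (j - n))"
          by (rule mult_right_mono) (auto simp: C'_def)
        finally show ?thesis .
      next
        case False
        have "measure M (E n \<inter> (f ^^ n) -` Y (j - n)) \<le> C * measure M (Y (j - n))"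
          by (rule transfer) (use return_H False E[of n] Y in \<open>auto simp: E_def\<close>)
        also have "\<dots> \<le> C' * measure M (Y (j - n))"
          by (rule mult_right_mono) (auto simp: C'_def)
        finally show ?thesis .
      qed
    qed
    also have "\<dots> = C' * (\<Sum>k\<le>j. measure M (Y k))"
      unfolding sum_distrib_left[symmetric]
      by (subst sum.nat_diff_reindex[symmetric, of _ "Suc j", unfolded lessThan_Suc_atMost]) simp
    also have "\<dots> \<le> \<nu> X"
      unfolding \<nu>_def by (rule mult_left_mono[OF le]) (simp add: C'_def)
    finally show "measure M ((f ^^ j) -` X \<inter> space M) \<le> \<nu> X" .
  next
    fix X assume X: "X \<in> null_sets M"
    have "AE x in M. \<forall>k. (f ^^ k) x \<notin> X"
      unfolding AE_all_countable
    proof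
      fix k show "AE x in M. (f ^^ k) x \<notin> X"
        by (rule AE_I'[OF null_pre[OF X, of k]]) auto
    qed
    then have "AE x in M. u X x = 0" by eventually_elim (simp add: u_def)
    then have "(LINT x|M. u X x) = 0" using X by (subst integral_cong_AE[where g="\<lambda>_. 0"]) auto
    then show "\<nu> X = 0" by (simp add: \<nu>_def)
  next
    fix A :: "nat \<Rightarrow> 'a set" assume A: "range A \<subseteq> sets M" "decseq A" "(\<Inter>i. A i) = {}"
    have "(\<lambda>i. LINT x|M. u (A i) x) \<longlonglongrightarrow> (LINT x|M. 0)"
    proof (rule integral_dominated_convergence[where w="\<lambda>x. real (h x)"])
      show "AE x in M. (\<lambda>i. u (A i) x) \<longlonglongrightarrow> 0"
      proof (rule AE_I2)
        fix x
        have "(\<lambda>i. indicator (A i) y :: real) \<longlonglongrightarrow> 0" for y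
          using LIMSEQ_indicator_decseq[OF A(2), of y] A(3) by simp
        then have "(\<lambda>i. u (A i) x) \<longlonglongrightarrow> (\<Sum>k<h x. 0)" unfolding u_def by (intro tendsto_sum)
        then show "(\<lambda>i. u (A i) x) \<longlonglongrightarrow> 0" by simp
      qed
    qed (use inth u_bound A(1) in auto)
    then have "(\<lambda>i. C' * (LINT x|M. u (A i) x)) \<longlonglongrightarrow> C' * 0" by (intro tendsto_mult) auto
    then show "(\<lambda>i. \<nu> (A i)) \<longlonglongrightarrow> 0" by (simp add: \<nu>_def)
  qed (use assms in auto)
qed

section \<open>Sections of local homeomorphisms over convex sets\<close>

text \<open>
  The mean value inequality for paths in a metric space. The Lipschitz constants of lifted paths are
  obtained from it, in place of integrals of speeds.
\<close>

lemma lipschitz_of_pointwise_lipschitz: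
  fixes \<xi> :: "real \<Rightarrow> 'm::metric_space"
  assumes "a \<le> b"
    and loc: "\<And>t l. a \<le> t \<Longrightarrow> t \<le> b \<Longrightarrow> L < l \<Longrightarrow>
      \<forall>\<^sub>F s in at t within {a..b}. dist (\<xi> s) (\<xi> t) \<le> l * \<bar>s - t\<bar>"
  shows "dist (\<xi> a) (\<xi> b) \<le> L * (b - a)"
proof (rule field_le_epsilon)
  fix e :: real assume "0 < e"
  define l where "l = L + e / (b - a + 1)"
  have l: "L < l" using \<open>0 < e\<close> \<open>a \<le> b\<close> by (simp add: l_def)
  have "a \<le> a \<and> b \<le> b \<longrightarrow> dist (\<xi> a) (\<xi> b) \<le> l * (b - a)"
    using \<open>a \<le> b\<close>
  proof (induction rule: Bolzano[where P="\<lambda>u v. a \<le> u \<and> v \<le> b \<longrightarrow> dist (\<xi> u) (\<xi> v) \<le> l * (v - u)"])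
    case (trans u v w)
    then show ?case using dist_triangle[of "\<xi> u" "\<xi> w" "\<xi> v"] by (auto simp: algebra_simps)
  next
    case (local t)
    obtain d where d: "d > 0" "\<And>s. s \<in> {a..b} \<Longrightarrow> 0 < dist s t \<Longrightarrow> dist s t < d \<Longrightarrow> dist (\<xi> s) (\<xi> t) \<le> l * \<bar>s - t\<bar>"
      using loc[OF local l] unfolding eventually_at by (auto simp: dist_real_def)
    then have d': "dist (\<xi> s) (\<xi> t) \<le> l * \<bar>s - t\<bar>" if "s \<in> {a..b}" "\<bar>s - t\<bar> < d" for s
      using that by (cases "s = t") (auto simp: dist_real_def)
    show ?case
    proof (intro exI[of _ d] conjI allI impI d(1))
      fix u v assume uv: "u \<le> t \<and> t \<le> v \<and> v - u < d" and ab: "a \<le> u \<and> v \<le> b"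
      have "dist (\<xi> u) (\<xi> v) \<le> dist (\<xi> u) (\<xi> t) + dist (\<xi> v) (\<xi> t)"
        by (rule dist_triangle2)
      also have "\<dots> \<le> l * \<bar>u - t\<bar> + l * \<bar>v - t\<bar>"
        using uv ab by (intro add_mono d') auto
      finally show "dist (\<xi> u) (\<xi> v) \<le> l * (v - u)" using uv by (simp add: algebra_simps)
    qed
  qed
  then have "dist (\<xi> a) (\<xi> b) \<le> l * (b - a)" by simp
  also have "\<dots> = L * (b - a) + e * ((b - a) / (b - a + 1))" by (simp add: l_def algebra_simps)
  also have "\<dots> \<le> L * (b - a) + e * 1"
    using \<open>0 < e\<close> \<open>a \<le> b\<close> by (intro add_left_mono mult_left_mono) auto
  finally show "dist (\<xi> a) (\<xi> b) \<le> L * (b - a) + e" by simp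
qed

text \<open>
  The last condition expresses the continuity of the inverse on \<open>P ` V\<close> in a form that is stable under
  composition and restriction.
\<close>

definition local_homeo_at :: "('a::topological_space \<Rightarrow> 'b::topological_space) \<Rightarrow> 'a set \<Rightarrow> 'a \<Rightarrow> bool" where
  "local_homeo_at P R y \<longleftrightarrow> (\<exists>V. open V \<and> y \<in> V \<and> V \<subseteq> R \<and> inj_on P V \<and> continuous_on V P \<and>
     (\<forall>Z. open Z \<longrightarrow> Z \<subseteq> V \<longrightarrow> open (P ` Z)))"

lemma local_homeo_at_inverse:
  fixes P :: "'a::topological_space \<Rightarrow> 'b::topological_space"
  assumes "local_homeo_at P R y"
  obtains V k where "open V" "y \<in> V" "V \<subseteq> R" "inj_on P V" "open (P ` V)" "continuous_on (P ` V) k"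
    "\<And>v. v \<in> V \<Longrightarrow> k (P v) = v"
proof -
  obtain V where V: "open V" "y \<in> V" "V \<subseteq> R" "inj_on P V" "continuous_on V P"
     "\<And>Z. open Z \<Longrightarrow> Z \<subseteq> V \<Longrightarrow> open (P ` Z)"
    using assms unfolding local_homeo_at_def by blast
  have inv: "inv_into V P (P v) = v" if "v \<in> V" for v using V(4) that by simp
  have "continuous_on (P ` V) (inv_into V P)"
  proof (rule continuous_on_inverse_open_map[OF V(5) refl])
    show "inv_into V P (P v) = v" if "v \<in> V" for v by (rule inv[OF that])
    show "openin (top_of_set (P ` V)) (P ` U)" if "openin (top_of_set V) U" for U
      using that V(1,6) by (simp add: openin_open_eq image_mono)
  qed
  then show thesis using that[of V "inv_into V P"] V inv by auto
qed

text \<open>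
  Two sections that agree at a point agree around it, since \<open>P\<close> is injective near the common value;
  so the set where they agree is open and closed.
\<close>

lemma sections_agree:
  fixes P :: "'a::metric_space \<Rightarrow> 'b::topological_space"
  assumes R: "\<And>y. y \<in> R \<Longrightarrow> local_homeo_at P R y" and C: "connected C"
    and g1: "continuous_on C g1" "\<And>u. u \<in> C \<Longrightarrow> g1 u \<in> R \<and> P (g1 u) = u"
    and g2: "continuous_on C g2" "\<And>u. u \<in> C \<Longrightarrow> g2 u \<in> R \<and> P (g2 u) = u"
    and c: "c \<in> C" "g1 c = g2 c" and u: "u \<in> C"
  shows "g1 u = g2 u"
proof -
  let ?A = "{u \<in> C. g1 u = g2 u}"
  have cl: "closedin (top_of_set C) ?A"
  proof -
    have "closedin (top_of_set C) {x \<in> topspace (top_of_set C). g1 x = g2 x}"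
      by (rule closedin_continuous_maps_eq[of euclidean]) (use g1 g2 in \<open>auto simp: Hausdorff_space_euclidean\<close>)
    then show ?thesis by simp
  qed
  have op: "openin (top_of_set C) ?A"
  proof (subst openin_subopen, intro ballI)
    fix u assume u: "u \<in> ?A"
    obtain V where V: "open V" "g1 u \<in> V" "inj_on P V"
      using R[of "g1 u"] g1(2) u unfolding local_homeo_at_def by blast
    let ?T = "(C \<inter> g1 -` V) \<inter> (C \<inter> g2 -` V)"
    have "openin (top_of_set C) ?T"
      by (intro openin_Int continuous_openin_preimage_gen g1 g2 V)
    moreover have "u \<in> ?T" using u V by auto
    moreover have "?T \<subseteq> ?A"
    proof
      fix v assume v: "v \<in> ?T"
      then have "P (g1 v) = P (g2 v)" using g1(2) g2(2) by auto
      then show "v \<in> ?A" using v inj_onD[OF V(3)] by auto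
    qed
    ultimately show "\<exists>T. openin (top_of_set C) T \<and> u \<in> T \<and> T \<subseteq> ?A" by blast
  qed
  have "?A = C"
    using C[unfolded connected_clopen, rule_format, of ?A] op cl c by auto
  then show ?thesis using u by auto
qed

text \<open>
  If straight paths from \<open>P x\<close> can be lifted to paths that start at \<open>x\<close>, then \<open>P\<close> has a section over
  the whole convex set. Sections over domains that are star-shaped about \<open>P x\<close> agree on common points,
  since a segment leading to \<open>P x\<close> lies in both domains; hence there is a largest one. Suppose that a
  segment from \<open>P x\<close> leaves its domain, first at \<open>p\<close>. The lift of the segment converges to a point over
  \<open>p\<close>, and the local inverse of \<open>P\<close> at this point continues the section to a cone about the segment
  that contains \<open>p\<close>. Using a cone keeps the extended domain star-shaped.
\<close>

theorem section_of_path_lifting: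
  fixes P :: "'a::metric_space \<Rightarrow> 'b::euclidean_space"
  assumes R: "\<And>y. y \<in> R \<Longrightarrow> local_homeo_at P R y"
    and U: "open U" "convex U" and x: "x \<in> R" "P x \<in> U"
    and lift: "\<And>p \<xi>. p \<in> U \<Longrightarrow> continuous_on {0..<1} \<xi> \<Longrightarrow> \<xi> 0 = x \<Longrightarrow>
       (\<And>t. 0 \<le> t \<Longrightarrow> t < 1 \<Longrightarrow> \<xi> t \<in> R \<and> P (\<xi> t) = P x + t *\<^sub>R (p - P x)) \<Longrightarrow>
       \<exists>y\<in>R. (\<xi> \<longlongrightarrow> y) (at_left (1::real))"
  shows "\<exists>g. continuous_on U g \<and> g (P x) = x \<and> (\<forall>u\<in>U. g u \<in> R \<and> P (g u) = u)"
proof -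
  define z where "z = P x"
  define good where "good D g \<longleftrightarrow> open D \<and> D \<subseteq> U \<and> z \<in> D \<and> (\<forall>u\<in>D. closed_segment z u \<subseteq> D) \<and>
     continuous_on D g \<and> g z = x \<and> (\<forall>u\<in>D. g u \<in> R \<and> P (g u) = u)" for D g
  have agree: "g1 u = g2 u" if "good D1 g1" "good D2 g2" "u \<in> D1" "u \<in> D2" for D1 D2 g1 g2 u
  proof (rule sections_agree[OF R, of "closed_segment z u" g1 g2 z])
    have s: "closed_segment z u \<subseteq> D1" "closed_segment z u \<subseteq> D2" using that unfolding good_def by blast+
    show "continuous_on (closed_segment z u) g1" "continuous_on (closed_segment z u) g2"
      using s that unfolding good_def by (auto intro: continuous_on_subset)
    show "g1 v \<in> R \<and> P (g1 v) = v" if "v \<in> closed_segment z u" for v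
      using s \<open>good D1 g1\<close> that unfolding good_def by blast
    show "g2 v \<in> R \<and> P (g2 v) = v" if "v \<in> closed_segment z u" for v
      using s \<open>good D2 g2\<close> that unfolding good_def by blast
  qed (use that in \<open>auto simp: good_def\<close>)
  define Dm where "Dm = \<Union>{D. \<exists>g. good D g}"
  define gm where "gm u = (SOME y. \<exists>D g. good D g \<and> u \<in> D \<and> y = g u)" for u
  have gm: "gm u = g u" if "good D g" "u \<in> D" for D g u
  proof -
    have "\<exists>D g. good D g \<and> u \<in> D \<and> gm u = g u"
      unfolding gm_def by (rule someI_ex) (use that in blast)
    then show ?thesis using agree that by metis
  qed
  obtain D0 g0 where D0: "good D0 g0"
  proof -
    obtain V k where V: "open V" "x \<in> V" "V \<subseteq> R" "inj_on P V" "open (P ` V)" "continuous_on (P ` V) k"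
      and k: "\<And>v. v \<in> V \<Longrightarrow> k (P v) = v"
      using local_homeo_at_inverse[OF R[OF x(1)]] by blast
    have "open (P ` V \<inter> U)" "z \<in> P ` V \<inter> U" using V U x by (auto simp: z_def)
    then obtain r where r: "r > 0" "ball z r \<subseteq> P ` V \<inter> U" by (meson open_contains_ball)
    have "good (ball z r) k"
      unfolding good_def
    proof (intro conjI ballI)
      show "closed_segment z u \<subseteq> ball z r" if "u \<in> ball z r" for u
        using that r(1) by (intro closed_segment_subset) auto
      show "continuous_on (ball z r) k" using V(6) r(2) by (meson continuous_on_subset le_inf_iff)
      show "k z = x" using k[OF V(2)] by (simp add: z_def)
      fix u assume "u \<in> ball z r"
      then obtain v where "v \<in> V" "u = P v" using r(2) by blast
      then show "k u \<in> R" "P (k u) = u" using k V(3) by auto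
    qed (use r in auto)
    then show thesis using that by blast
  qed
  have openDm: "open Dm" unfolding Dm_def by (rule open_Union) (auto simp: good_def)
  have gmDm: "good Dm gm"
    unfolding good_def
  proof (intro conjI ballI)
    show "open Dm" by (rule openDm)
    show "Dm \<subseteq> U" by (auto simp: Dm_def good_def)
    show "z \<in> Dm" using D0 by (auto simp: Dm_def good_def)
    show "closed_segment z u \<subseteq> Dm" if u: "u \<in> Dm" for u
    proof -
      obtain D g where Dg: "good D g" "u \<in> D" using u unfolding Dm_def by blast
      then have "closed_segment z u \<subseteq> D" by (simp add: good_def)
      also have "D \<subseteq> Dm" using Dg unfolding Dm_def by blast
      finally show ?thesis .
    qed
    show "continuous_on Dm gm"
      unfolding continuous_on_eq_continuous_at[OF openDm]
    proof
      fix u assume u: "u \<in> Dm"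
      obtain D g where Dg: "good D g" "u \<in> D" using u unfolding Dm_def by blast
      then have "open D" "continuous_on D g" by (auto simp: good_def)
      then have "continuous_on D gm" using gm[OF Dg(1)] continuous_on_cong by fastforce
      then show "isCont gm u" using \<open>open D\<close> Dg(2) by (simp add: continuous_on_eq_continuous_at)
    qed
    show "gm z = x" using D0 gm[OF D0, of z] by (auto simp: good_def)
    fix u assume u: "u \<in> Dm"
    obtain D g where Dg: "good D g" "u \<in> D" using u unfolding Dm_def by blast
    then have "g u \<in> R" "P (g u) = u" by (auto simp: good_def)
    then show "gm u \<in> R" "P (gm u) = u" using gm[OF Dg] by auto
  qed
  have Dm_max: "D \<subseteq> Dm" if "good D g" for D g using that unfolding Dm_def by blast
  have "Dm = U"
  proof (rule ccontr)
    assume "Dm \<noteq> U"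
    then obtain w where w: "w \<in> U" "w \<notin> Dm" using gmDm by (auto simp: good_def)
    let ?T = "{t \<in> {0..1}. z + t *\<^sub>R (w - z) \<in> - Dm}"
    have cT: "closed ?T"
    proof -
      have "closed ({0..1::real} \<inter> (\<lambda>t. z + t *\<^sub>R (w - z)) -` (- Dm))"
        by (intro closed_Int closed_vimage closed_Compl openDm continuous_intros)
      moreover have "?T = {0..1::real} \<inter> (\<lambda>t. z + t *\<^sub>R (w - z)) -` (- Dm)" by auto
      ultimately show ?thesis by simp
    qed
    have oneT: "1 \<in> ?T" using w by simp
    have bb: "bdd_below ?T" by (rule bdd_belowI[of _ 0]) auto
    have tT: "Inf ?T \<in> ?T" by (rule closed_contains_Inf[OF _ bb cT]) (use oneT in blast)
    define t0 where "t0 = Inf ?T"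
    define p where "p = z + t0 *\<^sub>R (w - z)"
    have t0: "0 \<le> t0" "t0 \<le> 1" "p \<notin> Dm" using tT by (auto simp: t0_def p_def)
    have zD: "z \<in> Dm" using gmDm by (simp add: good_def)
    then have "p \<noteq> z" using t0 by auto
    have before: "z + t *\<^sub>R (p - z) \<in> Dm" if "0 \<le> t" "t < 1" for t
    proof (rule ccontr)
      assume "z + t *\<^sub>R (p - z) \<notin> Dm"
      moreover have "t * t0 \<le> 1" using that t0 by (intro mult_le_one) auto
      ultimately have "t * t0 \<in> ?T" using that t0 by (auto simp: p_def)
      then have "t0 \<le> t * t0" unfolding t0_def by (rule cInf_lower[OF _ bb])
      then have "t0 * (1 - t) \<le> 0" by (simp add: algebra_simps)
      then have "t0 = 0" using that t0 by (simp add: mult_le_0_iff)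
      then show False using \<open>p \<noteq> z\<close> by (simp add: p_def)
    qed
    have pU: "p \<in> U"
    proof -
      have "closed_segment z w \<subseteq> U" using U(2) w(1) x(2) by (auto simp: z_def closed_segment_subset)
      moreover have "p \<in> closed_segment z w"
        unfolding in_segment by (rule exI[of _ t0]) (use t0 in \<open>simp add: p_def algebra_simps\<close>)
      ultimately show ?thesis by blast
    qed
    define \<xi> where "\<xi> t = gm (z + t *\<^sub>R (p - z))" for t
    have \<xi>: "\<xi> t \<in> R" "P (\<xi> t) = z + t *\<^sub>R (p - z)" if "0 \<le> t" "t < 1" for t
      using before[OF that] gmDm by (auto simp: \<xi>_def good_def)
    have "\<exists>y\<in>R. (\<xi> \<longlongrightarrow> y) (at_left 1)"
    proof (rule lift[OF pU])
      show "continuous_on {0..<1} \<xi>"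
        unfolding \<xi>_def
      proof (rule continuous_on_compose2[of Dm gm])
        show "continuous_on Dm gm" using gmDm by (simp add: good_def)
        show "continuous_on {0..<1} (\<lambda>t. z + t *\<^sub>R (p - z))" by (intro continuous_intros)
      qed (use before in auto)
      show "\<xi> 0 = x" using gmDm by (simp add: \<xi>_def good_def)
    qed (use \<xi> in \<open>auto simp: z_def\<close>)
    then obtain y where y: "y \<in> R" "(\<xi> \<longlongrightarrow> y) (at_left 1)" by blast
    obtain V k where V: "open V" "y \<in> V" "V \<subseteq> R" "inj_on P V" "open (P ` V)" "continuous_on (P ` V) k"
      and k: "\<And>v. v \<in> V \<Longrightarrow> k (P v) = v"
      using local_homeo_at_inverse[OF R[OF y(1)]] by blast
    have Py: "P y = p"
    proof (rule tendsto_unique[OF trivial_limit_at_left_real])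
      have "isCont P y"
        using R[OF y(1)] unfolding local_homeo_at_def by (auto simp: continuous_on_eq_continuous_at)
      then show "((\<lambda>t. P (\<xi> t)) \<longlongrightarrow> P y) (at_left 1)"
        using y(2) by (rule isCont_tendsto_compose)
      have "((\<lambda>t. z + t *\<^sub>R (p - z)) \<longlongrightarrow> z + 1 *\<^sub>R (p - z)) (at_left 1)"
        by (intro tendsto_intros)
      moreover have "eventually (\<lambda>t. z + t *\<^sub>R (p - z) = P (\<xi> t)) (at_left (1::real))"
        unfolding eventually_at_left_field by (rule exI[of _ 0]) (use \<xi> in auto)
      ultimately show "((\<lambda>t. P (\<xi> t)) \<longlongrightarrow> p) (at_left 1)"
        using Lim_transform_eventually by fastforce
    qed
    have "open (P ` V \<inter> U)" "p \<in> P ` V \<inter> U" using V U pU Py by auto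
    then obtain e where e: "e > 0" "ball p e \<subseteq> P ` V \<inter> U" by (meson open_contains_ball)
    have kb: "k u \<in> V" "P (k u) = u" if ub: "u \<in> ball p e" for u
    proof -
      obtain v where "v \<in> V" "u = P v" using ub e(2) by blast
      then show "k u \<in> V" "P (k u) = u" using k by auto
    qed
    have kcont: "continuous_on (ball p e) k" using V(6) e(2) by (meson continuous_on_subset le_inf_iff)
    \<comment> \<open>a point \<open>q\<close> of the segment, close to \<open>p\<close>, around which the two sections already agree\<close>
    have "eventually (\<lambda>t. \<xi> t \<in> V) (at_left 1)"
      using y(2) V(1,2) by (rule topological_tendstoD)
    moreover have "eventually (\<lambda>t. z + t *\<^sub>R (p - z) \<in> ball p e) (at_left (1::real))"
    proof -
      have "((\<lambda>t. z + t *\<^sub>R (p - z)) \<longlongrightarrow> z + 1 *\<^sub>R (p - z)) (at_left 1)"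
        by (intro tendsto_intros)
      then show ?thesis using e(1) by (intro topological_tendstoD[of _ p]) auto
    qed
    moreover have "eventually (\<lambda>t. 0 < t \<and> t < 1) (at_left (1::real))"
      unfolding eventually_at_left_field by (rule exI[of _ 0]) auto
    ultimately have "eventually (\<lambda>t. \<xi> t \<in> V \<and> z + t *\<^sub>R (p - z) \<in> ball p e \<and> 0 < t \<and> t < 1) (at_left (1::real))"
      by eventually_elim auto
    then obtain t where t: "\<xi> t \<in> V" "z + t *\<^sub>R (p - z) \<in> ball p e" "0 < t" "t < 1"
      using eventually_happens'[OF trivial_limit_at_left_real] by blast
    define q where "q = z + t *\<^sub>R (p - z)"
    have gmc: "continuous_on Dm gm" using gmDm by (simp add: good_def)
    have "open (Dm \<inter> gm -` V \<inter> ball p e)"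
      by (intro open_Int open_ball continuous_open_preimage[OF gmc openDm V(1)])
    moreover have "q \<in> Dm \<inter> gm -` V \<inter> ball p e"
      using before[of t] t by (auto simp: q_def \<xi>_def)
    ultimately obtain r where r: "r > 0" "ball q r \<subseteq> Dm \<inter> gm -` V \<inter> ball p e"
      by (meson open_contains_ball)
    have near: "gm q' = k q'" if "q' \<in> ball q r" for q'
    proof -
      have "q' \<in> Dm" "gm q' \<in> V" using that r by auto
      then have "P (gm q') = q'" using gmDm by (auto simp: good_def)
      then show ?thesis using k[OF \<open>gm q' \<in> V\<close>] by simp
    qed
    \<comment> \<open>the part near \<open>p\<close> of the cone with apex \<open>z\<close> over a small ball about \<open>q\<close>\<close>
    define Co where "Co = (\<Union>s\<in>{1..}. (\<lambda>q'. z + s *\<^sub>R (q' - z)) ` ball q r) \<inter> ball p e"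
    have openCo: "open Co"
      unfolding Co_def
    proof (intro open_Int open_UN open_ball ballI)
      fix s :: real assume s: "s \<in> {1..}"
      have "(\<lambda>q'. z + s *\<^sub>R (q' - z)) ` ball q r = (\<lambda>q'. (z - s *\<^sub>R z) + q') ` ((*\<^sub>R) s ` ball q r)"
        by (auto simp: image_image algebra_simps intro!: image_cong)
      then show "open ((\<lambda>q'. z + s *\<^sub>R (q' - z)) ` ball q r)"
        using s by (simp only:) (intro open_translation open_scaling, auto)
    qed
    have pCo: "p \<in> Co"
      unfolding Co_def
    proof (intro IntI UN_I[of "1 / t"] image_eqI[of _ _ q])
      show "p = z + (1 / t) *\<^sub>R (q - z)" using t by (simp add: q_def)
    qed (use t r e in auto)
    have Co_seg: "\<exists>q'\<in>ball q r. closed_segment q' u \<subseteq> ball p e \<and> closed_segment q' u \<subseteq> closed_segment z u \<and>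
        closed_segment z u \<subseteq> closed_segment z q' \<union> closed_segment q' u \<and> closed_segment q' u \<subseteq> Co"
      if u: "u \<in> Co" for u
    proof -
      obtain s q' where s: "1 \<le> s" "q' \<in> ball q r" "u = z + s *\<^sub>R (q' - z)" "u \<in> ball p e"
        using u unfolding Co_def by auto
      have q'e: "q' \<in> ball p e" using s r by auto
      have q'seg: "q' \<in> closed_segment z u"
      proof -
        have "q' = (1 - 1 / s) *\<^sub>R z + (1 / s) *\<^sub>R u"
          unfolding s(3) using s(1) by (simp add: algebra_simps)
        then show ?thesis unfolding in_segment using s(1) by (intro exI[of _ "1 / s"]) auto
      qed
      have sub: "closed_segment q' u \<subseteq> ball p e"
        using q'e s by (intro closed_segment_subset) auto
      have "closed_segment q' u \<subseteq> Co"
      proof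
        fix v assume v: "v \<in> closed_segment q' u"
        then obtain c where c: "0 \<le> c" "c \<le> 1" "v = (1 - c) *\<^sub>R q' + c *\<^sub>R u" unfolding in_segment by blast
        have "v = z + (1 - c + c * s) *\<^sub>R (q' - z)" using c s by (simp add: algebra_simps)
        moreover have "1 \<le> 1 - c + c * s" using c s mult_left_mono[of 1 s c] by simp
        ultimately show "v \<in> Co" using sub v s(2) unfolding Co_def by (auto intro!: bexI[of _ "1 - c + c * s"])
      qed
      moreover have "closed_segment z u = closed_segment z q' \<union> closed_segment q' u"
        using Un_closed_segment[OF q'seg] by simp
      ultimately show ?thesis using s(2) sub by (intro bexI[of _ q']) auto
    qed
    define g' where "g' u = (if u \<in> Dm then gm u else k u)" for u
    have overlap: "gm u = k u" if u: "u \<in> Co" "u \<in> Dm" for u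
    proof -
      obtain q' where q': "q' \<in> ball q r" "closed_segment q' u \<subseteq> ball p e" "closed_segment q' u \<subseteq> closed_segment z u"
        using Co_seg[OF u(1)] by blast
      have inD: "closed_segment q' u \<subseteq> Dm" using q'(3) u(2) gmDm unfolding good_def by blast
      show ?thesis
      proof (rule sections_agree[OF R, of "closed_segment q' u" gm k q'])
        show "continuous_on (closed_segment q' u) gm" using inD gmc continuous_on_subset by blast
        show "continuous_on (closed_segment q' u) k" using q'(2) kcont continuous_on_subset by blast
        show "gm v \<in> R \<and> P (gm v) = v" if "v \<in> closed_segment q' u" for v
          using inD gmDm that unfolding good_def by blast
        show "k v \<in> R \<and> P (k v) = v" if "v \<in> closed_segment q' u" for v
          using kb[of v] q'(2) V(3) that by blast
      qed (use near[OF q'(1)] in auto)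
    qed
    have g'Co: "g' u = k u" if "u \<in> Co" for u using overlap that by (simp add: g'_def)
    have Coe: "Co \<subseteq> ball p e" by (auto simp: Co_def)
    have "good (Dm \<union> Co) g'"
      unfolding good_def
    proof (intro conjI ballI)
      show "open (Dm \<union> Co)" using openDm openCo by auto
      show "Dm \<union> Co \<subseteq> U" using gmDm Coe e(2) unfolding good_def by blast
      show "z \<in> Dm \<union> Co" using zD by simp
      show "closed_segment z u \<subseteq> Dm \<union> Co" if uDC: "u \<in> Dm \<union> Co" for u
      proof (cases "u \<in> Dm")
        case True then show ?thesis using gmDm unfolding good_def by blast
      next
        case False
        then obtain q' where q': "q' \<in> ball q r" "closed_segment z u \<subseteq> closed_segment z q' \<union> closed_segment q' u"
           "closed_segment q' u \<subseteq> Co"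
          using Co_seg[of u] uDC by blast
        have "q' \<in> Dm" using q'(1) r by auto
        then have "closed_segment z q' \<subseteq> Dm" using gmDm unfolding good_def by blast
        then show ?thesis using q' by blast
      qed
      have "continuous_on Dm g'" using gmc by (rule continuous_on_eq) (simp add: g'_def)
      moreover have "continuous_on Co g'"
        using continuous_on_subset[OF kcont Coe] by (rule continuous_on_eq) (simp add: g'Co)
      ultimately show "continuous_on (Dm \<union> Co) g'"
        using continuous_on_open_Un[OF openDm openCo] by blast
      show "g' z = x" using gmDm zD by (simp add: g'_def good_def)
      fix u assume u: "u \<in> Dm \<union> Co"
      show "g' u \<in> R" "P (g' u) = u"
      proof (atomize (full), cases "u \<in> Dm")
        case True then show "g' u \<in> R \<and> P (g' u) = u" using gmDm by (auto simp: g'_def good_def)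
      next
        case False
        then have "u \<in> ball p e" "g' u = k u" using u Coe by (auto simp: g'_def)
        then show "g' u \<in> R \<and> P (g' u) = u" using kb[of u] V(3) by auto
      qed
    qed
    then show False using Dm_max pCo t0(3) by blast
  qed
  then show ?thesis using gmDm unfolding good_def z_def by blast
qed

lemma local_homeo_at_comp:
  assumes P: "local_homeo_at P R y" and Q: "local_homeo_at Q T (P y)"
  shows "local_homeo_at (Q \<circ> P) R y"
proof -
  obtain V where V: "open V" "y \<in> V" "V \<subseteq> R" "inj_on P V" "continuous_on V P"
     "\<And>Z. open Z \<Longrightarrow> Z \<subseteq> V \<Longrightarrow> open (P ` Z)"
    using P unfolding local_homeo_at_def by blast
  obtain W where W: "open W" "P y \<in> W" "inj_on Q W" "continuous_on W Q"
     "\<And>Z. open Z \<Longrightarrow> Z \<subseteq> W \<Longrightarrow> open (Q ` Z)"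
    using Q unfolding local_homeo_at_def by blast
  show ?thesis
    unfolding local_homeo_at_def
  proof (intro exI[of _ "V \<inter> P -` W"] conjI allI impI)
    show "open (V \<inter> P -` W)" by (rule continuous_open_preimage[OF V(5,1) W(1)])
    show "inj_on (Q \<circ> P) (V \<inter> P -` W)"
      by (rule comp_inj_on) (use V(4) W(3) in \<open>auto intro: inj_on_subset\<close>)
    show "continuous_on (V \<inter> P -` W) (Q \<circ> P)"
      by (rule continuous_on_compose) (use V(5) W(4) in \<open>auto intro: continuous_on_subset\<close>)
    show "open ((Q \<circ> P) ` Z)" if "open Z" "Z \<subseteq> V \<inter> P -` W" for Z
    proof -
      have "open (P ` Z)" using V(6) that by auto
      moreover have "P ` Z \<subseteq> W" using that by auto
      ultimately show ?thesis unfolding image_comp[symmetric] by (rule W(5))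
    qed
  qed (use V W in auto)
qed

lemma local_homeo_at_Int_open:
  assumes "local_homeo_at P R y" "open T" "y \<in> T"
  shows "local_homeo_at P (R \<inter> T) y"
proof -
  obtain V where V: "open V" "y \<in> V" "V \<subseteq> R" "inj_on P V" "continuous_on V P"
     "\<And>Z. open Z \<Longrightarrow> Z \<subseteq> V \<Longrightarrow> open (P ` Z)"
    using assms(1) unfolding local_homeo_at_def by blast
  show ?thesis
    unfolding local_homeo_at_def
    by (rule exI[of _ "V \<inter> T"])
       (use V assms in \<open>auto intro: inj_on_subset continuous_on_subset\<close>)
qed

text \<open>
  Near a value \<open>s q\<close> the points of the image are exactly those whose projection lies in a
  neighbourhood of \<open>q\<close>, by injectivity of \<open>F\<close> there.
\<close>

lemma section_image_open:
  assumes R: "\<And>o'. o' \<in> Q \<Longrightarrow> local_homeo_at F UNIV (s o')" and Q: "open Q"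
    and s: "continuous_on Q s" "\<And>o'. o' \<in> Q \<Longrightarrow> F (s o') = o'"
  shows "open (s ` Q)"
proof (subst open_subopen, intro ballI)
  fix y assume "y \<in> s ` Q"
  then obtain q where q: "q \<in> Q" "y = s q" by blast
  obtain V where V: "open V" "y \<in> V" "inj_on F V" "continuous_on V F"
    using R[OF q(1)] q(2) unfolding local_homeo_at_def by blast
  define N where "N = Q \<inter> s -` V"
  have oN: "open N" unfolding N_def by (rule continuous_open_preimage[OF s(1) Q V(1)])
  have "open (V \<inter> F -` N)" by (rule continuous_open_preimage[OF V(4,1) oN])
  moreover have "y \<in> V \<inter> F -` N" using V q s(2)[OF q(1)] by (auto simp: N_def)
  moreover have "V \<inter> F -` N \<subseteq> s ` Q"
  proof
    fix v assume v: "v \<in> V \<inter> F -` N"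
    then have "F v \<in> Q" "s (F v) \<in> V" by (auto simp: N_def)
    then have "v = s (F v)" using inj_onD[OF V(3), of v "s (F v)"] s(2)[of "F v"] v by auto
    then show "v \<in> s ` Q" using \<open>F v \<in> Q\<close> by blast
  qed
  ultimately show "\<exists>T. open T \<and> y \<in> T \<and> T \<subseteq> s ` Q" by blast
qed

text \<open>
  A compact metric space has a countable base, given by finite covers with balls of radius \<open>1 / n\<close>.
  Balls of it that lie in some member of \<open>\<V>\<close> select the countable subcover.
\<close>

lemma countable_subcover_compact_metric:
  fixes W :: "'m::metric_space set"
  assumes K: "compact (UNIV :: 'm set)" and cov: "\<And>x. x \<in> W \<Longrightarrow> \<exists>V\<in>\<V>. open V \<and> x \<in> V"
  obtains \<V>' where "\<V>' \<subseteq> \<V>" "countable \<V>'" "W \<subseteq> \<Union>\<V>'"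
proof -
  have "\<exists>C. finite C \<and> UNIV \<subseteq> (\<Union>c\<in>C. ball c (1 / real (Suc k)) :: 'm set)" for k
  proof (rule compactE_image[OF K, of UNIV "\<lambda>c. ball c (1 / real (Suc k))"])
    show "UNIV \<subseteq> (\<Union>c. ball c (1 / real (Suc k)) :: 'm set)" by auto
  qed auto
  then obtain C where "\<forall>k. finite (C k) \<and> UNIV \<subseteq> (\<Union>c\<in>C k. ball c (1 / real (Suc k)) :: 'm set)"
    by (rule choice[OF allI, THEN exE])
  then have C: "\<And>k. finite (C k)" "\<And>k. UNIV \<subseteq> (\<Union>c\<in>C k. ball c (1 / real (Suc k)) :: 'm set)"
    by auto
  define \<B> where "\<B> = (\<Union>k. (\<lambda>c. ball c (1 / real (Suc k))) ` C k)"
  have "countable \<B>" unfolding \<B>_def using C(1) by (intro countable_UN) (auto intro: countable_finite)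
  define pick where "pick b = (SOME V. V \<in> \<V> \<and> b \<subseteq> V)" for b :: "'m set"
  have pick: "pick b \<in> \<V>" "b \<subseteq> pick b" if "\<exists>V\<in>\<V>. b \<subseteq> V" for b
  proof -
    have "pick b \<in> \<V> \<and> b \<subseteq> pick b"
      unfolding pick_def by (rule someI_ex) (use that in blast)
    then show "pick b \<in> \<V>" "b \<subseteq> pick b" by auto
  qed
  show thesis
  proof (rule that[of "pick ` {b \<in> \<B>. \<exists>V\<in>\<V>. b \<subseteq> V}"])
    show "pick ` {b \<in> \<B>. \<exists>V\<in>\<V>. b \<subseteq> V} \<subseteq> \<V>" using pick by blast
    show "countable (pick ` {b \<in> \<B>. \<exists>V\<in>\<V>. b \<subseteq> V})"
      using \<open>countable \<B>\<close> by (auto intro: countable_subset)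
    show "W \<subseteq> \<Union> (pick ` {b \<in> \<B>. \<exists>V\<in>\<V>. b \<subseteq> V})"
    proof
      fix x assume "x \<in> W"
      then obtain V where V: "V \<in> \<V>" "open V" "x \<in> V" using cov by blast
      then obtain e where e: "e > 0" "ball x e \<subseteq> V" by (meson open_contains_ball)
      obtain k where k: "1 / real (Suc k) < e / 2" using nat_approx_posE[of "e / 2"] e(1) by auto
      obtain c where c: "c \<in> C k" "x \<in> ball c (1 / real (Suc k))" using C(2)[of k] by blast
      have "ball c (1 / real (Suc k)) \<subseteq> ball x e"
      proof
        fix y assume "y \<in> ball c (1 / real (Suc k))"
        then show "y \<in> ball x e"
          using c(2) k dist_triangle[of x y c] by (simp add: dist_commute)
      qed
      then have "ball c (1 / real (Suc k)) \<in> {b \<in> \<B>. \<exists>V\<in>\<V>. b \<subseteq> V}"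
        using c(1) e V(1) unfolding \<B>_def by blast
      then show "x \<in> \<Union> (pick ` {b \<in> \<B>. \<exists>V\<in>\<V>. b \<subseteq> V})"
        using pick(2) c(2) by blast
    qed
  qed
qed

lemma countable_disjoint_open_sets:
  fixes \<W> :: "'m::metric_space set set"
  assumes K: "compact (UNIV :: 'm set)" and "\<And>W. W \<in> \<W> \<Longrightarrow> open W \<and> W \<noteq> {}" and dis: "disjoint \<W>"
  shows "countable \<W>"
proof -
  obtain \<W>' where W': "\<W>' \<subseteq> \<W>" "countable \<W>'" "\<Union>\<W> \<subseteq> \<Union>\<W>'"
    using countable_subcover_compact_metric[OF K, of "\<Union>\<W>" \<W>] assms(2) by blast
  have "\<W> \<subseteq> \<W>'"
  proof
    fix W assume W: "W \<in> \<W>"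
    then obtain x where x: "x \<in> W" using assms(2) by blast
    then obtain V where V: "V \<in> \<W>'" "x \<in> V" using W W'(3) by blast
    then have "V = W" using dis W'(1) W x unfolding disjoint_def by blast
    then show "W \<in> \<W>'" using V by simp
  qed
  then show ?thesis using W'(2) countable_subset by blast
qed

section \<open>Inverse branches\<close>

text \<open>
  The number \<open>lam x\<close> stands for the norm of \<open>Df(x)\<^sup>-\<^sup>1\<close>. The rate of expansion is only required
  infinitesimally and only from \<open>x\<close>; this suffices for lifting paths.
\<close>

locale pointwise_expanding =
  fixes f :: "'m::metric_space \<Rightarrow> 'm" and S :: "'m set" and lam :: "'m \<Rightarrow> real"
  assumes compact_space: "compact (UNIV :: 'm set)"
    and f_cont: "continuous_on UNIV f"
    and f_local_homeo: "x \<notin> S \<Longrightarrow> local_homeo_at f (- S) x"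
    and lam_pos: "x \<notin> S \<Longrightarrow> 0 < lam x"
    and expands: "x \<notin> S \<Longrightarrow> lam x < l \<Longrightarrow> \<forall>\<^sub>F y in nhds x. dist y x \<le> l * dist (f y) (f x)"
begin

lemma funpow_cont: "continuous_on A (f ^^ n)"
proof -
  have "continuous_on UNIV (f ^^ n)"
  proof (induction n)
    case (Suc n)
    then show ?case using continuous_on_compose[OF Suc continuous_on_subset[OF f_cont]] by simp
  qed (simp add: id_def)
  then show ?thesis by (rule continuous_on_subset) simp
qed

lemma funpow_isCont: "isCont (f ^^ n) x"
  using funpow_cont[of UNIV n] by (simp add: continuous_on_eq_continuous_at)

lemma funpow_local_homeo:
  "(\<And>i. i < n \<Longrightarrow> (f ^^ i) y \<notin> S) \<Longrightarrow> local_homeo_at (f ^^ n) UNIV y"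
proof (induction n)
  case 0
  show ?case unfolding local_homeo_at_def by (rule exI[of _ UNIV]) auto
next
  case (Suc n)
  have "local_homeo_at (f ^^ n) UNIV y"
    by (rule Suc.IH, rule Suc.prems) simp
  moreover have "local_homeo_at f (- S) ((f ^^ n) y)"
    by (rule f_local_homeo, rule Suc.prems) simp
  ultimately have "local_homeo_at (f \<circ> f ^^ n) UNIV y"
    by (rule local_homeo_at_comp)
  then show ?case by (simp only: funpow.simps)
qed

text \<open>
  The infinitesimal rates multiply along the orbit. In the induction step both rates are enlarged by
  the same factor \<open>t > 1\<close>, chosen so that their product becomes \<open>l\<close>.
\<close>

lemma funpow_expands:
  assumes "\<And>i. i < n \<Longrightarrow> (f ^^ i) y \<notin> S" "(\<Prod>i<n. lam ((f ^^ i) y)) < l"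
  shows "\<forall>\<^sub>F y' in nhds y. dist y' y \<le> l * dist ((f ^^ n) y') ((f ^^ n) y)"
  using assms
proof (induction n arbitrary: y l)
  case 0
  have "dist y' y \<le> l * dist y' y" for y'
    using 0(2) mult_right_mono[of 1 l "dist y' y"] by simp
  then show ?case by simp
next
  case (Suc n)
  define a where "a = lam y"
  define b where "b = (\<Prod>i<n. lam ((f ^^ i) (f y)))"
  have orb: "(f ^^ i) (f y) \<notin> S" if "i < n" for i
    using Suc.prems(1)[of "Suc i"] that by (simp add: funpow_swap1)
  have a: "0 < a" unfolding a_def using Suc.prems(1)[of 0] by (intro lam_pos) simp
  have b: "0 < b" unfolding b_def using orb by (intro prod_pos lam_pos) auto
  have ab: "a * b < l"
    using Suc.prems(2) by (simp add: a_def b_def prod.lessThan_Suc_shift funpow_swap1 del: prod.lessThan_Suc)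
  define t where "t = sqrt (l / (a * b))"
  have t: "1 < t" using a b ab unfolding t_def by (auto intro!: real_less_rsqrt simp: divide_simps)
  have tt: "(a * t) * (b * t) = l"
  proof -
    have ab0: "0 < a * b" using a b by simp
    then have "0 \<le> l / (a * b)" using ab by (intro divide_nonneg_pos) linarith+
    then have "t * t = l / (a * b)" unfolding t_def by (simp only: real_sqrt_mult_self abs_of_nonneg)
    then have "(a * b) * (t * t) = l" using a b by (simp only:) (simp add: field_simps)
    then show ?thesis by (simp only: ac_simps)
  qed
  have 1: "\<forall>\<^sub>F y' in nhds y. dist y' y \<le> (a * t) * dist (f y') (f y)"
    by (rule expands) (use Suc.prems(1)[of 0] a t in \<open>simp_all add: a_def[symmetric]\<close>)
  have 2: "\<forall>\<^sub>F w in nhds (f y). dist w (f y) \<le> (b * t) * dist ((f ^^ n) w) ((f ^^ n) (f y))"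
    by (rule Suc.IH[OF orb]) (use b t in \<open>simp_all add: b_def[symmetric]\<close>)
  have "filterlim f (nhds (f y)) (nhds y)"
    using f_cont by (simp add: continuous_on_eq_continuous_at isCont_def tendsto_at_iff_tendsto_nhds)
  from eventually_compose_filterlim[OF 2 this] 1 show ?case
  proof eventually_elim
    case (elim y')
    have "dist y' y \<le> (a * t) * dist (f y') (f y)" using elim(2) .
    also have "\<dots> \<le> (a * t) * ((b * t) * dist ((f ^^ n) (f y')) ((f ^^ n) (f y)))"
      using a t by (intro mult_left_mono elim(1)) auto
    also have "\<dots> = l * dist ((f ^^ n) (f y')) ((f ^^ n) (f y))" unfolding tt[symmetric] by (simp only: mult.assoc)
    finally show ?case by (simp add: funpow_swap1)
  qed
qed

text \<open>
  A branch of the inverse of \<open>f\<^sup>n\<close> over the small set \<open>Q\<close>, found by lifting the straight paths of the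
  coordinates \<open>\<phi>\<close>. As long as the orbit of the lift stays within distance \<open>rad j\<close> of that of \<open>x\<close>, its
  \<open>j\<close>-th image has Lipschitz constant at most \<open>\<Lambda> j * \<dots> * \<Lambda> (n - 1)\<close> times that of the given path. The
  length of the path being less than \<open>r\<close>, the image stays at a distance that is strictly less than
  \<open>rad j\<close>; hence the lift can be continued up to the end of the path.
\<close>

theorem inverse_branch:
  fixes \<psi> :: "'b::euclidean_space \<Rightarrow> 'm"
  assumes n: "0 < n"
    and ctrl: "\<And>j y. j < n \<Longrightarrow> dist ((f ^^ j) x) y < rad j \<Longrightarrow> y \<notin> S \<and> lam y \<le> \<Lambda> j"
    and \<Lambda>: "\<And>j. j < n \<Longrightarrow> 0 < \<Lambda> j"
    and rad: "\<And>j. j < n \<Longrightarrow> (\<Prod>i\<in>{j..<n}. \<Lambda> i) * r \<le> rad j"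
    and U: "open U" "convex U" and Q: "open Q" "(f ^^ n) x \<in> Q" and hom: "homeomorphism U Q \<psi> \<phi>"
    and lip: "0 \<le> K" "\<And>u v. u \<in> U \<Longrightarrow> v \<in> U \<Longrightarrow> dist (\<psi> u) (\<psi> v) \<le> K * dist u v"
    and diam: "\<And>u v. u \<in> U \<Longrightarrow> v \<in> U \<Longrightarrow> K * dist u v < r"
  shows "\<exists>g. continuous_on Q g \<and> g ((f ^^ n) x) = x \<and>
    (\<forall>q\<in>Q. (f ^^ n) (g q) = q \<and> (\<forall>j<n. dist ((f ^^ j) x) ((f ^^ j) (g q)) < rad j))"
proof -
  note hom' = homeomorphism_image1[OF hom] homeomorphism_image2[OF hom] homeomorphism_apply1[OF hom]
    homeomorphism_apply2[OF hom] homeomorphism_cont1[OF hom] homeomorphism_cont2[OF hom]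
  define R where "R = {y. (f ^^ n) y \<in> Q \<and> (\<forall>j<n. dist ((f ^^ j) x) ((f ^^ j) y) < rad j)}"
  define P where "P = \<phi> \<circ> f ^^ n"
  define z where "z = P x"
  have zU: "z \<in> U" using Q hom'(2) by (auto simp: z_def P_def)
  have r: "0 < r" using diam[OF zU zU] by simp
  have prodpos: "0 < (\<Prod>i\<in>{j..<n}. \<Lambda> i)" for j using \<Lambda> by (intro prod_pos) auto
  have radpos: "0 < rad j" if "j < n" for j
    using rad[OF that] prodpos[of j] r by (meson less_le_trans mult_pos_pos)
  have Req: "R = ((f ^^ n) -` Q) \<inter> (\<Inter>j\<in>{..<n}. (f ^^ j) -` ball ((f ^^ j) x) (rad j))"
    by (auto simp: R_def)
  have oR: "open R" unfolding Req
    by (intro open_Int open_INT open_vimage Q funpow_cont ballI finite_lessThan open_ball)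
  have RS: "(f ^^ j) y \<notin> S" "lam ((f ^^ j) y) \<le> \<Lambda> j" if "y \<in> R" "j < n" for y j
    using ctrl that by (auto simp: R_def)
  have homeo: "local_homeo_at P R y" if "y \<in> R" for y
  proof -
    have "local_homeo_at (f ^^ n) UNIV y" using RS[OF that] by (intro funpow_local_homeo)
    moreover have "local_homeo_at \<phi> Q ((f ^^ n) y)"
      unfolding local_homeo_at_def
    proof (intro exI[of _ Q] conjI allI impI)
      show "(f ^^ n) y \<in> Q" using that by (simp add: R_def)
      show "inj_on \<phi> Q" using hom'(4) by (rule inj_on_inverseI)
      show "open (\<phi> ` Z)" if "open Z" "Z \<subseteq> Q" for Z
      proof -
        have "\<phi> ` Z = U \<inter> \<psi> -` Z" using that hom' by force
        then show ?thesis using continuous_open_preimage[OF hom'(5) U(1) that(1)] by simp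
      qed
    qed (use Q hom' in auto)
    ultimately have "local_homeo_at P UNIV y" unfolding P_def by (rule local_homeo_at_comp)
    from local_homeo_at_Int_open[OF this oR that] show ?thesis by simp
  qed
  have xR: "x \<in> R" using Q radpos by (auto simp: R_def)
  have "\<exists>g. continuous_on U g \<and> g (P x) = x \<and> (\<forall>u\<in>U. g u \<in> R \<and> P (g u) = u)"
  proof (rule section_of_path_lifting[OF homeo U xR])
    show "P x \<in> U" using zU by (simp add: z_def)
    fix p \<xi>
    assume p: "p \<in> U" and \<xi>c: "continuous_on {0..<1} \<xi>" and \<xi>0: "\<xi> 0 = x"
      and \<xi>: "\<And>t. 0 \<le> t \<Longrightarrow> t < 1 \<Longrightarrow> \<xi> t \<in> R \<and> P (\<xi> t) = P x + t *\<^sub>R (p - P x)"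
    define \<gamma> where "\<gamma> t = z + t *\<^sub>R (p - z)" for t
    have \<gamma>U: "\<gamma> t \<in> U" if "0 \<le> t" "t \<le> 1" for t
    proof -
      have "\<gamma> t = (1 - t) *\<^sub>R z + t *\<^sub>R p" by (simp add: \<gamma>_def algebra_simps)
      then show ?thesis using convexD[OF U(2) zU p, of "1 - t" t] that by simp
    qed
    have \<gamma>dist: "dist (\<gamma> s) (\<gamma> t) = \<bar>s - t\<bar> * dist p z" for s t
      by (simp add: \<gamma>_def dist_norm scaleR_diff_left[symmetric])
    have fn: "(f ^^ n) (\<xi> t) = \<psi> (\<gamma> t)" if "0 \<le> t" "t < 1" for t
      using \<xi>[OF that] hom'(4)[of "(f ^^ n) (\<xi> t)"] by (auto simp: R_def P_def \<gamma>_def z_def)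
    define L where "L j = (\<Prod>i\<in>{j..<n}. \<Lambda> i) * (K * dist p z)" for j
    have Lnn: "0 \<le> L j" for j unfolding L_def using prodpos[of j] lip(1) by (intro mult_nonneg_nonneg) auto
    have Lip': "dist ((f ^^ j) (\<xi> a)) ((f ^^ j) (\<xi> b)) \<le> L j * (b - a)"
      if j: "j < n" and ab: "0 \<le> a" "a \<le> b" "b < 1" for j a b
    proof (rule lipschitz_of_pointwise_lipschitz[where \<xi>="\<lambda>t. (f ^^ j) (\<xi> t)", OF ab(2)])
      fix t l assume t: "a \<le> t" "t \<le> b" and l: "L j < l"
      obtain l' where l': "(\<Prod>i\<in>{j..<n}. \<Lambda> i) < l'" "l' * (K * dist p z) \<le> l"
      proof (cases "K * dist p z = 0")
        case True
        then show ?thesis using l by (intro that[of "(\<Prod>i\<in>{j..<n}. \<Lambda> i) + 1"]) (auto simp: L_def)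
      next
        case False
        then have "0 < K * dist p z" using lip(1) by (metis less_eq_real_def mult_nonneg_nonneg zero_le_dist)
        then show ?thesis using l by (intro that[of "l / (K * dist p z)"]) (auto simp: L_def pos_less_divide_eq)
      qed
      have l'pos: "0 < l'" using l'(1) prodpos[of j] by linarith
      have t01: "0 \<le> t" "t < 1" using t ab by auto
      have \<xi>R: "\<xi> t \<in> R" using \<xi>[OF t01] by simp
      have "(\<Prod>i<n - j. lam ((f ^^ i) ((f ^^ j) (\<xi> t)))) = (\<Prod>i\<in>{j..<n}. lam ((f ^^ i) (\<xi> t)))"
        using prod.shift_bounds_nat_ivl[of "\<lambda>i. lam ((f ^^ i) (\<xi> t))" 0 j "n - j"] j
        by (simp add: funpow_add atLeast0LessThan add.commute)
      also have "\<dots> \<le> (\<Prod>i\<in>{j..<n}. \<Lambda> i)"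
        using RS[OF \<xi>R] lam_pos by (intro prod_mono) (auto intro: order_less_imp_le)
      also note l'(1)
      finally have less: "(\<Prod>i<n - j. lam ((f ^^ i) ((f ^^ j) (\<xi> t)))) < l'" .
      have "\<forall>\<^sub>F y in nhds ((f ^^ j) (\<xi> t)). dist y ((f ^^ j) (\<xi> t))
          \<le> l' * dist ((f ^^ (n - j)) y) ((f ^^ (n - j)) ((f ^^ j) (\<xi> t)))"
      proof (rule funpow_expands[OF _ less])
        fix i assume "i < n - j"
        then show "(f ^^ i) ((f ^^ j) (\<xi> t)) \<notin> S"
          using RS(1)[OF \<xi>R, of "i + j"] by (simp add: funpow_add)
      qed
      moreover have "((\<lambda>s. (f ^^ j) (\<xi> s)) \<longlongrightarrow> (f ^^ j) (\<xi> t)) (at t within {a..b})"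
      proof -
        have "continuous_on {a..b} \<xi>" by (rule continuous_on_subset[OF \<xi>c]) (use ab in auto)
        then have "continuous_on {a..b} (\<lambda>s. (f ^^ j) (\<xi> s))"
          by (rule continuous_on_compose2[OF funpow_cont[of UNIV]]) auto
        then show ?thesis using t by (simp add: continuous_on_def)
      qed
      ultimately have "\<forall>\<^sub>F s in at t within {a..b}. dist ((f ^^ j) (\<xi> s)) ((f ^^ j) (\<xi> t))
          \<le> l' * dist ((f ^^ (n - j)) ((f ^^ j) (\<xi> s))) ((f ^^ (n - j)) ((f ^^ j) (\<xi> t)))"
        by (rule eventually_compose_filterlim)
      moreover have "\<forall>\<^sub>F s in at t within {a..b}. s \<in> {a..b}"
        by (simp add: eventually_at_filter)
      ultimately show "\<forall>\<^sub>F s in at t within {a..b}. dist ((f ^^ j) (\<xi> s)) ((f ^^ j) (\<xi> t)) \<le> l * \<bar>s - t\<bar>"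
      proof eventually_elim
        case (elim s)
        have s01: "0 \<le> s" "s < 1" using elim ab by auto
        have nj: "(f ^^ (n - j)) ((f ^^ j) y) = (f ^^ n) y" for y
          using j by (metis comp_apply funpow_add le_add_diff_inverse2 less_imp_le)
        have "dist ((f ^^ j) (\<xi> s)) ((f ^^ j) (\<xi> t)) \<le> l' * dist (\<psi> (\<gamma> s)) (\<psi> (\<gamma> t))"
          using elim(1) unfolding nj fn[OF s01] fn[OF t01] .
        also have "\<dots> \<le> l' * (K * dist (\<gamma> s) (\<gamma> t))"
          using l'pos s01 t01 by (intro mult_left_mono lip(2) \<gamma>U) auto
        also have "\<dots> = (l' * (K * dist p z)) * \<bar>s - t\<bar>" by (simp add: \<gamma>dist)
        also have "\<dots> \<le> l * \<bar>s - t\<bar>" by (intro mult_right_mono l') auto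
        finally show ?case .
      qed
    qed
    have Lip: "dist ((f ^^ j) (\<xi> a)) ((f ^^ j) (\<xi> b)) \<le> L j * \<bar>b - a\<bar>"
      if "j < n" "0 \<le> a" "a < 1" "0 \<le> b" "b < 1" for j a b
      using Lip'[of j a b] Lip'[of j b a] that by (cases "a \<le> b") (auto simp: dist_commute)
    define sq where "sq k = 1 - 1 / real (Suc (Suc k))" for k
    have sq: "0 \<le> sq k" "sq k < 1" for k by (auto simp: sq_def)
    have sqlim: "sq \<longlonglongrightarrow> 1"
    proof -
      have "(\<lambda>k. 1 / real (Suc (Suc k))) \<longlonglongrightarrow> 0"
        using LIMSEQ_Suc[OF LIMSEQ_Suc[OF lim_1_over_n[where 'a=real]]] .
      from tendsto_diff[OF tendsto_const[of 1] this] show ?thesis by (simp add: sq_def[abs_def])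
    qed
    \<comment> \<open>the end point of the lift, by compactness and the Lipschitz bound\<close>
    obtain y \<rho> where y: "strict_mono (\<rho> :: nat \<Rightarrow> nat)" "((\<lambda>k. \<xi> (sq k)) \<circ> \<rho>) \<longlonglongrightarrow> y"
      using compact_space unfolding compact_def by blast
    have sqr: "(\<lambda>k. sq (\<rho> k)) \<longlonglongrightarrow> 1"
      using LIMSEQ_subseq_LIMSEQ[OF sqlim y(1)] by (simp add: o_def)
    have bound: "dist (\<xi> t) y \<le> L 0 * (1 - t)" if "0 \<le> t" "t < 1" for t
    proof (rule LIMSEQ_le)
      show "(\<lambda>k. dist (\<xi> t) (\<xi> (sq (\<rho> k)))) \<longlonglongrightarrow> dist (\<xi> t) y"
        using y(2) by (intro tendsto_intros) (simp add: o_def)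
      have "(\<lambda>k. L 0 * \<bar>sq (\<rho> k) - t\<bar>) \<longlonglongrightarrow> L 0 * \<bar>1 - t\<bar>"
        by (intro tendsto_intros sqr)
      then show "(\<lambda>k. L 0 * \<bar>sq (\<rho> k) - t\<bar>) \<longlonglongrightarrow> L 0 * (1 - t)" using that by simp
      show "\<exists>N. \<forall>k\<ge>N. dist (\<xi> t) (\<xi> (sq (\<rho> k))) \<le> L 0 * \<bar>sq (\<rho> k) - t\<bar>"
        using Lip[of 0 t] that sq n by auto
    qed
    have ev: "eventually (\<lambda>t. 0 \<le> t \<and> t < 1) (at_left (1::real))"
      unfolding eventually_at_left_field by (rule exI[of _ 0]) auto
    have ylim: "(\<xi> \<longlongrightarrow> y) (at_left 1)"
    proof (rule tendsto_dist_iff[THEN iffD2], rule Lim_null_comparison)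
      show "\<forall>\<^sub>F t in at_left 1. norm (dist (\<xi> t) y) \<le> L 0 * (1 - t)"
        using ev by eventually_elim (use bound in auto)
      have "((\<lambda>t. L 0 * (1 - t)) \<longlongrightarrow> L 0 * (1 - 1)) (at_left (1::real))" by (intro tendsto_intros)
      then show "((\<lambda>t. L 0 * (1 - t)) \<longlongrightarrow> 0) (at_left (1::real))" by simp
    qed
    have fy: "((\<lambda>t. (f ^^ j) (\<xi> t)) \<longlongrightarrow> (f ^^ j) y) (at_left 1)" for j
      by (rule isCont_tendsto_compose[OF funpow_isCont ylim])
    have "y \<in> R"
      unfolding R_def
    proof (intro CollectI conjI allI impI)
      have "((\<lambda>t. \<psi> (\<gamma> t)) \<longlongrightarrow> \<psi> p) (at_left 1)"
      proof -
        have "isCont \<psi> p" using hom'(5) U(1) p by (simp add: continuous_on_eq_continuous_at)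
        moreover have "(\<gamma> \<longlongrightarrow> z + 1 *\<^sub>R (p - z)) (at_left 1)"
          unfolding \<gamma>_def[abs_def] by (intro tendsto_intros)
        ultimately show ?thesis by (intro isCont_tendsto_compose[of p \<psi>]) auto
      qed
      moreover have "eventually (\<lambda>t. \<psi> (\<gamma> t) = (f ^^ n) (\<xi> t)) (at_left (1::real))"
        using ev by eventually_elim (use fn in auto)
      ultimately have "((\<lambda>t. (f ^^ n) (\<xi> t)) \<longlongrightarrow> \<psi> p) (at_left 1)"
        by (rule Lim_transform_eventually)
      then have "(f ^^ n) y = \<psi> p" using tendsto_unique[OF trivial_limit_at_left_real fy] by blast
      then show "(f ^^ n) y \<in> Q" using p hom'(1) by auto
      fix j assume j: "j < n"
      have "dist ((f ^^ j) x) ((f ^^ j) y) \<le> L j"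
      proof (rule tendsto_upperbound[OF _ _ trivial_limit_at_left_real])
        show "((\<lambda>t. dist ((f ^^ j) x) ((f ^^ j) (\<xi> t))) \<longlongrightarrow> dist ((f ^^ j) x) ((f ^^ j) y)) (at_left 1)"
          by (intro tendsto_intros fy)
        show "\<forall>\<^sub>F t in at_left 1. dist ((f ^^ j) x) ((f ^^ j) (\<xi> t)) \<le> L j"
          using ev
        proof eventually_elim
          case (elim t)
          have "dist ((f ^^ j) x) ((f ^^ j) (\<xi> t)) \<le> L j * t" using Lip'[OF j, of 0 t] \<xi>0 elim by simp
          also have "\<dots> \<le> L j * 1" using Lnn elim by (intro mult_left_mono) auto
          finally show ?case by simp
        qed
      qed
      also have "L j < (\<Prod>i\<in>{j..<n}. \<Lambda> i) * r"
        unfolding L_def by (rule mult_strict_left_mono[OF diam[OF p zU] prodpos])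
      also have "\<dots> \<le> rad j" by (rule rad[OF j])
      finally show "dist ((f ^^ j) x) ((f ^^ j) y) < rad j" .
    qed
    then show "\<exists>y\<in>R. (\<xi> \<longlongrightarrow> y) (at_left 1)" using ylim by blast
  qed
  then obtain g where g: "continuous_on U g" "g (P x) = x" "\<And>u. u \<in> U \<Longrightarrow> g u \<in> R \<and> P (g u) = u" by blast
  have \<phi>U: "\<phi> q \<in> U" if "q \<in> Q" for q using that hom'(2) by auto
  have "(f ^^ n) (g (\<phi> q)) = q" if "q \<in> Q" for q
  proof -
    have "\<phi> ((f ^^ n) (g (\<phi> q))) = \<phi> q" "(f ^^ n) (g (\<phi> q)) \<in> Q"
      using g(3)[OF \<phi>U[OF that]] by (auto simp: P_def R_def)
    then show ?thesis using hom'(4) that by metis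
  qed
  moreover have "continuous_on Q (g \<circ> \<phi>)"
    by (rule continuous_on_compose[OF hom'(6)]) (simp add: hom' g)
  ultimately show ?thesis
    using g \<phi>U by (intro exI[of _ "g \<circ> \<phi>"]) (auto simp: P_def R_def)
qed

end

section \<open>Bounded distortion\<close>

text \<open>
  \<open>J\<close> is the rate at which the inverse of \<open>f\<close> changes volume. Instead of an integral formula only
  the bounds on sets are recorded on which \<open>J\<close> is bounded: these simply multiply for successive iterates.
\<close>

definition jacobian_bounds :: "'m::topological_space measure \<Rightarrow> ('m \<Rightarrow> 'm) \<Rightarrow> ('m \<Rightarrow> real) \<Rightarrow> 'm set \<Rightarrow> bool" where
  "jacobian_bounds m f J V \<longleftrightarrow> (\<forall>Y\<in>sets borel. Y \<subseteq> V \<longrightarrow> (\<forall>a>0.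
     ((\<forall>y\<in>Y. J y \<le> a) \<longrightarrow> emeasure m Y \<le> ennreal a * emeasure m (f ` Y)) \<and>
     ((\<forall>y\<in>Y. a \<le> J y) \<longrightarrow> ennreal a * emeasure m (f ` Y) \<le> emeasure m Y)))"

lemma borel_preimage_of_continuous:
  assumes "continuous_on W k" "open W" "Y \<in> sets borel"
  shows "W \<inter> k -` Y \<in> sets borel"
proof -
  have "k \<in> borel_measurable (restrict_space borel W)"
    using assms(1) by (rule borel_measurable_continuous_on_restrict)
  from measurable_sets[OF this assms(3)] show ?thesis
    using assms(2) by (auto simp: sets_restrict_space_iff space_restrict_space Int_commute)
qed

locale expanding_with_jacobian = pointwise_expanding f S lam + prob_space m
  for f :: "'m::metric_space \<Rightarrow> 'm" and S lam and m :: "'m measure" +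
  fixes J :: "'m \<Rightarrow> real"
  assumes sets_m [simp, measurable_cong]: "sets m = sets borel"
    and open_pos: "open (W :: 'm set) \<Longrightarrow> W \<noteq> {} \<Longrightarrow> 0 < emeasure m W"
    and J_pos: "x \<notin> S \<Longrightarrow> 0 < J x"
    and local_jacobian: "x \<notin> S \<Longrightarrow> \<exists>V. open V \<and> x \<in> V \<and> jacobian_bounds m f J V"
begin

lemma image_open:
  assumes "open W" "W \<subseteq> - S"
  shows "open (f ` W)"
proof (subst open_subopen, intro ballI)
  fix y assume "y \<in> f ` W"
  then obtain x where x: "x \<in> W" "y = f x" by blast
  then obtain V where V: "open V" "x \<in> V" "\<And>Z. open Z \<Longrightarrow> Z \<subseteq> V \<Longrightarrow> open (f ` Z)"
    using f_local_homeo[of x] assms unfolding local_homeo_at_def by blast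
  have "open (f ` (V \<inter> W))" using V assms by auto
  then show "\<exists>T. open T \<and> y \<in> T \<and> T \<subseteq> f ` W" using x V by (intro exI[of _ "f ` (V \<inter> W)"]) auto
qed

lemma image_borel:
  assumes W: "open W" "W \<subseteq> - S" "inj_on f W" and Y: "Y \<in> sets borel" "Y \<subseteq> W"
  shows "f ` Y \<in> sets borel"
proof -
  have "continuous_on (f ` W) (inv_into W f)"
  proof (rule continuous_on_inverse_open_map[OF continuous_on_subset[OF f_cont] refl])
    show "inv_into W f (f v) = v" if "v \<in> W" for v using W(3) that by simp
    show "openin (top_of_set (f ` W)) (f ` U)" if "openin (top_of_set W) U" for U
    proof -
      have "open U" "U \<subseteq> W" using that W(1) by (auto simp: openin_open_eq)
      then have "open (f ` U)" using W(2) by (intro image_open) auto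
      then show ?thesis using image_open[OF W(1,2)] \<open>U \<subseteq> W\<close> by (simp add: openin_open_eq image_mono)
    qed
  qed simp
  from borel_preimage_of_continuous[OF this image_open[OF W(1,2)] Y(1)]
  have "f ` W \<inter> inv_into W f -` Y \<in> sets borel" .
  moreover have "f ` W \<inter> inv_into W f -` Y = f ` Y"
    using W(3) Y(2) by force
  ultimately show ?thesis by simp
qed

text \<open>
  Cutting a set into countably many pieces on which the local bounds hold; injectivity keeps the images
  of the pieces disjoint.
\<close>

lemma jacobian_bounds_inj:
  assumes W: "open W" "W \<subseteq> - S" "inj_on f W"
  shows "jacobian_bounds m f J W"
  unfolding jacobian_bounds_def
proof (intro ballI impI allI conjI)
  fix Y and a :: real assume Y: "Y \<in> sets borel" "Y \<subseteq> W" and a: "0 < a"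
  define \<V> where "\<V> = {V. open V \<and> jacobian_bounds m f J V}"
  obtain \<V>' where V': "\<V>' \<subseteq> \<V>" "countable \<V>'" "W \<subseteq> \<Union>\<V>'"
  proof (rule countable_subcover_compact_metric[OF compact_space])
    show "\<exists>V\<in>\<V>. open V \<and> x \<in> V" if "x \<in> W" for x
      using local_jacobian[of x] that W(2) unfolding \<V>_def by blast
  qed
  define V where "V = from_nat_into (insert {} \<V>')"
  have rV: "range V = insert {} \<V>'" unfolding V_def using V'(2) by (intro range_from_nat_into) auto
  have jbe: "jacobian_bounds m f J {}" by (auto simp: jacobian_bounds_def)
  have V: "open (V i)" "jacobian_bounds m f J (V i)" for i
  proof -
    have "V i \<in> insert {} \<V>'" using rV by auto
    then show "open (V i)" "jacobian_bounds m f J (V i)" using V'(1) jbe by (auto simp: \<V>_def)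
  qed
  define Z where "Z i = Y \<inter> disjointed V i" for i
  have Z: "Z i \<in> sets borel" for i
  proof -
    have "range (disjointed V) \<subseteq> sets borel" by (rule sets.range_disjointed_sets) (use V in auto)
    then show ?thesis unfolding Z_def using Y(1) by (intro sets.Int) auto
  qed
  have ZV: "Z i \<subseteq> V i" for i using disjointed_subset[of V i] by (auto simp: Z_def)
  have dis: "disjoint_family Z" using disjoint_family_disjointed[of V] by (auto simp: disjoint_family_on_def Z_def)
  have "Y \<subseteq> (\<Union>i. V i)" using rV V'(3) Y(2) by auto
  then have UZ: "(\<Union>i. Z i) = Y" unfolding Z_def using UN_disjointed_eq[of V] by blast
  have ZY: "Z i \<subseteq> Y" for i by (auto simp: Z_def)
  have mY: "emeasure m Y = (\<Sum>i. emeasure m (Z i))"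
  proof -
    have "range Z \<subseteq> sets m" using Z by auto
    from suminf_emeasure[OF this dis] show ?thesis unfolding UZ by simp
  qed
  have fZ: "f ` Z i \<in> sets borel" for i using image_borel[OF W Z] ZY Y(2) by blast
  have disf: "disjoint_family (\<lambda>i. f ` Z i)"
    unfolding disjoint_family_on_def
  proof (intro ballI impI)
    fix i j :: nat assume "i \<noteq> j"
    then have "Z i \<inter> Z j = {}" using dis by (auto simp: disjoint_family_on_def)
    then show "f ` Z i \<inter> f ` Z j = {}"
      using W(3) ZY Y(2) by (subst inj_on_image_Int[symmetric, OF W(3)]) auto
  qed
  have mfY: "emeasure m (f ` Y) = (\<Sum>i. emeasure m (f ` Z i))"
  proof -
    have "range (\<lambda>i. f ` Z i) \<subseteq> sets m" using fZ by auto
    from suminf_emeasure[OF this disf] show ?thesis unfolding image_UN[symmetric] UZ by simp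
  qed
  have bd: "(\<forall>y\<in>Z i. J y \<le> a) \<longrightarrow> emeasure m (Z i) \<le> ennreal a * emeasure m (f ` Z i)"
     "(\<forall>y\<in>Z i. a \<le> J y) \<longrightarrow> ennreal a * emeasure m (f ` Z i) \<le> emeasure m (Z i)" for i
    using V(2)[of i, unfolded jacobian_bounds_def, rule_format, OF Z ZV a] by auto
  show "emeasure m Y \<le> ennreal a * emeasure m (f ` Y)" if "\<forall>y\<in>Y. J y \<le> a"
    unfolding mY mfY ennreal_suminf_cmult[symmetric]
    by (intro suminf_le bd[rule_format]) (use that ZY in auto)
  show "ennreal a * emeasure m (f ` Y) \<le> emeasure m Y" if "\<forall>y\<in>Y. a \<le> J y"
    unfolding mY mfY ennreal_suminf_cmult[symmetric]
    by (intro suminf_le bd[rule_format]) (use that ZY in auto)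
qed

text \<open>
  An inverse branch of \<open>f\<^sup>n\<close> over \<open>Q\<close> on which the logarithm of the Jacobian varies by at most \<open>\<epsilon> j\<close>
  about a constant at the \<open>j\<close>-th step, the variations adding up to at most \<open>\<Theta>\<close>.
\<close>

definition hyperbolic_section :: "nat \<Rightarrow> real \<Rightarrow> 'm set \<Rightarrow> ('m \<Rightarrow> 'm) \<Rightarrow> bool" where
  "hyperbolic_section n \<Theta> Q g \<longleftrightarrow> continuous_on Q g \<and> (\<forall>q\<in>Q. (f ^^ n) (g q) = q) \<and>
     (\<exists>c \<epsilon>. (\<Sum>j<n. \<epsilon> j) \<le> \<Theta> \<and> (\<forall>j<n. 0 < c j \<and> (\<forall>q\<in>Q. (f ^^ j) (g q) \<notin> S \<and>
        exp (- \<epsilon> j) * c j \<le> J ((f ^^ j) (g q)) \<and> J ((f ^^ j) (g q)) \<le> exp (\<epsilon> j) * c j)))"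

lemma funpow_diff:
  assumes "j \<le> n" shows "(f ^^ (n - j)) ((f ^^ j) y) = (f ^^ n) y"
  using assms by (metis comp_apply funpow_add le_add_diff_inverse2)

lemma hyperbolic_section_image:
  assumes g: "hyperbolic_section n \<Theta> Q g" and Q: "open Q" and j: "j \<le> n"
  shows "open ((\<lambda>q. (f ^^ j) (g q)) ` Q)"
    and "X \<in> sets borel \<Longrightarrow> X \<subseteq> Q \<Longrightarrow> (\<lambda>q. (f ^^ j) (g q)) ` X \<in> sets borel"
proof -
  let ?s = "\<lambda>q. (f ^^ j) (g q)"
  have gc: "continuous_on Q g" and sec: "\<And>q. q \<in> Q \<Longrightarrow> (f ^^ n) (g q) = q"
    and gS: "\<And>q i. q \<in> Q \<Longrightarrow> i < n \<Longrightarrow> (f ^^ i) (g q) \<notin> S"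
    using g unfolding hyperbolic_section_def by blast+
  have s: "(f ^^ (n - j)) (?s q) = q" if "q \<in> Q" for q
    using sec[OF that] funpow_diff[OF j] by simp
  show o: "open (?s ` Q)"
  proof (rule section_image_open[where F="f ^^ (n - j)" and s="?s", OF _ Q])
    show "(f ^^ (n - j)) (?s q) = q" if "q \<in> Q" for q using s[OF that] .
    show "continuous_on Q ?s"
      by (rule continuous_on_compose2[OF funpow_cont[of UNIV] gc]) auto
    show "local_homeo_at (f ^^ (n - j)) UNIV (?s q)" if "q \<in> Q" for q
    proof (rule funpow_local_homeo)
      fix i assume "i < n - j"
      then show "(f ^^ i) (?s q) \<notin> S" using gS[OF that, of "i + j"] by (simp add: funpow_add)
    qed
  qed
  show "?s ` X \<in> sets borel" if "X \<in> sets borel" "X \<subseteq> Q"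
  proof -
    have "?s ` X = ?s ` Q \<inter> (f ^^ (n - j)) -` X" using s that(2) by force
    then show ?thesis using borel_preimage_of_continuous[OF funpow_cont o that(1)] by simp
  qed
qed

text \<open>
  The bounds of the single steps multiply; \<open>c\<close> is the product of the constants of the steps.
\<close>

lemma hyperbolic_section_measure:
  assumes g: "hyperbolic_section n \<Theta> Q g" and Q: "open Q"
  obtains c where "0 < c"
     "\<And>X. X \<in> sets borel \<Longrightarrow> X \<subseteq> Q \<Longrightarrow> emeasure m (g ` X) \<le> ennreal (exp \<Theta> * c) * emeasure m X"
     "\<And>X. X \<in> sets borel \<Longrightarrow> X \<subseteq> Q \<Longrightarrow> ennreal (exp (- \<Theta>) * c) * emeasure m X \<le> emeasure m (g ` X)"
proof -
  have sec: "\<And>q. q \<in> Q \<Longrightarrow> (f ^^ n) (g q) = q" using g unfolding hyperbolic_section_def by blast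
  obtain c \<epsilon> where \<epsilon>: "(\<Sum>j<n. \<epsilon> j) \<le> \<Theta>" and c: "\<And>j. j < n \<Longrightarrow> 0 < c j"
    and gS: "\<And>j q. j < n \<Longrightarrow> q \<in> Q \<Longrightarrow> (f ^^ j) (g q) \<notin> S"
    and Jlo: "\<And>j q. j < n \<Longrightarrow> q \<in> Q \<Longrightarrow> exp (- \<epsilon> j) * c j \<le> J ((f ^^ j) (g q))"
    and Jhi: "\<And>j q. j < n \<Longrightarrow> q \<in> Q \<Longrightarrow> J ((f ^^ j) (g q)) \<le> exp (\<epsilon> j) * c j"
    using g unfolding hyperbolic_section_def by metis
  let ?C = "\<Prod>i<n. c i"
  have C: "0 < ?C" using c by (intro prod_pos) auto
  have step: "emeasure m ((\<lambda>q. (f ^^ j) (g q)) ` X) \<le> ennreal (exp (\<epsilon> j) * c j) * emeasure m ((\<lambda>q. (f ^^ Suc j) (g q)) ` X)"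
      "ennreal (exp (- \<epsilon> j) * c j) * emeasure m ((\<lambda>q. (f ^^ Suc j) (g q)) ` X) \<le> emeasure m ((\<lambda>q. (f ^^ j) (g q)) ` X)"
    if j: "j < n" and X: "X \<in> sets borel" "X \<subseteq> Q" for j X
  proof -
    let ?s = "\<lambda>q. (f ^^ j) (g q)"
    have "inj_on f (?s ` Q)"
    proof (rule inj_onI)
      fix y y' assume "y \<in> ?s ` Q" "y' \<in> ?s ` Q" and eq: "f y = f y'"
      then obtain q q' where q: "q \<in> Q" "y = ?s q" "q' \<in> Q" "y' = ?s q'" by blast
      have "(f ^^ Suc j) (g q) = (f ^^ Suc j) (g q')" using eq q by simp
      then have "(f ^^ n) (g q) = (f ^^ n) (g q')"
        using funpow_diff[of "Suc j" n "g q"] funpow_diff[of "Suc j" n "g q'"] j by simp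
      then show "y = y'" using sec q by simp
    qed
    then have jb: "jacobian_bounds m f J (?s ` Q)"
      by (intro jacobian_bounds_inj hyperbolic_section_image(1)[OF g Q]) (use gS j in auto)
    have im: "f ` ?s ` X = (\<lambda>q. (f ^^ Suc j) (g q)) ` X" by (simp add: image_image)
    have b: "?s ` X \<in> sets borel" using hyperbolic_section_image(2)[OF g Q _ X] j by simp
    have pos: "0 < exp (\<epsilon> j) * c j" "0 < exp (- \<epsilon> j) * c j" using c[OF j] by auto
    have sub: "?s ` X \<subseteq> ?s ` Q" using X(2) by (rule image_mono)
    note jb' = jb[unfolded jacobian_bounds_def, rule_format, OF b sub]
    show "emeasure m (?s ` X) \<le> ennreal (exp (\<epsilon> j) * c j) * emeasure m ((\<lambda>q. (f ^^ Suc j) (g q)) ` X)"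
      using jb'[OF pos(1)] Jhi[OF j] X(2) unfolding im by blast
    show "ennreal (exp (- \<epsilon> j) * c j) * emeasure m ((\<lambda>q. (f ^^ Suc j) (g q)) ` X) \<le> emeasure m (?s ` X)"
      using jb'[OF pos(2)] Jlo[OF j] X(2) unfolding im by blast
  qed
  have upto: "emeasure m (g ` X) \<le> ennreal (\<Prod>i<k. exp (\<epsilon> i) * c i) * emeasure m ((\<lambda>q. (f ^^ k) (g q)) ` X) \<and>
     ennreal (\<Prod>i<k. exp (- \<epsilon> i) * c i) * emeasure m ((\<lambda>q. (f ^^ k) (g q)) ` X) \<le> emeasure m (g ` X)"
    if X: "X \<in> sets borel" "X \<subseteq> Q" and "k \<le> n" for k X
    using that(3)
  proof (induction k)
    case 0
    have "(\<lambda>q. (f ^^ 0) (g q)) ` X = g ` X" by simp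
    then show ?case by simp
  next
    case (Suc k)
    then have k: "k < n" by simp
    have nn: "0 \<le> (\<Prod>i<k. exp (\<epsilon> i) * c i)" "0 \<le> (\<Prod>i<k. exp (- \<epsilon> i) * c i)"
      using c k by (auto intro!: prod_nonneg mult_nonneg_nonneg simp: less_imp_le)
    have nn': "0 \<le> exp (\<epsilon> k) * c k" "0 \<le> exp (- \<epsilon> k) * c k" using c[OF k] by auto
    have "emeasure m (g ` X) \<le> ennreal (\<Prod>i<k. exp (\<epsilon> i) * c i) * emeasure m ((\<lambda>q. (f ^^ k) (g q)) ` X)"
      using Suc by simp
    also have "\<dots> \<le> ennreal (\<Prod>i<k. exp (\<epsilon> i) * c i) * (ennreal (exp (\<epsilon> k) * c k) * emeasure m ((\<lambda>q. (f ^^ Suc k) (g q)) ` X))"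
      by (rule mult_left_mono[OF step(1)[OF k X]]) simp
    also have "\<dots> = ennreal (\<Prod>i<Suc k. exp (\<epsilon> i) * c i) * emeasure m ((\<lambda>q. (f ^^ Suc k) (g q)) ` X)"
      unfolding prod.lessThan_Suc ennreal_mult[OF nn(1) nn'(1)] by (simp only: mult.assoc)
    finally have 1: "emeasure m (g ` X) \<le> ennreal (\<Prod>i<Suc k. exp (\<epsilon> i) * c i) * emeasure m ((\<lambda>q. (f ^^ Suc k) (g q)) ` X)" .
    have "ennreal (\<Prod>i<Suc k. exp (- \<epsilon> i) * c i) * emeasure m ((\<lambda>q. (f ^^ Suc k) (g q)) ` X)
       = ennreal (\<Prod>i<k. exp (- \<epsilon> i) * c i) * (ennreal (exp (- \<epsilon> k) * c k) * emeasure m ((\<lambda>q. (f ^^ Suc k) (g q)) ` X))"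
      unfolding prod.lessThan_Suc ennreal_mult[OF nn(2) nn'(2)] by (simp only: mult.assoc)
    also have "\<dots> \<le> ennreal (\<Prod>i<k. exp (- \<epsilon> i) * c i) * emeasure m ((\<lambda>q. (f ^^ k) (g q)) ` X)"
      by (rule mult_left_mono[OF step(2)[OF k X]]) simp
    also have "\<dots> \<le> emeasure m (g ` X)" using Suc by simp
    finally show ?case using 1 by simp
  qed
  have prods: "(\<Prod>i<n. exp (\<epsilon> i) * c i) = exp (\<Sum>i<n. \<epsilon> i) * ?C" "(\<Prod>i<n. exp (- \<epsilon> i) * c i) = exp (- (\<Sum>i<n. \<epsilon> i)) * ?C"
    by (simp_all add: prod.distrib exp_sum sum_negf[symmetric])
  have le: "exp (\<Sum>i<n. \<epsilon> i) * ?C \<le> exp \<Theta> * ?C" "exp (- \<Theta>) * ?C \<le> exp (- (\<Sum>i<n. \<epsilon> i)) * ?C"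
    using \<epsilon> C by auto
  have idX: "(\<lambda>q. (f ^^ n) (g q)) ` X = X" if "X \<subseteq> Q" for X
    using sec that by force
  show thesis
  proof (rule that[OF C])
    fix X assume X: "X \<in> sets borel" "X \<subseteq> Q"
    note u = upto[OF X order_refl, unfolded prods idX[OF X(2)]]
    show "emeasure m (g ` X) \<le> ennreal (exp \<Theta> * ?C) * emeasure m X"
      using u mult_right_mono[OF ennreal_leI[OF le(1)], of "emeasure m X"] by (auto intro: order_trans)
    show "ennreal (exp (- \<Theta>) * ?C) * emeasure m X \<le> emeasure m (g ` X)"
      using u mult_right_mono[OF ennreal_leI[OF le(2)], of "emeasure m X"] by (auto intro: order_trans)
  qed
qed

lemma hyperbolic_section_distortion:
  assumes g: "hyperbolic_section n \<Theta> Q g" and Q: "open Q" "Q \<noteq> {}" and X: "X \<in> sets borel" "X \<subseteq> Q"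
  shows "measure m (g ` X) \<le> exp (2 * \<Theta>) / measure m Q * measure m X * measure m (g ` Q)"
proof -
  obtain c where c: "0 < c"
     "\<And>X. X \<in> sets borel \<Longrightarrow> X \<subseteq> Q \<Longrightarrow> emeasure m (g ` X) \<le> ennreal (exp \<Theta> * c) * emeasure m X"
     "\<And>X. X \<in> sets borel \<Longrightarrow> X \<subseteq> Q \<Longrightarrow> ennreal (exp (- \<Theta>) * c) * emeasure m X \<le> emeasure m (g ` X)"
    using hyperbolic_section_measure[OF g Q(1)] by blast
  have Qb: "Q \<in> sets borel" using Q by simp
  have pos: "0 < measure m Q" using open_pos[OF Q] by (simp add: emeasure_eq_measure)
  have "ennreal (measure m (g ` X)) \<le> ennreal (exp \<Theta> * c * measure m X)"
    using c(2)[OF X] c(1) by (simp add: emeasure_eq_measure ennreal_mult'')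
  then have 1: "measure m (g ` X) \<le> exp \<Theta> * c * measure m X"
    using c(1) by (subst (asm) ennreal_le_iff) auto
  have "ennreal (exp (- \<Theta>) * c * measure m Q) \<le> ennreal (measure m (g ` Q))"
    using c(3)[OF Qb order_refl] c(1) by (simp add: emeasure_eq_measure ennreal_mult'')
  then have 2: "exp (- \<Theta>) * c * measure m Q \<le> measure m (g ` Q)"
    by (subst (asm) ennreal_le_iff) auto
  have "measure m (g ` X) * measure m Q \<le> exp \<Theta> * c * measure m X * measure m Q"
    using 1 pos by (intro mult_right_mono) auto
  also have "\<dots> = exp (2 * \<Theta>) * measure m X * (exp (- \<Theta>) * c * measure m Q)"
    by (simp add: exp_add[symmetric] mult.assoc[symmetric] mult.commute[of _ "exp (- \<Theta>)"])
  also have "\<dots> \<le> exp (2 * \<Theta>) * measure m X * measure m (g ` Q)"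
    by (intro mult_left_mono 2) auto
  finally show ?thesis using pos by (simp add: field_simps)
qed

text \<open>
  The part of \<open>f\<^sup>-\<^sup>n X\<close> inside \<open>E\<close> is covered by the images of \<open>X\<close> under the branches over \<open>Q\<close>. By bounded
  distortion each of them occupies a fraction at most \<open>\<kappa>\<close> of the corresponding image of \<open>Q\<close>, and the
  images of \<open>Q\<close> under different branches are disjoint in a space of total volume one.
\<close>

theorem transfer_bound_over:
  assumes Q: "open Q" "connected Q" "Q \<noteq> {}" and E: "E \<in> sets borel" and X: "X \<in> sets borel" "X \<subseteq> Q"
    and branch: "\<And>x. x \<in> E \<Longrightarrow> (f ^^ n) x \<in> Q \<Longrightarrow> \<exists>g. hyperbolic_section n \<Theta> Q g \<and> g ((f ^^ n) x) = x"
  shows "measure m (E \<inter> (f ^^ n) -` X) \<le> exp (2 * \<Theta>) / measure m Q * measure m X"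
proof -
  define \<kappa> where "\<kappa> = exp (2 * \<Theta>) / measure m Q * measure m X"
  have \<kappa>0: "0 \<le> \<kappa>" by (auto simp: \<kappa>_def)
  define \<W> where "\<W> = {W. \<exists>g. hyperbolic_section n \<Theta> Q g \<and> W = g ` Q}"
  have Wopen: "open W \<and> W \<noteq> {}" if W: "W \<in> \<W>" for W
  proof -
    obtain g where g: "hyperbolic_section n \<Theta> Q g" "W = g ` Q" using W by (auto simp: \<W>_def)
    have "open ((\<lambda>q. (f ^^ 0) (g q)) ` Q)" by (rule hyperbolic_section_image(1)[OF g(1) Q(1)]) simp
    then show ?thesis using g Q by simp
  qed
  have dis: "disjoint \<W>"
    unfolding disjoint_def
  proof (intro ballI impI)
    fix W1 W2 assume W12: "W1 \<in> \<W>" "W2 \<in> \<W>" "W1 \<noteq> W2"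
    obtain g1 where g1: "hyperbolic_section n \<Theta> Q g1" "W1 = g1 ` Q" using W12(1) by (auto simp: \<W>_def)
    obtain g2 where g2: "hyperbolic_section n \<Theta> Q g2" "W2 = g2 ` Q" using W12(2) by (auto simp: \<W>_def)
    have c: "continuous_on Q g1" "continuous_on Q g2"
      and s: "\<And>q. q \<in> Q \<Longrightarrow> (f ^^ n) (g1 q) = q" "\<And>q. q \<in> Q \<Longrightarrow> (f ^^ n) (g2 q) = q"
      and gS: "\<And>i q. i < n \<Longrightarrow> q \<in> Q \<Longrightarrow> (f ^^ i) (g1 q) \<notin> S" "\<And>i q. i < n \<Longrightarrow> q \<in> Q \<Longrightarrow> (f ^^ i) (g2 q) \<notin> S"
      using g1(1) g2(1) unfolding hyperbolic_section_def by blast+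
    show "W1 \<inter> W2 = {}"
    proof (rule ccontr)
      assume "W1 \<inter> W2 \<noteq> {}"
      then obtain q1 q2 where q: "q1 \<in> Q" "q2 \<in> Q" "g1 q1 = g2 q2" using g1(2) g2(2) by blast
      then have qq: "q1 = q2" using s(1)[OF q(1)] s(2)[OF q(2)] by simp
      have "g1 u = g2 u" if "u \<in> Q" for u
      proof (rule sections_agree[of "{y. \<forall>i<n. (f ^^ i) y \<notin> S}" "f ^^ n" Q g1 g2 q1])
        show "local_homeo_at (f ^^ n) {y. \<forall>i<n. (f ^^ i) y \<notin> S} y" if "y \<in> {y. \<forall>i<n. (f ^^ i) y \<notin> S}" for y
        proof -
          have "local_homeo_at (f ^^ n) UNIV y" using that by (intro funpow_local_homeo) auto
          moreover have "open {y. \<forall>i<n. (f ^^ i) y \<notin> S}"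
          proof -
            have "open (- S)"
            proof (subst open_subopen, intro ballI)
              fix w assume "w \<in> - S"
              then show "\<exists>T. open T \<and> w \<in> T \<and> T \<subseteq> - S"
                using f_local_homeo[of w] unfolding local_homeo_at_def by blast
            qed
            then have "open (\<Inter>i\<in>{..<n}. (f ^^ i) -` (- S))"
              by (intro open_INT open_vimage funpow_cont ballI finite_lessThan)
            moreover have "{y. \<forall>i<n. (f ^^ i) y \<notin> S} = (\<Inter>i\<in>{..<n}. (f ^^ i) -` (- S))" by auto
            ultimately show ?thesis by simp
          qed
          ultimately show ?thesis using local_homeo_at_Int_open[of "f ^^ n" UNIV y] that by simp
        qed
      qed (use Q c s gS q qq that in auto)
      then have "W1 = W2" using g1(2) g2(2) by auto
      then show False using W12(3) by simp
    qed
  qed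
  have cnt: "countable \<W>" by (rule countable_disjoint_open_sets[OF compact_space Wopen dis])
  have fnX: "(f ^^ n) -` X \<in> sets borel"
    using borel_preimage_of_continuous[OF funpow_cont open_UNIV X(1), of n] by simp
  define T where "T = (\<Union>W\<in>\<W>. W \<inter> (f ^^ n) -` X)"
  have WX: "W \<inter> (f ^^ n) -` X \<in> sets m" if "W \<in> \<W>" for W using Wopen[OF that] fnX by auto
  have djf: "disjoint_family_on (\<lambda>W. W \<inter> (f ^^ n) -` X) \<W>" "disjoint_family_on (\<lambda>W. W) \<W>"
    using dis by (auto simp: disjoint_family_on_def disjoint_def)
  have sub: "E \<inter> (f ^^ n) -` X \<subseteq> T"
  proof
    fix x assume x: "x \<in> E \<inter> (f ^^ n) -` X"
    then have "(f ^^ n) x \<in> Q" using X by auto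
    then obtain g where g: "hyperbolic_section n \<Theta> Q g" "g ((f ^^ n) x) = x" using branch x by blast
    then have "x \<in> g ` Q" using \<open>(f ^^ n) x \<in> Q\<close> by (metis image_eqI)
    then show "x \<in> T" using g x unfolding T_def \<W>_def by blast
  qed
  have Wle: "emeasure m (W \<inter> (f ^^ n) -` X) \<le> ennreal \<kappa> * emeasure m W" if W: "W \<in> \<W>" for W
  proof -
    obtain g where g: "hyperbolic_section n \<Theta> Q g" "W = g ` Q" using W by (auto simp: \<W>_def)
    have s: "\<And>q. q \<in> Q \<Longrightarrow> (f ^^ n) (g q) = q" using g(1) unfolding hyperbolic_section_def by blast
    have "W \<inter> (f ^^ n) -` X = g ` X" using s X(2) g(2) by force
    moreover have "measure m (g ` X) \<le> \<kappa> * measure m W"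
      using hyperbolic_section_distortion[OF g(1) Q(1,3) X] g(2) by (simp add: \<kappa>_def)
    ultimately show ?thesis using \<kappa>0 by (simp add: emeasure_eq_measure ennreal_mult''[symmetric] ennreal_leI)
  qed
  have "emeasure m (E \<inter> (f ^^ n) -` X) \<le> emeasure m T"
    by (rule emeasure_mono[OF sub]) (unfold T_def, rule sets.countable_UN'[OF cnt], use WX in blast)
  also have "\<dots> = (\<integral>\<^sup>+W. emeasure m (W \<inter> (f ^^ n) -` X) \<partial>count_space \<W>)"
    unfolding T_def by (rule emeasure_UN_countable[OF WX cnt djf(1)])
  also have "\<dots> \<le> (\<integral>\<^sup>+W. ennreal \<kappa> * emeasure m W \<partial>count_space \<W>)"
    by (rule nn_integral_mono) (simp add: Wle)
  also have "\<dots> = ennreal \<kappa> * (\<integral>\<^sup>+W. emeasure m W \<partial>count_space \<W>)"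
    by (rule nn_integral_cmult) simp
  also have "(\<integral>\<^sup>+W. emeasure m W \<partial>count_space \<W>) = emeasure m (\<Union>W\<in>\<W>. W)"
    by (rule emeasure_UN_countable[symmetric, OF _ cnt djf(2)]) (use Wopen in auto)
  also have "ennreal \<kappa> * \<dots> \<le> ennreal \<kappa> * 1"
    by (intro mult_left_mono emeasure_le_1) auto
  finally have "ennreal (measure m (E \<inter> (f ^^ n) -` X)) \<le> ennreal \<kappa>" by (simp add: emeasure_eq_measure)
  then show ?thesis using \<kappa>0 unfolding \<kappa>_def[symmetric] by simp
qed

end

section \<open>Transfer of volume along hyperbolic times\<close>

text \<open>
  What the transfer of volume needs to know about hyperbolic times: the product bound of the definition,
  control of \<open>lam\<close> and \<open>J\<close> on balls that shrink at half the exponential rate, and coordinates about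
  every point that are small compared to the size \<open>\<rho>\<close> of these balls. The parameter \<open>chart_type\<close>
  only names the Euclidean space of the coordinates.
\<close>

locale abstract_hyperbolic_times = expanding_with_jacobian f S lam m J
  for f :: "'m::metric_space \<Rightarrow> 'm" and S lam and m :: "'m measure" and J +
  fixes H :: "'m \<Rightarrow> nat \<Rightarrow> bool" and \<sigma> \<rho> C \<tau> :: real and chart_type :: "'b::euclidean_space itself"
  assumes \<sigma>: "0 < \<sigma>" and \<rho>: "0 < \<rho>" and C: "0 \<le> C" and \<tau>: "0 < \<tau>" "\<tau> < 1"
    and H_pos: "H x n \<Longrightarrow> 0 < n"
    and H_concat: "H x n \<Longrightarrow> H ((f ^^ n) x) k \<Longrightarrow> H x (n + k)"
    and H_prod: "H x n \<Longrightarrow> 1 \<le> k \<Longrightarrow> k \<le> n \<Longrightarrow> (\<Prod>j=n-k..<n. lam ((f ^^ j) x)) \<le> \<sigma> ^ k"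
    and H_control: "H x n \<Longrightarrow> 1 \<le> k \<Longrightarrow> k \<le> n \<Longrightarrow> dist ((f ^^ (n - k)) x) y < \<rho> * \<sigma> powr (real k / 2) \<Longrightarrow>
       y \<notin> S \<and> lam y \<le> \<sigma> powr (- (1 / 2)) * lam ((f ^^ (n - k)) x) \<and>
       \<bar>ln (J y) - ln (J ((f ^^ (n - k)) x))\<bar> \<le> C * \<tau> ^ k"
    and small_charts: "\<exists>(U :: 'b set) Q \<psi> \<phi> K. open U \<and> convex U \<and> open Q \<and> (z :: 'm) \<in> Q \<and> homeomorphism U Q \<psi> \<phi> \<and> 0 \<le> K \<and>
       (\<forall>u\<in>U. \<forall>v\<in>U. dist (\<psi> u) (\<psi> v) \<le> K * dist u v \<and> K * dist u v < \<rho>)"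
    and local_nonsingular: "x \<notin> S \<Longrightarrow> \<exists>V. open V \<and> x \<in> V \<and> (\<forall>X\<in>null_sets m. f -` X \<inter> V \<in> null_sets m)"
begin

text \<open>
  The rate \<open>\<sigma>\<^sup>-\<^sup>1\<^sup>/\<^sup>2\<close> lost at each step by passing from \<open>f\<^sup>j(x)\<close> to nearby points is half of what
  hyperbolicity provides, so the branch still contracts by \<open>\<sigma>\<^sup>k\<^sup>/\<^sup>2\<close> over \<open>k\<close> steps, which is the rate at
  which the balls shrink. The distortion is bounded by a geometric series.
\<close>

lemma hyperbolic_branch:
  fixes U :: "'b set"
  assumes H: "H x n" and U: "open U" "convex U" and Q: "open Q" "(f ^^ n) x \<in> Q" and hom: "homeomorphism U Q \<psi> \<phi>"
    and K: "0 \<le> K" "\<And>u v. u \<in> U \<Longrightarrow> v \<in> U \<Longrightarrow> dist (\<psi> u) (\<psi> v) \<le> K * dist u v \<and> K * dist u v < \<rho>"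
  shows "\<exists>g. hyperbolic_section n (C / (1 - \<tau>)) Q g \<and> g ((f ^^ n) x) = x"
proof -
  define rad where "rad j = \<rho> * \<sigma> powr (real (n - j) / 2)" for j
  define \<Lambda> where "\<Lambda> j = \<sigma> powr (- (1 / 2)) * lam ((f ^^ j) x)" for j
  have ctrl: "y \<notin> S" "lam y \<le> \<Lambda> j" "\<bar>ln (J y) - ln (J ((f ^^ j) x))\<bar> \<le> C * \<tau> ^ (n - j)"
    if "j < n" "dist ((f ^^ j) x) y < rad j" for j y
    using H_control[OF H, of "n - j" y] that by (auto simp: rad_def \<Lambda>_def)
  have radpos: "0 < rad j" for j using \<rho> \<sigma> by (simp add: rad_def)
  have xS: "(f ^^ j) x \<notin> S" if "j < n" for j using ctrl(1)[OF that] radpos[of j] by (metis dist_self)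
  have \<Lambda>pos: "0 < \<Lambda> j" if "j < n" for j using lam_pos[OF xS[OF that]] \<sigma> by (simp add: \<Lambda>_def)
  have "\<exists>g. continuous_on Q g \<and> g ((f ^^ n) x) = x \<and>
    (\<forall>q\<in>Q. (f ^^ n) (g q) = q \<and> (\<forall>j<n. dist ((f ^^ j) x) ((f ^^ j) (g q)) < rad j))"
  proof (rule inverse_branch[OF H_pos[OF H] _ \<Lambda>pos _ U Q hom K(1), where r=\<rho>])
    fix j assume j: "j < n"
    have "(\<Prod>i\<in>{j..<n}. \<Lambda> i) = (\<sigma> powr (- (1 / 2))) ^ (n - j) * (\<Prod>i\<in>{n - (n - j)..<n}. lam ((f ^^ i) x))"
      using j by (simp add: \<Lambda>_def prod.distrib)
    also have "\<dots> \<le> (\<sigma> powr (- (1 / 2))) ^ (n - j) * \<sigma> ^ (n - j)"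
      using j by (intro mult_left_mono H_prod[OF H]) auto
    also have "\<dots> = \<sigma> powr (real (n - j) / 2)"
    proof -
      have "(\<sigma> powr (- (1 / 2))) ^ (n - j) * \<sigma> ^ (n - j) = (\<sigma> powr (- (1 / 2)) * \<sigma> powr 1) ^ (n - j)"
        using \<sigma> by (simp add: power_mult_distrib)
      also have "\<dots> = (\<sigma> powr (1 / 2)) ^ (n - j)" by (simp only: powr_add[symmetric]) simp
      also have "\<dots> = \<sigma> powr (real (n - j) / 2)" using \<sigma> by (simp add: powr_power)
      finally show ?thesis .
    qed
    finally show "(\<Prod>i\<in>{j..<n}. \<Lambda> i) * \<rho> \<le> rad j"
      using \<rho> by (simp add: rad_def mult.commute)
  qed (use ctrl K in auto)
  then obtain g where g: "continuous_on Q g" "g ((f ^^ n) x) = x" "\<And>q. q \<in> Q \<Longrightarrow> (f ^^ n) (g q) = q"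
     "\<And>q j. q \<in> Q \<Longrightarrow> j < n \<Longrightarrow> dist ((f ^^ j) x) ((f ^^ j) (g q)) < rad j" by blast
  have "hyperbolic_section n (C / (1 - \<tau>)) Q g"
    unfolding hyperbolic_section_def
  proof (intro conjI ballI g)
    show "\<exists>c \<epsilon>. (\<Sum>j<n. \<epsilon> j) \<le> C / (1 - \<tau>) \<and> (\<forall>j<n. 0 < c j \<and> (\<forall>q\<in>Q. (f ^^ j) (g q) \<notin> S \<and>
        exp (- \<epsilon> j) * c j \<le> J ((f ^^ j) (g q)) \<and> J ((f ^^ j) (g q)) \<le> exp (\<epsilon> j) * c j))"
    proof (intro exI conjI allI impI ballI)
      have "(\<Sum>j<n. C * \<tau> ^ (n - j)) \<le> (\<Sum>j<n. C * \<tau> ^ (n - Suc j))"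
        using C \<tau> by (intro sum_mono mult_left_mono power_decreasing) auto
      also have "\<dots> = C * (\<Sum>j<n. \<tau> ^ j)"
        by (simp add: sum_distrib_left sum.nat_diff_reindex[of "\<lambda>k. C * \<tau> ^ k"])
      also have "\<dots> \<le> C * (1 / (1 - \<tau>))"
      proof (intro mult_left_mono C)
        show "(\<Sum>j<n. \<tau> ^ j) \<le> 1 / (1 - \<tau>)"
          using sum_le_suminf[of "\<lambda>j. \<tau> ^ j" "{..<n}"] \<tau> by (simp add: suminf_geometric summable_geometric)
      qed
      finally show "(\<Sum>j<n. C * \<tau> ^ (n - j)) \<le> C / (1 - \<tau>)" by simp
      fix j assume j: "j < n"
      show Jp: "0 < J ((f ^^ j) x)" by (rule J_pos[OF xS[OF j]])
      fix q assume q: "q \<in> Q"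
      note cj = ctrl[OF j g(4)[OF q j]]
      show "(f ^^ j) (g q) \<notin> S" by (rule cj(1))
      then have Jq: "0 < J ((f ^^ j) (g q))" by (rule J_pos)
      have e: "J ((f ^^ j) x) = exp (ln (J ((f ^^ j) x)))" "J ((f ^^ j) (g q)) = exp (ln (J ((f ^^ j) (g q))))"
        using Jp Jq by simp_all
      show "exp (- (C * \<tau> ^ (n - j))) * J ((f ^^ j) x) \<le> J ((f ^^ j) (g q))"
        using cj(3) by (subst e(1), subst e(2)) (simp add: exp_add[symmetric] del: exp_ln)
      show "J ((f ^^ j) (g q)) \<le> exp (C * \<tau> ^ (n - j)) * J ((f ^^ j) x)"
        using cj(3) by (subst e(1), subst e(2)) (simp add: exp_add[symmetric] del: exp_ln)
    qed
  qed
  then show ?thesis using g(2) by blast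
qed

text \<open>
  Finitely many coordinate neighbourhoods cover the space, so the transfer bounds over them add up to
  one bound with a constant independent of \<open>n\<close>. The set \<open>S\<close> is null since no point of it has a hyperbolic
  time; away from it \<open>f\<close> is nonsingular, and countably many of the local neighbourhoods suffice.
\<close>

theorem invariant_measure:
  assumes ae: "AE x in m. \<exists>n. H x n"
    and int: "integrable m (\<lambda>x. real (LEAST n. H x n))"
  shows "\<exists>\<mu>. prob_space \<mu> \<and> sets \<mu> = sets borel \<and> absolutely_continuous m \<mu> \<and> distr \<mu> \<mu> f = \<mu>"
proof -
  define \<Theta> where "\<Theta> = C / (1 - \<tau>)"
  define nice where "nice Q \<longleftrightarrow> open Q \<and> connected Q \<and> Q \<noteq> {} \<and>
    (\<forall>x n. H x n \<longrightarrow> (f ^^ n) x \<in> Q \<longrightarrow> (\<exists>g. hyperbolic_section n \<Theta> Q g \<and> g ((f ^^ n) x) = x))" for Q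
  have ex_nice: "\<exists>Q. nice Q \<and> z \<in> Q" for z
  proof -
    obtain U :: "'b set" and Q \<psi> \<phi> K where U: "open U" "convex U" and Q: "open Q" "z \<in> Q"
      and hom: "homeomorphism U Q \<psi> \<phi>" and K: "0 \<le> K"
        "\<forall>u\<in>U. \<forall>v\<in>U. dist (\<psi> u) (\<psi> v) \<le> K * dist u v \<and> K * dist u v < \<rho>"
      using small_charts[of z] by blast
    have "connected Q"
      using connected_continuous_image[OF homeomorphism_cont1[OF hom] convex_connected[OF U(2)]]
        homeomorphism_image1[OF hom] by simp
    moreover have "\<exists>g. hyperbolic_section n \<Theta> Q g \<and> g ((f ^^ n) x) = x" if "H x n" "(f ^^ n) x \<in> Q" for x n
      unfolding \<Theta>_def by (rule hyperbolic_branch[OF that(1) U Q(1) that(2) hom K(1)]) (use K(2) in blast)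
    ultimately have "nice Q" using Q unfolding nice_def by blast
    then show ?thesis using Q(2) by blast
  qed
  obtain \<Q> where \<Q>: "\<Q> \<subseteq> {Q. nice Q}" "finite \<Q>" "UNIV \<subseteq> \<Union>\<Q>"
  proof (rule compactE[OF compact_space, of "{Q. nice Q}"])
    show "UNIV \<subseteq> \<Union>{Q. nice Q}" using ex_nice by auto
    show "open B" if "B \<in> {Q. nice Q}" for B using that by (simp add: nice_def)
  qed
  define D where "D = (\<Sum>Q\<in>\<Q>. exp (2 * \<Theta>) / measure m Q)"
  have fm: "f \<in> m \<rightarrow>\<^sub>M m"
    using borel_measurable_continuous_onI[OF f_cont] by (simp cong: measurable_cong_sets)
  have sp: "space m = UNIV" using sets_eq_imp_space_eq[OF sets_m] by simp
  have HS: "x \<notin> S" if "H x n" for x n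
    using H_control[OF that, of n x] H_pos[OF that] \<rho> \<sigma> by simp
  have oS: "open (- S)"
  proof (subst open_subopen, intro ballI)
    fix w assume "w \<in> - S"
    then show "\<exists>T. open T \<and> w \<in> T \<and> T \<subseteq> - S"
      using f_local_homeo[of w] unfolding local_homeo_at_def by blast
  qed
  have nullS: "S \<in> null_sets m"
  proof -
    have "S \<in> sets m" using oS by (metis borel_closed closed_def sets_m)
    moreover have "AE x in m. x \<notin> S" using ae by eventually_elim (use HS in blast)
    ultimately show ?thesis by (simp add: AE_iff_null_sets[symmetric])
  qed
  show ?thesis
  proof (subst sets_m[symmetric], rule invariant_measure_of_integrable_return_time[where H=H and C=D])
    show "prob_space m" by unfold_locales
    show "f \<in> m \<rightarrow>\<^sub>M m" by (rule fm)
    fix X assume X: "X \<in> null_sets m"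
    define \<V> where "\<V> = {V. open V \<and> f -` X \<inter> V \<in> null_sets m}"
    obtain \<V>' where V': "\<V>' \<subseteq> \<V>" "countable \<V>'" "- S \<subseteq> \<Union>\<V>'"
    proof (rule countable_subcover_compact_metric[OF compact_space])
      show "\<exists>V\<in>\<V>. open V \<and> x \<in> V" if "x \<in> - S" for x
        using local_nonsingular[of x] that X unfolding \<V>_def by blast
    qed
    have "(\<Union>V\<in>\<V>'. f -` X \<inter> V) \<in> null_sets m"
      by (rule null_sets_UN'[OF V'(2)]) (use V'(1) in \<open>auto simp: \<V>_def\<close>)
    then have "(\<Union>V\<in>\<V>'. f -` X \<inter> V) \<union> S \<in> null_sets m" using nullS by (rule null_sets.Un)
    then show "f -` X \<inter> space m \<in> null_sets m"
    proof (rule null_sets_subset)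
      show "f -` X \<inter> space m \<in> sets m" using X fm by (intro measurable_sets) auto
      show "f -` X \<inter> space m \<subseteq> (\<Union>V\<in>\<V>'. f -` X \<inter> V) \<union> S" using V'(3) by blast
    qed
  next
    fix n E X assume E: "E \<in> sets m" "\<And>x. x \<in> E \<Longrightarrow> H x n" and X: "X \<in> sets m"
    have Qb: "Q \<in> sets borel" if "Q \<in> \<Q>" for Q using that \<Q>(1) by (auto simp: nice_def)
    have fX: "(f ^^ n) -` Y \<in> sets borel" if "Y \<in> sets borel" for Y
      using borel_preimage_of_continuous[OF funpow_cont open_UNIV that, of n] by simp
    have "measure m (E \<inter> (f ^^ n) -` X) \<le> measure m (\<Union>Q\<in>\<Q>. E \<inter> (f ^^ n) -` (X \<inter> Q))"
    proof (rule finite_measure_mono)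
      show "E \<inter> (f ^^ n) -` X \<subseteq> (\<Union>Q\<in>\<Q>. E \<inter> (f ^^ n) -` (X \<inter> Q))" using \<Q>(3) by blast
      show "(\<Union>Q\<in>\<Q>. E \<inter> (f ^^ n) -` (X \<inter> Q)) \<in> sets m"
        using \<Q>(2) E X Qb by (intro sets.finite_UN) (auto intro!: sets.Int fX)
    qed
    also have "\<dots> \<le> (\<Sum>Q\<in>\<Q>. measure m (E \<inter> (f ^^ n) -` (X \<inter> Q)))"
      by (rule finite_measure_subadditive_finite[OF \<Q>(2)]) (use E X Qb in \<open>auto intro!: sets.Int fX\<close>)
    also have "\<dots> \<le> (\<Sum>Q\<in>\<Q>. exp (2 * \<Theta>) / measure m Q * measure m X)"
    proof (rule sum_mono)
      fix Q assume Q: "Q \<in> \<Q>"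
      then have "nice Q" using \<Q>(1) by blast
      then have "measure m (E \<inter> (f ^^ n) -` (X \<inter> Q)) \<le> exp (2 * \<Theta>) / measure m Q * measure m (X \<inter> Q)"
        using E X Qb[OF Q] by (intro transfer_bound_over) (auto simp: nice_def)
      also have "\<dots> \<le> exp (2 * \<Theta>) / measure m Q * measure m X"
        using X by (intro mult_left_mono finite_measure_mono) auto
      finally show "measure m (E \<inter> (f ^^ n) -` (X \<inter> Q)) \<le> exp (2 * \<Theta>) / measure m Q * measure m X" .
    qed
    also have "\<dots> = D * measure m X" by (simp add: D_def sum_distrib_right)
    finally show "measure m (E \<inter> (f ^^ n) -` X) \<le> D * measure m X" .
  qed (use H_concat H_pos ae int in auto)
qed

end

section \<open>Change of variables\<close>

text \<open>
  The change of variables formula is transported from index types that carry a well-order to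
  arbitrary finite ones. The type \<open>'n ordered_index\<close> is a well-ordered copy of the index type \<open>'n\<close>.
\<close>

typedef ('n::finite) ordered_index = "{..<CARD('n)}"
  by (rule exI[of _ 0]) simp

instantiation ordered_index :: (finite) wellorder
begin
definition less_eq_ordered_index :: "'a ordered_index \<Rightarrow> 'a ordered_index \<Rightarrow> bool"
  where "i \<le> j \<longleftrightarrow> Rep_ordered_index i \<le> Rep_ordered_index j"
definition less_ordered_index :: "'a ordered_index \<Rightarrow> 'a ordered_index \<Rightarrow> bool"
  where "i < j \<longleftrightarrow> Rep_ordered_index i < Rep_ordered_index j"
instance
proof
  fix P :: "'a ordered_index \<Rightarrow> bool" and a
  assume *: "\<And>x. (\<And>y. y < x \<Longrightarrow> P y) \<Longrightarrow> P x"
  show "P a"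
    by (induction a rule: measure_induct_rule[where f=Rep_ordered_index])
       (auto intro: * simp: less_ordered_index_def)
qed (auto simp: less_eq_ordered_index_def less_ordered_index_def Rep_ordered_index_inject)
end

lemma finite_card_ordered_index:
  "finite (UNIV :: 'n::finite ordered_index set)" "CARD('n ordered_index) = CARD('n)"
proof -
  have *: "bij_betw Rep_ordered_index (UNIV :: 'n ordered_index set) {..<CARD('n)}"
    by (metis Rep_ordered_index_inject bij_betw_def inj_on_def type_definition.Rep_range type_definition_ordered_index)
  show "finite (UNIV :: 'n ordered_index set)"
    using * bij_betw_finite by blast
  show "CARD('n ordered_index) = CARD('n)"
    using bij_betw_same_card[OF *] by simp
qed

instance ordered_index :: (finite) finite
  by standard (rule finite_card_ordered_index)

text \<open>
  Together with \<open>sign_conjugate\<close>: the sign of a permutation does not change under renaming of the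
  points, since transpositions become transpositions.
\<close>

lemma swapidseq_conjugate:
  assumes "swapidseq n p" "bij (\<pi> :: 'k \<Rightarrow> 'n)"
  shows "swapidseq n (inv \<pi> \<circ> p \<circ> \<pi>)"
  using assms(1)
proof induction
  case id
  have eq: "inv \<pi> \<circ> id \<circ> \<pi> = id" using assms(2) by (auto simp: fun_eq_iff bij_is_inj)
  show ?case unfolding eq by (rule swapidseq.id)
next
  case (comp_Suc n p a b)
  have "inv \<pi> \<circ> (Transposition.transpose a b \<circ> p) \<circ> \<pi> = Transposition.transpose (inv \<pi> a) (inv \<pi> b) \<circ> (inv \<pi> \<circ> p \<circ> \<pi>)"
    using assms(2) by (auto simp: fun_eq_iff Transposition.transpose_def bij_is_inj bij_is_surj surj_f_inv_f
          inj_eq[OF bij_is_inj[OF bij_imp_bij_inv[OF assms(2)]]])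
  moreover have "inv \<pi> a \<noteq> inv \<pi> b"
    using comp_Suc(2) assms(2) by (metis bij_inv_eq_iff)
  ultimately show ?case using comp_Suc by (metis swapidseq.comp_Suc)
qed

lemma sign_conjugate:
  assumes "bij (\<pi> :: 'k::finite \<Rightarrow> 'n::finite)" "p permutes (UNIV :: 'n set)"
  shows "sign (inv \<pi> \<circ> p \<circ> \<pi>) = sign p"
proof -
  obtain n where n: "swapidseq n p"
    using permutes_imp_permutation[OF finite assms(2)] unfolding permutation_def by auto
  show ?thesis
    using evenperm_unique[OF n refl] evenperm_unique[OF swapidseq_conjugate[OF n assms(1)] refl]
    by (simp add: sign_def)
qed

lemma det_reindex:
  fixes M :: "real ^ 'n::finite ^ 'n" and \<pi> :: "'k::finite \<Rightarrow> 'n"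
  assumes "bij \<pi>"
  shows "det (\<chi> i j. M $ \<pi> i $ \<pi> j) = det M"
proof -
  have [simp]: "\<pi> (inv \<pi> x) = x" "inv \<pi> (\<pi> y) = y" for x y
    using assms by (auto simp: bij_is_inj bij_is_surj surj_f_inv_f)
  have bi: "bij (inv \<pi>)" using assms by (rule bij_imp_bij_inv)
  have "det M = (\<Sum>p | p permutes UNIV. of_int (sign p) * (\<Prod>i\<in>UNIV. M $ i $ p i))"
    by (simp add: det_def)
  also have "\<dots> = (\<Sum>p | p permutes (UNIV::'k set).
      of_int (sign p) * (\<Prod>i\<in>UNIV. (\<chi> i j. M $ \<pi> i $ \<pi> j) $ i $ p i))"
  proof (rule sum.reindex_bij_witness[where i="\<lambda>p. \<pi> \<circ> p \<circ> inv \<pi>" and j="\<lambda>p. inv \<pi> \<circ> p \<circ> \<pi>"], goal_cases)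
    case (1 a) then show ?case by (auto simp: fun_eq_iff)
  next
    case (2 a) then show ?case using assms bi by (auto intro!: bij_imp_permutes bij_comp dest: permutes_bij)
  next
    case (3 b) then show ?case by (auto simp: fun_eq_iff)
  next
    case (4 b) then show ?case using assms bi by (auto intro!: bij_imp_permutes bij_comp dest: permutes_bij)
  next
    case (5 p)
    have "(\<Prod>i\<in>UNIV. M $ i $ p i) = (\<Prod>i\<in>UNIV. M $ \<pi> i $ p (\<pi> i))"
      by (rule prod.reindex_bij_betw[symmetric, OF assms])
    then show ?case using 5 sign_conjugate[OF assms, of p] by simp
  qed
  finally show ?thesis by (simp add: det_def)
qed

definition reindex :: "('k \<Rightarrow> 'n) \<Rightarrow> real ^ 'n::finite \<Rightarrow> real ^ 'k::finite" where
  "reindex \<pi> v = (\<chi> i. v $ \<pi> i)"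

lemma linear_reindex: "linear (reindex \<pi>)"
  by (auto simp: reindex_def linear_iff vec_eq_iff)

lemma reindex_inverse:
  assumes "bij \<pi>" shows "reindex \<pi> (reindex (inv \<pi>) w) = w" "reindex (inv \<pi>) (reindex \<pi> v) = v"
  using assms by (auto simp: reindex_def vec_eq_iff bij_is_inj bij_is_surj surj_f_inv_f)

lemma measurable_reindex [measurable]: "reindex \<pi> \<in> borel_measurable borel"
  by (intro borel_measurable_continuous_onI linear_continuous_on linear_linear[THEN iffD2] linear_reindex)

text \<open>
  Renaming coordinates permutes the side lengths of boxes.
\<close>

lemma lborel_reindex:
  fixes \<pi> :: "'k::finite \<Rightarrow> 'n::finite"
  assumes "bij \<pi>"
  shows "distr lborel borel (reindex \<pi>) = (lborel :: (real ^ 'k) measure)"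
proof (rule lborel_eqI[symmetric])
  have [simp]: "\<pi> (inv \<pi> x) = x" "inv \<pi> (\<pi> y) = y" for x y
    using assms by (auto simp: bij_is_inj bij_is_surj surj_f_inv_f)
  fix l u :: "real ^ 'k"
  assume lu: "\<And>b. b \<in> Basis \<Longrightarrow> l \<bullet> b \<le> u \<bullet> b"
  have le: "l $ i \<le> u $ i" for i using lu[of "axis i 1"] by (simp add: cart_eq_inner_axis axis_in_Basis_iff)
  have "reindex \<pi> -` box l u = box (reindex (inv \<pi>) l) (reindex (inv \<pi>) u)"
    unfolding reindex_def by (auto simp: mem_box_cart) (metis \<open>\<And>x. \<pi> (inv \<pi> x) = x\<close> | metis \<open>\<And>y. inv \<pi> (\<pi> y) = y\<close>)+
  then have "emeasure (distr lborel borel (reindex \<pi>)) (box l u)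
      = emeasure lborel (box (reindex (inv \<pi>) l) (reindex (inv \<pi>) u))"
    by (simp add: emeasure_distr)
  also have "\<dots> = (\<Prod>b\<in>Basis. (reindex (inv \<pi>) u - reindex (inv \<pi>) l) \<bullet> b)"
    by (rule emeasure_lborel_box)
       (auto simp: Basis_vec_def cart_eq_inner_axis[symmetric] reindex_def le)
  also have "(\<Prod>b\<in>Basis. (reindex (inv \<pi>) u - reindex (inv \<pi>) l) \<bullet> b) = (\<Prod>i\<in>UNIV. (u - l) $ inv \<pi> i)"
    by (simp add: Basis_vec_def UNION_singleton_eq_range axis_eq_axis prod.reindex inj_on_def
          cart_eq_inner_axis[symmetric] reindex_def)
  also have "\<dots> = (\<Prod>i\<in>UNIV. (u - l) $ i)"
    by (rule prod.reindex_bij_betw[OF bij_imp_bij_inv[OF assms], of "\<lambda>i. (u - l) $ i"])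
  also have "\<dots> = (\<Prod>b\<in>Basis. (u - l) \<bullet> b)"
    by (simp add: Basis_vec_def UNION_singleton_eq_range axis_eq_axis prod.reindex inj_on_def
          cart_eq_inner_axis[symmetric])
  finally show "emeasure (distr lborel borel (reindex \<pi>)) (box l u) = ennreal (\<Prod>b\<in>Basis. (u - l) \<bullet> b)" .
qed simp

lemma nn_integral_reindex:
  fixes \<pi> :: "'k::finite \<Rightarrow> 'n::finite"
  assumes "bij \<pi>" "h \<in> borel_measurable borel"
  shows "(\<integral>\<^sup>+x. h (reindex \<pi> x) \<partial>lborel) = (\<integral>\<^sup>+y. h y \<partial>lborel)"
  using nn_integral_distr[of "reindex \<pi>" lborel borel h] assms(2) lborel_reindex[OF assms(1)] by simp

lemma nn_integral_change_of_variables_wellorder: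
  fixes \<phi> :: "real ^ 'n::{finite,wellorder} \<Rightarrow> real" and F :: "real ^ 'n::_ \<Rightarrow> real ^ 'n::_"
  assumes X: "X \<in> sets borel" "F ` X \<in> sets borel"
    and der: "\<And>x. x \<in> X \<Longrightarrow> (F has_derivative F' x) (at x within X)" and inj: "inj_on F X"
    and nonneg: "\<And>y. y \<in> F ` X \<Longrightarrow> 0 \<le> \<phi> y"
    and m1: "(\<lambda>y. indicator (F ` X) y * \<phi> y) \<in> borel_measurable borel"
    and fin: "(\<integral>\<^sup>+y\<in>F ` X. ennreal (\<phi> y) \<partial>lborel) < \<infinity>"
  shows "(\<integral>\<^sup>+x\<in>X. ennreal (\<bar>det (matrix (F' x))\<bar> * \<phi> (F x)) \<partial>lborel) = (\<integral>\<^sup>+y\<in>F ` X. ennreal (\<phi> y) \<partial>lborel)"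
proof -
  have eq: "ennreal (\<phi> y) * indicator (F ` X) y = ennreal (indicator (F ` X) y * \<phi> y)" for y
    by (auto simp: indicator_def)
  have i1: "integrable lborel (\<lambda>y. indicator (F ` X) y * \<phi> y)"
    by (rule integrableI_nonneg) (use m1 fin eq nonneg in \<open>auto simp: indicator_def\<close>)
  then have "integrable lebesgue (\<lambda>y. indicator (F ` X) y * \<phi> y)"
    by (subst integrable_completion) auto
  then have a1: "\<phi> absolutely_integrable_on (F ` X)"
    by (simp add: set_integrable_def)
  define b where "b = integral (F ` X) \<phi>"
  have Xl: "X \<in> sets lebesgue" using X by simp
  have v: "(\<lambda>y. vec (\<phi> y) :: real^1) absolutely_integrable_on (F ` X) \<and>
     integral (F ` X) (\<lambda>y. vec (\<phi> y) :: real^1) = vec b"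
    using a1 by (simp add: absolutely_integrable_on_1_iff integral_on_1_eq b_def)
  have w: "(\<lambda>x. \<bar>det (matrix (F' x))\<bar> *\<^sub>R (vec (\<phi> (F x)) :: real^1)) absolutely_integrable_on X \<and>
     integral X (\<lambda>x. \<bar>det (matrix (F' x))\<bar> *\<^sub>R (vec (\<phi> (F x)) :: real^1)) = vec b"
    by (rule has_absolute_integral_change_of_variables[OF Xl der inj, THEN iffD2, OF _ v])
  then have w': "(\<lambda>x. \<bar>det (matrix (F' x))\<bar> * \<phi> (F x)) absolutely_integrable_on X"
      "integral X (\<lambda>x. \<bar>det (matrix (F' x))\<bar> * \<phi> (F x)) = b"
    by (auto simp add: absolutely_integrable_on_1_iff integral_on_1_eq vec_eq_iff)
  have h2: "((\<lambda>x. \<bar>det (matrix (F' x))\<bar> * \<phi> (F x)) has_integral b) X"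
    using w' by (auto simp: absolutely_integrable_on_def has_integral_iff)
  have h1: "(\<phi> has_integral b) (F ` X)"
    using a1 b_def by (auto simp: absolutely_integrable_on_def has_integral_iff)
  show ?thesis
    using nn_integral_has_integral_lebesgue'[OF _ h2] nn_integral_has_integral_lebesgue'[OF _ h1] nonneg
    by (simp add: mult.commute)
qed

text \<open>
  Conjugating \<open>F\<close> with a renaming of the coordinates changes neither integrals over Lebesgue measure nor
  determinants.
\<close>

theorem nn_integral_change_of_variables:
  fixes \<phi> :: "real ^ 'n::finite \<Rightarrow> real" and F :: "real ^ 'n \<Rightarrow> real ^ 'n"
  assumes X: "X \<in> sets borel" "F ` X \<in> sets borel"
    and der: "\<And>x. x \<in> X \<Longrightarrow> (F has_derivative F' x) (at x within X)" and inj: "inj_on F X"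
    and nonneg: "\<And>y. y \<in> F ` X \<Longrightarrow> 0 \<le> \<phi> y"
    and m1: "(\<lambda>y. indicator (F ` X) y * \<phi> y) \<in> borel_measurable borel"
    and m2: "(\<lambda>x. indicator X x * (\<bar>det (matrix (F' x))\<bar> * \<phi> (F x))) \<in> borel_measurable borel"
    and fin: "(\<integral>\<^sup>+y\<in>F ` X. ennreal (\<phi> y) \<partial>lborel) < \<infinity>"
  shows "(\<integral>\<^sup>+x\<in>X. ennreal (\<bar>det (matrix (F' x))\<bar> * \<phi> (F x)) \<partial>lborel) = (\<integral>\<^sup>+y\<in>F ` X. ennreal (\<phi> y) \<partial>lborel)"
proof -
  have ie: "ennreal a * indicator Z y = ennreal (indicator Z y * a)" for a y and Z :: "(real ^ 'n) set"
    by (auto simp: indicator_def)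
  obtain \<pi> :: "'n ordered_index \<Rightarrow> 'n" where \<pi>: "bij \<pi>"
    using finite_same_card_bij[of "UNIV :: 'n ordered_index set" "UNIV :: 'n set"] finite_card_ordered_index
    by auto
  let ?i = "reindex \<pi>" and ?k = "reindex (inv \<pi>)"
  note inv = reindex_inverse[OF \<pi>]
  note bi = bij_imp_bij_inv[OF \<pi>]
  have lin: "bounded_linear ?i" "bounded_linear ?k"
    by (auto intro: linear_conv_bounded_linear[THEN iffD1] linear_reindex)
  define G where "G = ?i \<circ> F \<circ> ?k"
  define G' where "G' y = ?i \<circ> F' (?k y) \<circ> ?k" for y
  define Y where "Y = ?i ` X"
  have imY: "Y = ?k -` X" unfolding Y_def using inv by (auto simp: image_iff) metis
  have GY: "G ` Y = ?i ` (F ` X)" unfolding Y_def G_def using inv by (auto simp: image_iff)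
  have imG: "?i ` (F ` X) = ?k -` (F ` X)" using inv by (auto simp: image_iff) metis+
  have pre: "?k -` Z \<in> sets borel" if "Z \<in> sets borel" for Z
    using measurable_sets_borel[OF measurable_reindex that] .
  have meas: "Y \<in> sets borel" "G ` Y \<in> sets borel"
    using pre[OF X(1)] pre[OF X(2)] by (simp_all only: GY imG imY[symmetric])
  have indY: "indicator Y y = indicator X (?k y)" for y by (simp add: imY indicator_def)
  have indG: "indicator (G ` Y) y = indicator (F ` X) (?k y)" for y by (simp add: GY imG indicator_def)
  have det: "det (matrix (G' (?i x))) = det (matrix (F' x))" if "x \<in> X" for x
  proof -
    have "matrix (G' (?i x)) = (\<chi> i j. matrix (F' x) $ \<pi> i $ \<pi> j)"
    proof -
      have "?k (axis j 1) = axis (\<pi> j) 1" for j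
        using \<pi> by (auto simp: reindex_def axis_def vec_eq_iff bij_is_inj bij_is_surj surj_f_inv_f)
      then show ?thesis
        by (auto simp: vec_eq_iff matrix_def G'_def inv) (auto simp: reindex_def)
    qed
    then show ?thesis using det_reindex[OF \<pi>] by simp
  qed
  have main: "(\<integral>\<^sup>+y\<in>Y. ennreal (\<bar>det (matrix (G' y))\<bar> * \<phi> (?k (G y))) \<partial>lborel)
      = (\<integral>\<^sup>+y\<in>G ` Y. ennreal (\<phi> (?k y)) \<partial>lborel)"
  proof (rule nn_integral_change_of_variables_wellorder[OF meas])
    show "(G has_derivative G' y) (at y within Y)" if "y \<in> Y" for y
    proof -
      have "(F has_derivative F' (?k y)) (at (?k y) within ?k ` Y)"
        using der[of "?k y"] that by (simp add: imY has_derivative_subset image_subset_iff)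
      then have "(F \<circ> ?k has_derivative F' (?k y) \<circ> ?k) (at y within Y)"
        by (rule diff_chain_within[OF bounded_linear_imp_has_derivative[OF lin(2)]])
      then show ?thesis unfolding G_def G'_def comp_assoc
        by (rule diff_chain_within[OF _ bounded_linear_imp_has_derivative[OF lin(1)]])
    qed
    show "inj_on G Y"
      unfolding Y_def G_def using inj inv by (auto simp: inj_on_def) (metis)
    show "0 \<le> \<phi> (?k y)" if "y \<in> G ` Y" for y
      using that nonneg unfolding GY imG by auto
    show "(\<lambda>y. indicator (G ` Y) y * \<phi> (?k y)) \<in> borel_measurable borel"
      unfolding indG using measurable_compose[OF measurable_reindex m1] by simp
    show "(\<integral>\<^sup>+y\<in>G ` Y. ennreal (\<phi> (?k y)) \<partial>lborel) < \<infinity>"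
    proof -
      have "(\<integral>\<^sup>+y. ennreal (indicator (F ` X) (?k y) * \<phi> (?k y)) \<partial>lborel) = (\<integral>\<^sup>+y. ennreal (indicator (F ` X) y * \<phi> y) \<partial>lborel)"
        by (rule nn_integral_reindex[OF bi, of "\<lambda>y. ennreal (indicator (F ` X) y * \<phi> y)"]) (use m1 in auto)
      then show ?thesis using fin unfolding indG ie by simp
    qed
  qed
  have "(\<integral>\<^sup>+x\<in>X. ennreal (\<bar>det (matrix (F' x))\<bar> * \<phi> (F x)) \<partial>lborel)
      = (\<integral>\<^sup>+x. ennreal (indicator X x * (\<bar>det (matrix (F' x))\<bar> * \<phi> (F x))) \<partial>lborel)"
    by (simp only: ie)
  also have "\<dots> = (\<integral>\<^sup>+y. ennreal (indicator X (?k y) * (\<bar>det (matrix (F' (?k y)))\<bar> * \<phi> (F (?k y)))) \<partial>lborel)"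
    by (rule nn_integral_reindex[OF bi, symmetric]) (use m2 in auto)
  also have "\<dots> = (\<integral>\<^sup>+y\<in>Y. ennreal (\<bar>det (matrix (G' y))\<bar> * \<phi> (?k (G y))) \<partial>lborel)"
  proof (rule nn_integral_cong)
    fix y
    show "ennreal (indicator X (?k y) * (\<bar>det (matrix (F' (?k y)))\<bar> * \<phi> (F (?k y)))) = ennreal (\<bar>det (matrix (G' y))\<bar> * \<phi> (?k (G y))) * indicator Y y"
      using det[of "?k y"] by (cases "?k y \<in> X") (auto simp: inv G_def imY)
  qed
  also note main
  also have "(\<integral>\<^sup>+y\<in>G ` Y. ennreal (\<phi> (?k y)) \<partial>lborel) = (\<integral>\<^sup>+y. ennreal (indicator (F ` X) (?k y) * \<phi> (?k y)) \<partial>lborel)"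
    by (rule nn_integral_cong) (simp add: GY imG indicator_def)
  also have "\<dots> = (\<integral>\<^sup>+y. ennreal (indicator (F ` X) y * \<phi> y) \<partial>lborel)"
    by (rule nn_integral_reindex[OF bi, of "\<lambda>y. ennreal (indicator (F ` X) y * \<phi> y)"]) (use m1 in auto)
  finally show ?thesis by (simp only: ie)
qed

section \<open>Positive definite forms\<close>

definition inner_form :: "('a::euclidean_space \<Rightarrow> 'a \<Rightarrow> real) \<Rightarrow> bool" where
  "inner_form G \<longleftrightarrow> bilinear G \<and> (\<forall>v w. G v w = G w v) \<and> (\<forall>v. v \<noteq> 0 \<longrightarrow> 0 < G v v)"

lemma inner_form_bilinear: "inner_form G \<Longrightarrow> bilinear G"
  by (simp add: inner_form_def)

lemma inner_form_simps:
  assumes "inner_form G"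
  shows "G (u + v) w = G u w + G v w" "G u (v + w) = G u v + G u w"
    "G (c *\<^sub>R v) w = c * G v w" "G v (c *\<^sub>R w) = c * G v w" "G 0 w = 0" "G v 0 = 0"
    "G (u - v) w = G u w - G v w" "G u (v - w) = G u v - G u w"
  using inner_form_bilinear[OF assms]
  by (simp_all add: bilinear_ladd bilinear_radd bilinear_lmul bilinear_rmul bilinear_lzero bilinear_rzero
      bilinear_lsub bilinear_rsub)

lemma inner_form_nonneg: "inner_form G \<Longrightarrow> 0 \<le> G v v"
  by (cases "v = 0") (auto simp: inner_form_def inner_form_simps less_imp_le)

text \<open>
  The right-hand side shows that continuity in a parameter on basis vectors is enough for forms.
\<close>

lemma bilinear_expand:
  fixes G :: "'a::euclidean_space \<Rightarrow> 'a \<Rightarrow> real"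
  assumes "bilinear G"
  shows "G v w = (\<Sum>a\<in>Basis. \<Sum>b\<in>Basis. (v \<bullet> a) * (w \<bullet> b) * G a b)"
proof -
  have "G v w = G (\<Sum>a\<in>Basis. (v \<bullet> a) *\<^sub>R a) (\<Sum>b\<in>Basis. (w \<bullet> b) *\<^sub>R b)"
    by (simp add: euclidean_representation)
  also have "\<dots> = (\<Sum>(a,b)\<in>Basis \<times> Basis. G ((v \<bullet> a) *\<^sub>R a) ((w \<bullet> b) *\<^sub>R b))"
    by (rule bilinear_sum[OF assms])
  also have "\<dots> = (\<Sum>a\<in>Basis. \<Sum>b\<in>Basis. (v \<bullet> a) * (w \<bullet> b) * G a b)"
    by (simp add: sum.cartesian_product bilinear_lmul[OF assms] bilinear_rmul[OF assms] ac_simps)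
  finally show ?thesis .
qed

lemma inner_form_cauchy_schwarz:
  assumes G: "inner_form G"
  shows "G v w \<le> sqrt (G v v) * sqrt (G w w)"
proof (cases "w = 0")
  case True then show ?thesis by (simp add: inner_form_simps[OF G])
next
  case False
  then have w: "0 < G w w" using G by (simp add: inner_form_def)
  have sym: "G w v = G v w" using G by (simp add: inner_form_def)
  define s where "s = G v w / G w w"
  have "0 \<le> G (v - s *\<^sub>R w) (v - s *\<^sub>R w)" by (rule inner_form_nonneg[OF G])
  also have "\<dots> = G v v - G v w * G v w / G w w"
    using w by (simp add: inner_form_simps[OF G] sym s_def field_simps)
  finally have "G v w * G v w \<le> G v v * G w w" using w by (simp add: field_simps)
  then have "(G v w)\<^sup>2 \<le> G v v * G w w" by (simp add: power2_eq_square)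
  then have "\<bar>G v w\<bar> \<le> sqrt (G v v * G w w)" by (rule real_le_rsqrt[of "\<bar>G v w\<bar>", simplified])
  then show ?thesis by (simp add: real_sqrt_mult)
qed

lemma inner_form_triangle:
  assumes G: "inner_form G"
  shows "sqrt (G (v + w) (v + w)) \<le> sqrt (G v v) + sqrt (G w w)"
proof (rule real_le_lsqrt)
  have sym: "G w v = G v w" using G by (simp add: inner_form_def)
  have "G (v + w) (v + w) = G v v + 2 * G v w + G w w" by (simp add: inner_form_simps[OF G] sym)
  also have "\<dots> \<le> G v v + 2 * (sqrt (G v v) * sqrt (G w w)) + G w w"
    using inner_form_cauchy_schwarz[OF G, of v w] by simp
  also have "\<dots> = (sqrt (G v v) + sqrt (G w w))\<^sup>2"
    using inner_form_nonneg[OF G] by (simp add: power2_sum)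
  finally show "G (v + w) (v + w) \<le> (sqrt (G v v) + sqrt (G w w))\<^sup>2" .
qed (intro add_nonneg_nonneg real_sqrt_ge_zero inner_form_nonneg[OF G])

lemma inner_form_norm_bounds:
  fixes G :: "'a::euclidean_space \<Rightarrow> 'a \<Rightarrow> real"
  assumes G: "inner_form G"
  obtains a b where "0 < a" "0 < b" "\<And>v. a * norm v \<le> sqrt (G v v)" "\<And>v. sqrt (G v v) \<le> b * norm v"
proof -
  have cont: "continuous_on (sphere 0 1) (\<lambda>v. G v v)"
  proof -
    have "(\<lambda>v. G v v) = (\<lambda>v. \<Sum>a\<in>Basis. \<Sum>b\<in>Basis. (v \<bullet> a) * (v \<bullet> b) * G a b)"
      by (intro ext bilinear_expand inner_form_bilinear G)
    then show ?thesis by (simp only:) (intro continuous_intros)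
  qed
  have ne: "sphere 0 1 \<noteq> ({} :: 'a set)" by simp
  obtain u where u: "u \<in> sphere 0 1" "\<And>v. v \<in> sphere 0 1 \<Longrightarrow> G u u \<le> G v v"
    using continuous_attains_inf[OF compact_sphere ne cont] by blast
  obtain w where w: "w \<in> sphere 0 1" "\<And>v. v \<in> sphere 0 1 \<Longrightarrow> G v v \<le> G w w"
    using continuous_attains_sup[OF compact_sphere ne cont] by blast
  have pos: "0 < G v v" if "v \<in> sphere 0 1" for v
  proof -
    have "v \<noteq> 0" using that by auto
    then show ?thesis using G unfolding inner_form_def by blast
  qed
  have hom: "sqrt (G v v) = norm v * sqrt (G (v /\<^sub>R norm v) (v /\<^sub>R norm v))" if "v \<noteq> 0" for v
  proof -
    have "G v v = (norm v)\<^sup>2 * G (v /\<^sub>R norm v) (v /\<^sub>R norm v)"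
      using that by (simp add: inner_form_simps[OF G] field_simps power2_eq_square)
    then have "sqrt (G v v) = sqrt ((norm v)\<^sup>2) * sqrt (G (v /\<^sub>R norm v) (v /\<^sub>R norm v))"
      by (simp only: real_sqrt_mult)
    then show ?thesis by simp
  qed
  show thesis
  proof (rule that[of "sqrt (G u u)" "sqrt (G w w)"])
    show "sqrt (G u u) * norm v \<le> sqrt (G v v)" for v
    proof (cases "v = 0")
      case False
      have "sqrt (G u u) \<le> sqrt (G (v /\<^sub>R norm v) (v /\<^sub>R norm v))" using u(2) False by simp
      then show ?thesis using hom[OF False] by (simp add: mult.commute mult_left_mono)
    qed (simp add: inner_form_simps[OF G])
    show "sqrt (G v v) \<le> sqrt (G w w) * norm v" for v
    proof (cases "v = 0")
      case False
      have "sqrt (G (v /\<^sub>R norm v) (v /\<^sub>R norm v)) \<le> sqrt (G w w)" using w(2) False by simp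
      then show ?thesis using hom[OF False] by (simp add: mult.commute mult_left_mono)
    qed (simp add: inner_form_simps[OF G])
  qed (use pos u w in auto)
qed

text \<open>
  Forms that converge pointwise converge relative to a positive definite limit: entries converge, and
  the limit dominates a multiple of the Euclidean norm.
\<close>

lemma forms_converge_uniformly:
  fixes G :: "'a::euclidean_space \<Rightarrow> 'a \<Rightarrow> real" and H :: "'p \<Rightarrow> 'a \<Rightarrow> 'a \<Rightarrow> real"
  assumes G: "inner_form G" and bil: "\<forall>\<^sub>F p in F. bilinear (H p)"
    and lim: "\<And>v w. ((\<lambda>p. H p v w) \<longlongrightarrow> G v w) F" and e: "0 < e"
  shows "\<forall>\<^sub>F p in F. \<forall>v. (1 - e) * sqrt (G v v) \<le> sqrt (H p v v) \<and> sqrt (H p v v) \<le> (1 + e) * sqrt (G v v)"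
proof -
  define e' where "e' = min e 1"
  have e': "0 < e'" "e' \<le> e" "e' \<le> 1" using e by (auto simp: e'_def)
  obtain a b where ab: "0 < a" "\<And>v. a * norm v \<le> sqrt (G v v)"
    using inner_form_norm_bounds[OF G] by metis
  define \<eta> where "\<eta> = e' * a\<^sup>2 / (real DIM('a))\<^sup>2"
  have \<eta>: "0 < \<eta>" using e' ab(1) by (simp add: \<eta>_def)
  have "\<forall>\<^sub>F p in F. \<forall>i\<in>Basis. \<forall>j\<in>Basis. \<bar>H p i j - G i j\<bar> < \<eta>"
  proof (intro eventually_ball_finite finite_Basis ballI)
    fix i j :: 'a
    show "\<forall>\<^sub>F p in F. \<bar>H p i j - G i j\<bar> < \<eta>"
      using tendstoD[OF lim[of i j] \<eta>] by (simp add: dist_real_def)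
  qed
  with bil show ?thesis
  proof eventually_elim
    case (elim p)
    show ?case
    proof
      fix v
      have "\<bar>H p v v - G v v\<bar> = \<bar>\<Sum>i\<in>Basis. \<Sum>j\<in>Basis. (v \<bullet> i) * (v \<bullet> j) * (H p i j - G i j)\<bar>"
        unfolding bilinear_expand[OF elim(1), of v v] bilinear_expand[OF inner_form_bilinear[OF G], of v v]
        by (simp add: sum_subtractf right_diff_distrib)
      also have "\<dots> \<le> (\<Sum>i\<in>(Basis :: 'a set). \<Sum>j\<in>(Basis :: 'a set). (norm v)\<^sup>2 * \<eta>)"
      proof (intro order_trans[OF sum_abs] sum_mono)
        fix i j :: 'a assume ij: "i \<in> Basis" "j \<in> Basis"
        have "\<bar>(v \<bullet> i) * (v \<bullet> j) * (H p i j - G i j)\<bar> = \<bar>v \<bullet> i\<bar> * \<bar>v \<bullet> j\<bar> * \<bar>H p i j - G i j\<bar>"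
          by (simp add: abs_mult)
        also have "\<dots> \<le> norm v * norm v * \<eta>"
          using ij elim(2) by (intro mult_mono Basis_le_norm) (auto intro: less_imp_le)
        finally show "\<bar>(v \<bullet> i) * (v \<bullet> j) * (H p i j - G i j)\<bar> \<le> (norm v)\<^sup>2 * \<eta>"
          by (simp add: power2_eq_square)
      qed
      also have "\<dots> = e' * (a * norm v)\<^sup>2" by (simp add: \<eta>_def field_simps power2_eq_square)
      also have "\<dots> \<le> e' * (sqrt (G v v))\<^sup>2"
        using e' ab by (intro mult_left_mono power_mono) auto
      also have "\<dots> = e' * G v v" using inner_form_nonneg[OF G] by simp
      finally have d: "\<bar>H p v v - G v v\<bar> \<le> e' * G v v" .
      have G0: "0 \<le> G v v" by (rule inner_form_nonneg[OF G])
      have "sqrt (H p v v) \<le> sqrt ((1 + e')\<^sup>2 * G v v)"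
      proof (rule real_sqrt_le_mono)
        have "(1 + e') * G v v \<le> (1 + e')\<^sup>2 * G v v"
          using e' G0 by (intro mult_right_mono) (auto simp: power2_eq_square)
        then show "H p v v \<le> (1 + e')\<^sup>2 * G v v" using d by (simp add: algebra_simps)
      qed
      also have "\<dots> = (1 + e') * sqrt (G v v)" using e' by (simp add: real_sqrt_mult)
      also have "\<dots> \<le> (1 + e) * sqrt (G v v)" using e' G0 by (intro mult_right_mono) auto
      finally have 1: "sqrt (H p v v) \<le> (1 + e) * sqrt (G v v)" .
      have "(1 - e) * sqrt (G v v) \<le> (1 - e') * sqrt (G v v)" using e' G0 by (intro mult_right_mono) auto
      also have "\<dots> = sqrt ((1 - e')\<^sup>2 * G v v)" using e' by (simp add: real_sqrt_mult)
      also have "\<dots> \<le> sqrt (H p v v)"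
      proof (rule real_sqrt_le_mono)
        have "(1 - e')\<^sup>2 * G v v \<le> (1 - e') * G v v"
          using e' G0 by (intro mult_right_mono) (auto simp: power2_eq_square mult_left_le)
        then show "(1 - e')\<^sup>2 * G v v \<le> H p v v" using d by (simp add: algebra_simps)
      qed
      finally show "(1 - e) * sqrt (G v v) \<le> sqrt (H p v v) \<and> sqrt (H p v v) \<le> (1 + e) * sqrt (G v v)"
        using 1 by simp
    qed
  qed
qed

text \<open>
  The determinant is nonzero along the segment of positive definite matrices that joins the identity to
  the Gram matrix, hence of constant sign.
\<close>

lemma gram_det_pos:
  fixes G :: "real ^ 'n::finite \<Rightarrow> real ^ 'n \<Rightarrow> real"
  assumes G: "inner_form G"
  shows "0 < gram_det G"
proof -
  define M :: "real \<Rightarrow> real ^ 'n ^ 'n"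
    where "M t = (\<chi> i j. (1 - t) * (if i = j then 1 else 0) + t * G (axis i 1) (axis j 1))" for t
  have nz: "det (M t) \<noteq> 0" if t: "0 \<le> t" "t \<le> 1" for t
  proof
    assume "det (M t) = 0"
    then obtain v where v: "v \<noteq> 0" "M t *v v = 0"
      using invertible_det_nz[of "M t"] matrix_left_invertible_ker[of "M t"] invertible_left_inverse[of "M t"] by metis
    have "v \<bullet> (M t *v v) = (1 - t) * (v \<bullet> v) + t * G v v"
    proof -
      have comp: "(M t *v v) $ i = (1 - t) * v $ i + t * (\<Sum>j\<in>UNIV. v $ j * G (axis i 1) (axis j 1))" for i
      proof -
        have "(M t *v v) $ i = (\<Sum>j\<in>UNIV. (1 - t) * (if i = j then v $ j else 0) + t * (v $ j * G (axis i 1) (axis j 1)))"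
          unfolding M_def matrix_vector_mult_def by (auto intro!: sum.cong simp: algebra_simps)
        then show ?thesis by (simp add: sum.distrib sum_distrib_left[symmetric])
      qed
      have "v \<bullet> (M t *v v) = (\<Sum>i\<in>UNIV. v $ i * ((1 - t) * v $ i + t * (\<Sum>j\<in>UNIV. v $ j * G (axis i 1) (axis j 1))))"
        unfolding inner_vec_def inner_real_def comp ..
      also have "\<dots> = (1 - t) * (v \<bullet> v) + t * (\<Sum>i\<in>UNIV. \<Sum>j\<in>UNIV. v $ i * (v $ j) * G (axis i 1) (axis j 1))"
        by (simp add: inner_vec_def sum.distrib sum_distrib_left distrib_left ac_simps)
      also have "(\<Sum>i\<in>UNIV. \<Sum>j\<in>UNIV. v $ i * (v $ j) * G (axis i 1) (axis j 1)) = G v v"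
        unfolding bilinear_expand[OF inner_form_bilinear[OF G], of v v]
        by (simp add: Basis_vec_def UNION_singleton_eq_range axis_eq_axis sum.reindex inj_on_def cart_eq_inner_axis[symmetric])
      finally show ?thesis .
    qed
    moreover have "0 < v \<bullet> v" "0 < G v v" using v(1) G by (auto simp: inner_form_def)
    then have "0 < (1 - t) * (v \<bullet> v) + t * G v v"
      using t by (cases "t = 0") (auto intro!: add_nonneg_pos mult_nonneg_nonneg mult_pos_pos)
    ultimately show False using v(2) by simp
  qed
  have cont: "continuous_on {0..1} (\<lambda>t. det (M t))"
    unfolding det_def M_def by (intro continuous_intros)
  have M0: "det (M 0) = 1"
  proof -
    have "M 0 = mat 1" by (simp add: M_def mat_def)
    then show ?thesis by (simp add: det_I)
  qed
  have "0 < det (M 1)"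
  proof (rule ccontr)
    assume "\<not> 0 < det (M 1)"
    then obtain t where "0 \<le> t" "t \<le> 1" "det (M t) = 0"
      using IVT2'[of "\<lambda>t. det (M t)" 1 0 0] cont M0 by auto
    then show False using nz by blast
  qed
  then show ?thesis by (simp add: M_def gram_det_def)
qed

lemma gram_det_pullback:
  fixes G :: "real ^ 'n::finite \<Rightarrow> real ^ 'n \<Rightarrow> real"
  assumes G: "bilinear G" and T: "linear T"
  shows "gram_det (\<lambda>v w. G (T v) (T w)) = (det (matrix T))\<^sup>2 * gram_det G"
proof -
  define M :: "real ^ 'n ^ 'n" where "M = (\<chi> i j. G (axis i 1) (axis j 1))"
  have expand: "G v w = (\<Sum>k\<in>UNIV. \<Sum>l\<in>UNIV. v $ k * w $ l * G (axis k 1) (axis l 1))" for v w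
    unfolding bilinear_expand[OF G, of v w]
    by (simp add: Basis_vec_def UNION_singleton_eq_range axis_eq_axis sum.reindex inj_on_def cart_eq_inner_axis[symmetric])
  have "(\<chi> i j. G (T (axis i 1)) (T (axis j 1))) = transpose (matrix T) ** M ** matrix T"
  proof (simp only: vec_eq_iff, intro allI)
    fix i j :: 'n
    have "(transpose (matrix T) ** M ** matrix T) $ i $ j
        = (\<Sum>l\<in>UNIV. \<Sum>k\<in>UNIV. T (axis i 1) $ k * T (axis j 1) $ l * G (axis k 1) (axis l 1))"
      by (simp add: matrix_matrix_mult_def transpose_def matrix_def M_def sum_distrib_right sum_distrib_left ac_simps)
    also have "\<dots> = (\<Sum>k\<in>UNIV. \<Sum>l\<in>UNIV. T (axis i 1) $ k * T (axis j 1) $ l * G (axis k 1) (axis l 1))"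
      by (rule sum.swap)
    also have "\<dots> = G (T (axis i 1)) (T (axis j 1))" by (rule expand[symmetric])
    finally show "(\<chi> i j. G (T (axis i 1)) (T (axis j 1))) $ i $ j = (transpose (matrix T) ** M ** matrix T) $ i $ j"
      by simp
  qed
  then have "gram_det (\<lambda>v w. G (T v) (T w)) = det (transpose (matrix T) ** M ** matrix T)"
    by (simp add: gram_det_def)
  also have "\<dots> = (det (matrix T))\<^sup>2 * gram_det G"
    by (simp add: det_mul det_transpose gram_det_def M_def power2_eq_square)
  finally show ?thesis .
qed

section \<open>Maps of class C1 on open sets\<close>

lemma Ck_on_Suc_has_derivative:
  assumes "Ck_on (Suc k) F U" "open U" "p \<in> U"
  shows "(F has_derivative frechet_derivative F (at p)) (at p)"
proof -
  have "F differentiable (at p within U)"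
    using assms(1,3) unfolding Ck_on.simps differentiable_on_def by blast
  then have "F differentiable (at p)" by (simp only: at_within_open[OF assms(3,2)])
  then show ?thesis by (simp add: frechet_derivative_works)
qed

lemma Ck_on_continuous: "Ck_on k F U \<Longrightarrow> continuous_on U F"
  by (cases k) (auto simp: differentiable_imp_continuous_on)

lemma Ck_on_derivative_continuous:
  "Ck_on (Suc k) F U \<Longrightarrow> continuous_on U (\<lambda>x. frechet_derivative F (at x) v)"
  by (rule Ck_on_continuous[of k]) (simp only: Ck_on.simps)

lemma smooth_on_Ck: "smooth_on F U \<Longrightarrow> Ck_on k F U"
  by (simp add: smooth_on_def)

lemma isCont_tendsto_nhds: "isCont f x \<Longrightarrow> (f \<longlongrightarrow> f x) (nhds x)"
  by (simp add: isCont_def tendsto_at_iff_tendsto_nhds)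

section \<open>Riemannian metrics in charts\<close>

text \<open>
  For the coordinate change from \<open>c\<close> to \<open>d\<close>, \<open>trans c d p\<close> is its derivative at the coordinate point \<open>p\<close>,
  and \<open>met c p\<close> is the metric in the coordinates \<open>c\<close>. Tangent vectors are given in the coordinates selected
  at each point; working with \<open>met\<close> in one fixed chart makes this selection, which varies from point
  to point without any continuity, disappear.
\<close>

locale riemannian_manifold =
  fixes A :: "('m::metric_space, 'n::finite) chart set" and g :: "('m, 'n) metric_field"
  assumes atlas: "smooth_atlas A" and metric: "riemannian_metric A g"
begin

abbreviation coords :: "('m, 'n) chart \<Rightarrow> (real ^ 'n) set" where "coords c \<equiv> snd c ` fst c"

lemma chart:
  assumes "c \<in> A"
  shows "open (fst c)" "open (coords c)" "continuous_on (fst c) (snd c)" "continuous_on (coords c) (chart_inv c)"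
    and "x \<in> fst c \<Longrightarrow> chart_inv c (snd c x) = x" "p \<in> coords c \<Longrightarrow> snd c (chart_inv c p) = p"
    and "p \<in> coords c \<Longrightarrow> chart_inv c p \<in> fst c"
    and "homeomorphism (fst c) (coords c) (snd c) (chart_inv c)"
proof -
  have t: "topological_chart c" using atlas assms by (auto simp: smooth_atlas_def)
  then show h: "homeomorphism (fst c) (coords c) (snd c) (chart_inv c)"
    and "open (fst c)" "open (coords c)" by (auto simp: topological_chart_def)
  show "continuous_on (fst c) (snd c)" "continuous_on (coords c) (chart_inv c)"
    "x \<in> fst c \<Longrightarrow> chart_inv c (snd c x) = x" "p \<in> coords c \<Longrightarrow> snd c (chart_inv c p) = p"
    "p \<in> coords c \<Longrightarrow> chart_inv c p \<in> fst c"
    using h by (auto simp: homeomorphism_def)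
qed

lemma chart_isCont:
  assumes "c \<in> A"
  shows "x \<in> fst c \<Longrightarrow> isCont (snd c) x" "p \<in> coords c \<Longrightarrow> isCont (chart_inv c) p"
  using chart[OF assms] by (auto simp: continuous_on_eq_continuous_at)

lemma chart_image_open:
  assumes "c \<in> A" "open W" "W \<subseteq> fst c"
  shows "open (snd c ` W)"
proof -
  have "snd c ` W = coords c \<inter> chart_inv c -` W"
    using chart(5)[OF assms(1)] assms(3) by force
  then show ?thesis using continuous_open_preimage[OF chart(4,2)[OF assms(1)] assms(2)] by simp
qed

lemma chart_inv_image_open:
  assumes "c \<in> A" "open W" "W \<subseteq> coords c"
  shows "open (chart_inv c ` W)"
proof -
  have "chart_inv c ` W = fst c \<inter> snd c -` W"
    using chart(5,6,7)[OF assms(1)] assms(3) by force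
  then show ?thesis using continuous_open_preimage[OF chart(3,1)[OF assms(1)] assms(2)] by simp
qed

lemma chart_at: "chart_at A x \<in> A" "x \<in> fst (chart_at A x)"
proof -
  have "x \<in> (\<Union>c\<in>A. fst c)" using atlas by (simp add: smooth_atlas_def)
  then have "\<exists>c. c \<in> A \<and> x \<in> fst c" by blast
  then have "chart_at A x \<in> A \<and> x \<in> fst (chart_at A x)" unfolding chart_at_def by (rule someI_ex)
  then show "chart_at A x \<in> A" "x \<in> fst (chart_at A x)" by auto
qed

definition trans :: "('m, 'n) chart \<Rightarrow> ('m, 'n) chart \<Rightarrow> real ^ 'n \<Rightarrow> real ^ 'n \<Rightarrow> real ^ 'n" where
  "trans c d p = frechet_derivative (snd d \<circ> chart_inv c) (at p)"

lemma overlap_open: "c \<in> A \<Longrightarrow> d \<in> A \<Longrightarrow> open (snd c ` (fst c \<inter> fst d))"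
  by (intro chart_image_open) (auto simp: chart)

lemma transition_smooth: "c \<in> A \<Longrightarrow> d \<in> A \<Longrightarrow> smooth_on (snd d \<circ> chart_inv c) (snd c ` (fst c \<inter> fst d))"
  using atlas by (auto simp: smooth_atlas_def smoothly_compatible_def)

lemma trans_has_derivative:
  assumes "c \<in> A" "d \<in> A" "x \<in> fst c" "x \<in> fst d"
  shows "(snd d \<circ> chart_inv c has_derivative trans c d (snd c x)) (at (snd c x))"
  unfolding trans_def
  by (rule Ck_on_Suc_has_derivative[OF smooth_on_Ck[OF transition_smooth[OF assms(1,2)]] overlap_open[OF assms(1,2)]])
     (use assms in auto)

lemma trans_continuous:
  assumes "c \<in> A" "d \<in> A"
  shows "continuous_on (snd c ` (fst c \<inter> fst d)) (\<lambda>p. trans c d p v)"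
  unfolding trans_def by (rule Ck_on_derivative_continuous[OF smooth_on_Ck[OF transition_smooth[OF assms]]])

lemma trans_linear:
  assumes "c \<in> A" "d \<in> A" "x \<in> fst c" "x \<in> fst d"
  shows "linear (trans c d (snd c x))"
  using trans_has_derivative[OF assms] has_derivative_linear by blast

lemma trans_id:
  assumes "c \<in> A" "x \<in> fst c"
  shows "trans c c (snd c x) v = v"
proof -
  have "((\<lambda>q. q) has_derivative trans c c (snd c x)) (at (snd c x))"
  proof (rule has_derivative_transform_within_open[OF trans_has_derivative[OF assms(1,1,2,2)] chart(2)[OF assms(1)]])
    show "snd c x \<in> coords c" using assms by auto
    show "(snd c \<circ> chart_inv c) q = q" if "q \<in> coords c" for q using chart(6)[OF assms(1) that] by simp
  qed
  moreover have "((\<lambda>q. q) has_derivative (\<lambda>v. v)) (at (snd c x))" by (rule has_derivative_ident)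
  ultimately have "trans c c (snd c x) = (\<lambda>v. v)" by (rule has_derivative_unique)
  then show ?thesis by simp
qed

lemma trans_trans:
  assumes "c \<in> A" "d \<in> A" "e \<in> A" "x \<in> fst c" "x \<in> fst d" "x \<in> fst e"
  shows "trans d e (snd d x) (trans c d (snd c x) v) = trans c e (snd c x) v"
proof -
  have inv: "chart_inv c (snd c x) = x" by (rule chart(5)[OF assms(1,4)])
  have "((snd e \<circ> chart_inv d) \<circ> (snd d \<circ> chart_inv c) has_derivative trans d e (snd d x) \<circ> trans c d (snd c x)) (at (snd c x))"
    using trans_has_derivative[OF assms(1,2,4,5)] trans_has_derivative[OF assms(2,3,5,6)]
    by (intro diff_chain_at) (simp_all add: inv)
  then have "(snd e \<circ> chart_inv c has_derivative trans d e (snd d x) \<circ> trans c d (snd c x)) (at (snd c x))"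
  proof (rule has_derivative_transform_within_open[OF _ overlap_open[OF assms(1,2)]])
    show "snd c x \<in> snd c ` (fst c \<inter> fst d)" using assms by auto
    show "((snd e \<circ> chart_inv d) \<circ> (snd d \<circ> chart_inv c)) q = (snd e \<circ> chart_inv c) q"
      if "q \<in> snd c ` (fst c \<inter> fst d)" for q
      using that chart(5)[OF assms(1)] chart(5)[OF assms(2)] by auto
  qed
  from has_derivative_unique[OF this trans_has_derivative[OF assms(1,3,4,6)]]
  show ?thesis by (metis comp_apply)
qed

lemma trans_inverse:
  assumes "c \<in> A" "d \<in> A" "x \<in> fst c" "x \<in> fst d"
  shows "trans d c (snd d x) (trans c d (snd c x) v) = v"
  using trans_trans[OF assms(1,2,1,3,4,3)] trans_id[OF assms(1,3)] by simp

abbreviation met where "met c p \<equiv> metric_in_chart A g c p"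

lemma met_eq: "met c p v w = g (chart_inv c p) (trans c (chart_at A (chart_inv c p)) p v)
    (trans c (chart_at A (chart_inv c p)) p w)"
  by (simp add: metric_in_chart_def trans_def Let_def)

lemma g_inner_form: "inner_form (g x)"
  using metric by (auto simp: riemannian_metric_def inner_form_def)

lemma met_chart:
  assumes "c \<in> A" "x \<in> fst c"
  shows "met c (snd c x) v w = g x (trans c (chart_at A x) (snd c x) v) (trans c (chart_at A x) (snd c x) w)"
  using chart(5)[OF assms] by (simp add: met_eq)

text \<open>
  Positive definiteness is inherited because the coordinate change has an inverse.
\<close>

lemma met_inner_form:
  assumes "c \<in> A" "p \<in> coords c"
  shows "inner_form (met c p)"
proof -
  obtain x where x: "x \<in> fst c" "p = snd c x" using assms by auto
  define T where "T = trans c (chart_at A x) (snd c x)"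
  have met: "met c p v w = g x (T v) (T w)" for v w
    using met_chart[OF assms(1) x(1)] by (simp add: x(2) T_def)
  have T: "linear T" unfolding T_def by (rule trans_linear[OF assms(1) chart_at(1) x(1) chart_at(2)])
  have T0: "T v \<noteq> 0" if "v \<noteq> 0" for v
  proof
    assume "T v = 0"
    then have "v = trans (chart_at A x) c (snd (chart_at A x) x) 0"
      using trans_inverse[OF assms(1) chart_at(1) x(1) chart_at(2), of v] by (simp add: T_def)
    also have "\<dots> = 0" by (rule linear_0[OF trans_linear[OF chart_at(1) assms(1) chart_at(2) x(1)]])
    finally show False using that by simp
  qed
  have G: "inner_form (g x)" by (rule g_inner_form)
  have "bilinear (met c p)"
    unfolding bilinear_def met
    by (auto simp: linear_iff inner_form_simps[OF G] linear_add[OF T] linear_cmul[OF T])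
  then show ?thesis
    unfolding inner_form_def using T0 G by (auto simp: met inner_form_def)
qed

lemma met_Ck: "c \<in> A \<Longrightarrow> Ck_on k (\<lambda>p. met c p v w) (coords c)"
  using metric by (auto simp: riemannian_metric_def smooth_on_def)

lemma met_isCont: "c \<in> A \<Longrightarrow> p \<in> coords c \<Longrightarrow> isCont (\<lambda>p. met c p v w) p"
  by (rule continuous_on_eq_continuous_at[THEN iffD1, rule_format, OF chart(2) Ck_on_continuous[OF met_Ck[of c 0]]])

lemma met_near:
  assumes c: "c \<in> A" and p0: "p0 \<in> coords c" and e: "0 < e"
  shows "\<forall>\<^sub>F p in nhds p0. p \<in> coords c \<and>
    (\<forall>v. (1 - e) * sqrt (met c p0 v v) \<le> sqrt (met c p v v) \<and> sqrt (met c p v v) \<le> (1 + e) * sqrt (met c p0 v v))"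
proof -
  have ev: "\<forall>\<^sub>F p in nhds p0. p \<in> coords c" using chart(2)[OF c] p0 by (rule eventually_nhds_in_open)
  moreover have "\<forall>\<^sub>F p in nhds p0. \<forall>v. (1 - e) * sqrt (met c p0 v v) \<le> sqrt (met c p v v) \<and> sqrt (met c p v v) \<le> (1 + e) * sqrt (met c p0 v v)"
  proof (rule forms_converge_uniformly[where H="metric_in_chart A g c", OF met_inner_form[OF c p0] _ _ e])
    show "\<forall>\<^sub>F p in nhds p0. bilinear (met c p)"
      using ev by eventually_elim (rule inner_form_bilinear[OF met_inner_form[OF c]])
    show "((\<lambda>p. met c p v w) \<longlongrightarrow> met c p0 v w) (nhds p0)" for v w
      by (rule isCont_tendsto_nhds[OF met_isCont[OF c p0]])
  qed
  ultimately show ?thesis by eventually_elim auto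
qed

end

section \<open>Distance and coordinates\<close>

context riemannian_manifold
begin

text \<open>
  The speed of a curve can be computed in any fixed chart, although it is defined with the chart selected
  at each point of the curve.
\<close>

lemma speed_in_chart:
  assumes c: "c \<in> A" and cont: "isCont \<gamma> t" and t: "\<gamma> t \<in> fst c"
    and v: "(snd c \<circ> \<gamma> has_vector_derivative v) (at t)"
  shows "tangent_norm g (\<gamma> t) (velocity A \<gamma> t) = sqrt (met c (snd c (\<gamma> t)) v v)"
proof -
  define e where "e = chart_at A (\<gamma> t)"
  have e: "e \<in> A" "\<gamma> t \<in> fst e" unfolding e_def by (rule chart_at)+
  define T where "T = trans c e (snd c (\<gamma> t))"
  have "((snd e \<circ> chart_inv c) \<circ> (snd c \<circ> \<gamma>) has_derivative T \<circ> (\<lambda>h. h *\<^sub>R v)) (at t)"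
    unfolding T_def using trans_has_derivative[OF c e(1) t e(2)] v
    by (intro diff_chain_at) (simp_all add: has_vector_derivative_def)
  moreover have "T \<circ> (\<lambda>h. h *\<^sub>R v) = (\<lambda>h. h *\<^sub>R T v)"
    using trans_linear[OF c e(1) t e(2)] by (simp add: fun_eq_iff T_def linear_cmul)
  ultimately have 1: "((snd e \<circ> chart_inv c) \<circ> (snd c \<circ> \<gamma>) has_vector_derivative T v) (at t)"
    by (simp add: has_vector_derivative_def)
  have "\<forall>\<^sub>F s in nhds t. \<gamma> s \<in> fst c"
    using isCont_tendsto_nhds[OF cont] chart(1)[OF c] t by (rule topological_tendstoD)
  then obtain N where N: "open N" "t \<in> N" "\<And>s. s \<in> N \<Longrightarrow> \<gamma> s \<in> fst c"
    unfolding eventually_nhds by blast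
  have "(snd e \<circ> \<gamma> has_vector_derivative T v) (at t)"
    by (rule has_vector_derivative_transform_within_open[OF 1 N(1,2)]) (simp add: chart(5)[OF c] N(3))
  then have "velocity A \<gamma> t = T v"
    unfolding velocity_def e_def[symmetric] by (rule vector_derivative_at)
  then show ?thesis
    using met_chart[OF c t] by (simp add: tangent_norm_def T_def e_def)
qed

text \<open>
  The increment \<open>w\<close> of the coordinates is measured by the linear functional \<open>\<lambda>v. G v w\<close>, whose rate of change
  along the curve is at most the speed, by the Cauchy-Schwarz inequality. The derivative of a piecewise
  C1 curve may be unbounded near the exceptional points; if the length is finite, it is nevertheless
  integrable, and the fundamental theorem of calculus applies.
\<close>

lemma curve_length_lower:
  assumes c: "c \<in> A" and G: "inner_form G" and \<eta>: "0 < \<eta>"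
    and \<gamma>: "piecewise_C1_curve A \<gamma>" and s: "0 < s" "s \<le> 1" and dom: "\<gamma> ` {0..s} \<subseteq> fst c"
    and below: "\<And>t v. 0 < t \<Longrightarrow> t < s \<Longrightarrow> \<eta> * sqrt (G v v) \<le> sqrt (met c (snd c (\<gamma> t)) v v)"
    and w: "w = snd c (\<gamma> s) - snd c (\<gamma> 0)"
  shows "ennreal (\<eta> * sqrt (G w w)) \<le> curve_length A g \<gamma>"
proof (cases "w = 0 \<or> curve_length A g \<gamma> = \<infinity>")
  case True
  then show ?thesis by (auto simp: inner_form_simps[OF G])
next
  case False
  then have Gw: "0 < G w w" and fin: "curve_length A g \<gamma> < \<infinity>"
    using G by (auto simp: inner_form_def less_top)
  have sc: "(snd c \<circ> \<gamma>) piecewise_C1_differentiable_on {0..s}"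
    using \<gamma> c dom s unfolding piecewise_C1_curve_def by auto
  then obtain P where P: "continuous_on {0..s} (snd c \<circ> \<gamma>)" "finite P" "(snd c \<circ> \<gamma>) C1_differentiable_on ({0..s} - P)"
    unfolding piecewise_C1_differentiable_on_def by blast
  then obtain D where D: "\<And>t. t \<in> {0..s} - P \<Longrightarrow> (snd c \<circ> \<gamma> has_vector_derivative D t) (at t)"
      "continuous_on ({0..s} - P) D"
    unfolding C1_differentiable_on_def by blast
  define T where "T = {0..s} - (P \<union> {0, s})"
  have "closed (P \<union> {0, s})" by (rule finite_imp_closed) (use P(2) in simp)
  then have Tb: "T \<in> sets borel" unfolding T_def by (intro sets.Diff borel_closed) auto
  \<comment> \<open>the normalization for which the total increment of \<open>\<lambda>v. k * G v w\<close> is \<open>\<eta> * sqrt (G w w)\<close>\<close>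
  define k where "k = \<eta> / sqrt (G w w)"
  have k: "0 < k" using \<eta> Gw by (simp add: k_def)
  have kG: "k * (sqrt (G v v) * sqrt (G w w)) = \<eta> * sqrt (G v v)" for v using Gw by (simp add: k_def)
  have lin: "bounded_linear (\<lambda>v. k * G v w)"
    by (rule linear_conv_bounded_linear[THEN iffD1]) (auto simp: linear_iff inner_form_simps[OF G] algebra_simps)
  define h where "h t = indicator T t *\<^sub>R (k * G (D t) w)" for t
  have hm: "h \<in> borel_measurable borel"
    unfolding h_def
  proof (rule borel_measurable_continuous_on_indicator[OF Tb])
    show "continuous_on T (\<lambda>t. k * G (D t) w)"
      by (rule bounded_linear.continuous_on[OF lin]) (rule continuous_on_subset[OF D(2)], auto simp: T_def)
  qed
  have hb: "\<bar>h t\<bar> \<le> tangent_norm g (\<gamma> t) (velocity A \<gamma> t) * indicator {0..1} t" for t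
  proof (cases "t \<in> T")
    case True
    then have t: "0 < t" "t < s" "t \<in> {0..s} - P" by (auto simp: T_def)
    have "continuous_on {0<..<1} \<gamma>"
      using \<gamma> unfolding piecewise_C1_curve_def by (auto intro: continuous_on_subset)
    then have "isCont \<gamma> t" using t s by (simp add: continuous_on_eq_continuous_at)
    then have sp: "tangent_norm g (\<gamma> t) (velocity A \<gamma> t) = sqrt (met c (snd c (\<gamma> t)) (D t) (D t))"
      using dom t by (intro speed_in_chart[OF c _ _ D(1)]) auto
    have "\<bar>G (D t) w\<bar> \<le> sqrt (G (D t) (D t)) * sqrt (G w w)"
      using inner_form_cauchy_schwarz[OF G, of "D t" w] inner_form_cauchy_schwarz[OF G, of "- D t" w]
        inner_form_simps(3)[OF G, of "-1" "D t"] inner_form_simps(4)[OF G, of _ "-1" "D t"] by simp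
    then have "k * \<bar>G (D t) w\<bar> \<le> k * (sqrt (G (D t) (D t)) * sqrt (G w w))"
      using k by (intro mult_left_mono) auto
    also have "\<dots> \<le> sqrt (met c (snd c (\<gamma> t)) (D t) (D t))" unfolding kG using below[OF t(1,2)] .
    finally show ?thesis using True t s k by (simp add: h_def sp abs_mult)
  next
    case False
    have "0 \<le> tangent_norm g (\<gamma> t) (velocity A \<gamma> t)"
      unfolding tangent_norm_def by (intro real_sqrt_ge_zero inner_form_nonneg g_inner_form)
    then show ?thesis using False by (simp add: h_def)
  qed
  have hL: "(\<integral>\<^sup>+t. ennreal \<bar>h t\<bar> \<partial>lborel) \<le> curve_length A g \<gamma>"
    unfolding curve_length_def
  proof (rule nn_integral_mono)
    fix t
    show "ennreal \<bar>h t\<bar> \<le> ennreal (tangent_norm g (\<gamma> t) (velocity A \<gamma> t)) * indicator {0..1} t"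
      using ennreal_leI[OF hb[of t]] by (cases "t \<in> {0..1}") auto
  qed
  have hi: "integrable lborel h"
    by (rule integrableI_bounded) (use hm hL fin in \<open>auto intro: le_less_trans\<close>)
  have "(h has_integral (k * G (snd c (\<gamma> s)) w - k * G (snd c (\<gamma> 0)) w)) {0..s}"
  proof (rule fundamental_theorem_of_calculus_interior_strong[OF P(2), of 0 s "\<lambda>t. k * G (snd c (\<gamma> t)) w"])
    fix t assume t: "t \<in> {0<..<s} - P"
    then have "((\<lambda>t. k * G ((snd c \<circ> \<gamma>) t) w) has_vector_derivative k * G (D t) w) (at t)"
      by (intro bounded_linear.has_vector_derivative[OF lin] D(1)) auto
    moreover have "h t = k * G (D t) w" using t by (simp add: h_def T_def)
    ultimately show "((\<lambda>t. k * G (snd c (\<gamma> t)) w) has_vector_derivative h t) (at t)" by simp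
  next
    show "continuous_on {0..s} (\<lambda>t. k * G (snd c (\<gamma> t)) w)"
      using bounded_linear.continuous_on[OF lin P(1)] by simp
  qed (use s in simp)
  then have "(h has_integral (k * G (snd c (\<gamma> s)) w - k * G (snd c (\<gamma> 0)) w)) UNIV"
    by (rule has_integral_on_superset) (auto simp: h_def T_def)
  then have "integral\<^sup>L lborel h = k * G (snd c (\<gamma> s)) w - k * G (snd c (\<gamma> 0)) w"
    using has_integral_integral_lborel[OF hi] has_integral_unique by blast
  also have "\<dots> = k * G w w" unfolding w by (simp add: inner_form_simps[OF G] algebra_simps)
  also have "\<dots> = \<eta> * sqrt (G w w)" using kG[of w] Gw by simp
  finally have "ennreal (\<eta> * sqrt (G w w)) \<le> ennreal (norm (integral\<^sup>L lborel h))"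
    by (intro ennreal_leI) simp
  also have "\<dots> \<le> (\<integral>\<^sup>+t. ennreal \<bar>h t\<bar> \<partial>lborel)"
    using integral_norm_bound_ennreal[OF hi] by simp
  also note hL
  finally show ?thesis .
qed

lemma chart_segment:
  assumes c: "c \<in> A" and pq: "closed_segment p q \<subseteq> coords c"
    and above: "\<And>t. 0 \<le> t \<Longrightarrow> t \<le> 1 \<Longrightarrow> sqrt (met c (p + t *\<^sub>R (q - p)) (q - p) (q - p)) \<le> b"
  defines "\<gamma> \<equiv> \<lambda>t. chart_inv c (p + t *\<^sub>R (q - p))"
  shows "piecewise_C1_curve A \<gamma>" "curve_length A g \<gamma> \<le> ennreal b"
proof -
  define l where "l t = p + t *\<^sub>R (q - p)" for t
  have \<gamma>l: "\<gamma> = chart_inv c \<circ> l" by (auto simp: \<gamma>_def l_def)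
  have l: "l t \<in> coords c" if "0 \<le> t" "t \<le> 1" for t
  proof -
    have "l t \<in> closed_segment p q"
      unfolding in_segment by (rule exI[of _ t]) (use that in \<open>simp add: l_def algebra_simps\<close>)
    then show ?thesis using pq by blast
  qed
  have lcont: "isCont l t" for t unfolding l_def by (intro continuous_intros)
  have ld: "(l has_derivative (\<lambda>h. h *\<^sub>R (q - p))) (at t)" for t
    unfolding l_def by (auto intro!: derivative_eq_intros)
  have \<gamma>cont: "isCont \<gamma> t" if "0 \<le> t" "t \<le> 1" for t
    unfolding \<gamma>l by (rule continuous_at_compose[OF lcont chart_isCont(2)[OF c l[OF that]]])
  have \<gamma>c: "\<gamma> t \<in> fst c" "snd c (\<gamma> t) = l t" if "0 \<le> t" "t \<le> 1" for t
    using chart(6,7)[OF c l[OF that]] by (auto simp: \<gamma>l)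
  have deriv: "(snd d \<circ> \<gamma> has_vector_derivative trans c d (l t) (q - p)) (at t)"
    if t: "0 \<le> t" "t \<le> 1" and d: "d \<in> A" "\<gamma> t \<in> fst d" for t d
  proof -
    have "((snd d \<circ> chart_inv c) \<circ> l has_derivative trans c d (l t) \<circ> (\<lambda>h. h *\<^sub>R (q - p))) (at t)"
      using trans_has_derivative[OF c d(1) \<gamma>c(1)[OF t] d(2)] ld \<gamma>c(2)[OF t] by (intro diff_chain_at) simp_all
    moreover have "trans c d (l t) \<circ> (\<lambda>h. h *\<^sub>R (q - p)) = (\<lambda>h. h *\<^sub>R trans c d (l t) (q - p))"
      using trans_linear[OF c d(1) \<gamma>c(1)[OF t] d(2)] \<gamma>c(2)[OF t] by (simp add: fun_eq_iff linear_cmul)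
    ultimately show ?thesis by (simp add: has_vector_derivative_def \<gamma>l comp_assoc)
  qed
  show "piecewise_C1_curve A \<gamma>"
    unfolding piecewise_C1_curve_def
  proof (intro conjI ballI allI impI)
    show "continuous_on {0..1} \<gamma>" by (rule continuous_at_imp_continuous_on) (use \<gamma>cont in auto)
    fix d a b' assume d: "d \<in> A" and ab: "0 \<le> a \<and> a \<le> b' \<and> b' \<le> 1 \<and> \<gamma> ` {a..b'} \<subseteq> fst d"
    show "(snd d \<circ> \<gamma>) piecewise_C1_differentiable_on {a..b'}"
    proof (rule C1_differentiable_imp_piecewise, unfold C1_differentiable_on_def, intro exI conjI ballI)
      show "(snd d \<circ> \<gamma> has_vector_derivative trans c d (l t) (q - p)) (at t)" if "t \<in> {a..b'}" for t
        using that ab by (intro deriv d) auto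
      show "continuous_on {a..b'} (\<lambda>t. trans c d (l t) (q - p))"
      proof (rule continuous_on_compose2[OF trans_continuous[OF c d]])
        show "continuous_on {a..b'} l" by (rule continuous_at_imp_continuous_on) (use lcont in auto)
        show "l ` {a..b'} \<subseteq> snd c ` (fst c \<inter> fst d)"
        proof
          fix y assume "y \<in> l ` {a..b'}"
          then obtain t where t: "t \<in> {a..b'}" "y = l t" by blast
          then have t01: "0 \<le> t" "t \<le> 1" using ab by auto
          have "\<gamma> t \<in> fst c \<inter> fst d" using \<gamma>c(1)[OF t01] ab t by auto
          then show "y \<in> snd c ` (fst c \<inter> fst d)" using \<gamma>c(2)[OF t01] t by force
        qed
      qed
    qed
  qed
  have "curve_length A g \<gamma> \<le> (\<integral>\<^sup>+t. ennreal b * indicator {0..1::real} t \<partial>lborel)"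
    unfolding curve_length_def
  proof (rule nn_integral_mono)
    fix t :: real
    show "ennreal (tangent_norm g (\<gamma> t) (velocity A \<gamma> t)) * indicator {0..1} t \<le> ennreal b * indicator {0..1} t"
    proof (cases "t \<in> {0..1}")
      case True
      then have t: "0 \<le> t" "t \<le> 1" by auto
      have "tangent_norm g (\<gamma> t) (velocity A \<gamma> t) = sqrt (met c (l t) (trans c c (l t) (q - p)) (trans c c (l t) (q - p)))"
        using speed_in_chart[OF c \<gamma>cont[OF t] \<gamma>c(1)[OF t] deriv[OF t c \<gamma>c(1)[OF t]]] \<gamma>c(2)[OF t] by simp
      also have "trans c c (l t) (q - p) = q - p"
        using trans_id[OF c \<gamma>c(1)[OF t]] \<gamma>c(2)[OF t] by simp
      finally show ?thesis using above[OF t] True by (simp add: l_def ennreal_leI)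
    qed simp
  qed
  also have "\<dots> = ennreal b" by (simp add: nn_integral_cmult)
  finally show "curve_length A g \<gamma> \<le> ennreal b" .
qed

end

locale riemannian_distance = riemannian_manifold A g
  for A :: "('m::metric_space, 'n::finite) chart set" and g +
  assumes induced: "induced_distance A g"
begin

text \<open>
  Near \<open>p0\<close> the metric is almost constant. The upper bound is the length of the straight segment. For
  the lower bound consider a curve joining the two points. If it stays in a larger ball of radius \<open>R\<close>,
  its length is at least almost the norm of the difference of its end points; if it leaves that ball, the
  part before the exit is already longer than that.
\<close>

theorem dist_in_chart:
  assumes c: "c \<in> A" and p0: "p0 \<in> coords c" and e: "0 < e" "e < 1"
  shows "\<exists>r>0. ball p0 r \<subseteq> coords c \<and> (\<forall>p\<in>ball p0 r. \<forall>q\<in>ball p0 r.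
     (1 - e) * sqrt (met c p0 (q - p) (q - p)) \<le> dist (chart_inv c p) (chart_inv c q) \<and>
     dist (chart_inv c p) (chart_inv c q) \<le> (1 + e) * sqrt (met c p0 (q - p) (q - p)))"
proof -
  define G where "G = met c p0"
  have G: "inner_form G" unfolding G_def by (rule met_inner_form[OF c p0])
  obtain N where N: "open N" "p0 \<in> N" "\<And>p. p \<in> N \<Longrightarrow> p \<in> coords c"
     "\<And>p v. p \<in> N \<Longrightarrow> (1 - e) * sqrt (G v v) \<le> sqrt (met c p v v)"
     "\<And>p v. p \<in> N \<Longrightarrow> sqrt (met c p v v) \<le> (1 + e) * sqrt (G v v)"
    using met_near[OF c p0 e(1)] unfolding eventually_nhds G_def by blast
  then obtain R where R: "0 < R" "cball p0 R \<subseteq> N" by (meson open_contains_cball)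
  obtain a b where ab: "0 < a" "0 < b" "\<And>v. a * norm v \<le> sqrt (G v v)" "\<And>v. sqrt (G v v) \<le> b * norm v"
    using inner_form_norm_bounds[OF G] by metis
  \<comment> \<open>chosen such that leaving the ball of radius \<open>R\<close> costs at least the diameter of the small ball\<close>
  define r where "r = a * R / (a + 2 * b)"
  have r: "0 < r" using ab R by (simp add: r_def)
  have rR: "b * (2 * r) = a * (R - r)" using ab by (simp add: r_def field_simps)
  have rR': "r < R" using rR ab r by (metis diff_gt_0_iff_gt mult_pos_pos zero_less_mult_pos zero_less_numeral)
  have sub: "cball p0 R \<subseteq> coords c" using R(2) N(3) by blast
  have bsub: "ball p0 r \<subseteq> cball p0 R" using rR' by auto
  have Gnn: "0 \<le> sqrt (G v v)" for v using inner_form_nonneg[OF G] by simp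
  have main: "(1 - e) * sqrt (G (q - p) (q - p)) \<le> dist (chart_inv c p) (chart_inv c q)"
     "dist (chart_inv c p) (chart_inv c q) \<le> (1 + e) * sqrt (G (q - p) (q - p))"
    if p: "p \<in> ball p0 r" and q: "q \<in> ball p0 r" for p q
  proof -
    let ?x = "chart_inv c p" and ?y = "chart_inv c q"
    have pc: "p \<in> coords c" "q \<in> coords c" using p q bsub sub by auto
    have seg: "closed_segment p q \<subseteq> ball p0 r" using p q by (intro closed_segment_subset) auto
    have "connected_component UNIV ?x ?y"
    proof (rule connected_componentI)
      have "continuous_on (ball p0 r) (chart_inv c)"
        using chart(4)[OF c] bsub sub by (meson continuous_on_subset order_trans)
      then show "connected (chart_inv c ` ball p0 r)" by (rule connected_continuous_image) simp
    qed (use p q in auto)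
    then have d: "ennreal (dist ?x ?y) =
          (INF \<gamma>\<in>{\<gamma>. piecewise_C1_curve A \<gamma> \<and> \<gamma> 0 = ?x \<and> \<gamma> 1 = ?y}. curve_length A g \<gamma>)"
      using induced unfolding induced_distance_def by blast
    let ?\<gamma> = "\<lambda>t. chart_inv c (p + t *\<^sub>R (q - p))"
    have "sqrt (met c (p + t *\<^sub>R (q - p)) (q - p) (q - p)) \<le> (1 + e) * sqrt (G (q - p) (q - p))"
      if "0 \<le> t" "t \<le> 1" for t
    proof (rule N(5))
      have "p + t *\<^sub>R (q - p) \<in> closed_segment p q"
        unfolding in_segment by (rule exI[of _ t]) (use that in \<open>simp add: algebra_simps\<close>)
      then show "p + t *\<^sub>R (q - p) \<in> N" using seg bsub R(2) by blast
    qed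
    then have "piecewise_C1_curve A ?\<gamma>" "curve_length A g ?\<gamma> \<le> ennreal ((1 + e) * sqrt (G (q - p) (q - p)))"
      using seg bsub sub by (intro chart_segment[OF c]; blast)+
    then have "ennreal (dist ?x ?y) \<le> ennreal ((1 + e) * sqrt (G (q - p) (q - p)))"
      unfolding d by (intro INF_lower2[of ?\<gamma>]) auto
    then show "dist ?x ?y \<le> (1 + e) * sqrt (G (q - p) (q - p))"
      using e Gnn by (subst (asm) ennreal_le_iff) auto
    have "ennreal ((1 - e) * sqrt (G (q - p) (q - p))) \<le> ennreal (dist ?x ?y)"
      unfolding d
    proof (rule INF_greatest)
      fix \<gamma> assume "\<gamma> \<in> {\<gamma>. piecewise_C1_curve A \<gamma> \<and> \<gamma> 0 = ?x \<and> \<gamma> 1 = ?y}"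
      then have \<gamma>: "piecewise_C1_curve A \<gamma>" "\<gamma> 0 = ?x" "\<gamma> 1 = ?y" by auto
      have \<gamma>c: "continuous_on {0..1} \<gamma>" using \<gamma>(1) by (simp add: piecewise_C1_curve_def)
      define W where "W = chart_inv c ` ball p0 R"
      have oW: "open W" unfolding W_def using sub by (intro chart_inv_image_open[OF c]) auto
      have inW: "\<gamma> t \<in> fst c \<and> snd c (\<gamma> t) \<in> ball p0 R" if "\<gamma> t \<in> W" for t
      proof -
        obtain u where "u \<in> ball p0 R" "\<gamma> t = chart_inv c u" using \<open>\<gamma> t \<in> W\<close> by (auto simp: W_def)
        moreover then have "u \<in> coords c" using sub by auto
        ultimately show ?thesis using chart(6,7)[OF c] by auto
      qed
      have low: "(1 - e) * sqrt (G v v) \<le> sqrt (met c (snd c (\<gamma> t)) v v)" if "\<gamma> t \<in> W" for t v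
        using inW[OF that] R(2) by (intro N(4)) auto
      have snd0: "snd c (\<gamma> 0) = p" "snd c (\<gamma> 1) = q" using \<gamma> chart(6)[OF c] pc by auto
      have xW: "\<gamma> 0 \<in> W" "\<gamma> 1 \<in> W" using \<gamma> p q rR' by (auto simp: W_def)
      define F where "F = {0..1} \<inter> \<gamma> -` (- W)"
      have Fc: "closed F"
        unfolding F_def by (rule continuous_closed_preimage[OF \<gamma>c]) (use oW in auto)
      show "ennreal ((1 - e) * sqrt (G (q - p) (q - p))) \<le> curve_length A g \<gamma>"
      proof (cases "F = {}")
        case True
        then have W: "\<gamma> t \<in> W" if "t \<in> {0..1}" for t using that by (auto simp: F_def)
        show ?thesis
        proof (rule curve_length_lower[OF c G _ \<gamma>(1), of _ 1])
          show "\<gamma> ` {0..1} \<subseteq> fst c" using W inW by blast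
          show "q - p = snd c (\<gamma> 1) - snd c (\<gamma> 0)" by (simp add: snd0)
        qed (use e low W in auto)
      next
        case False
        have bb: "bdd_below F" by (rule bdd_belowI[of _ 0]) (auto simp: F_def)
        define s where "s = Inf F"
        have sF: "s \<in> F" unfolding s_def by (rule closed_contains_Inf[OF False bb Fc])
        then have s: "0 < s" "s \<le> 1" "\<gamma> s \<notin> W"
          using xW(1) by (auto simp: F_def less_eq_real_def)
        have before: "\<gamma> t \<in> W" if "0 \<le> t" "t < s" for t
        proof (rule ccontr)
          assume "\<gamma> t \<notin> W"
          then have "t \<in> F" using that s by (auto simp: F_def)
          then have "s \<le> t" unfolding s_def by (rule cInf_lower[OF _ bb])
          then show False using that by simp
        qed
        have "\<gamma> s \<in> chart_inv c ` cball p0 R"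
        proof (rule Lim_in_closed_set)
          have "continuous_on (cball p0 R) (chart_inv c)" using chart(4)[OF c] sub by (rule continuous_on_subset)
          then show "closed (chart_inv c ` cball p0 R)"
            by (intro compact_imp_closed compact_continuous_image compact_cball)
          show "\<forall>\<^sub>F t in at_left s. \<gamma> t \<in> chart_inv c ` cball p0 R"
            unfolding eventually_at_left_field
          proof (intro exI[of _ 0] conjI allI impI s(1))
            fix t assume "0 < t" "t < s"
            then have "\<gamma> t \<in> W" by (intro before) auto
            then show "\<gamma> t \<in> chart_inv c ` cball p0 R" unfolding W_def by auto
          qed
          show "at_left s \<noteq> bot" by (rule trivial_limit_at_left_real)
          have "continuous_on {0..s} \<gamma>" by (rule continuous_on_subset[OF \<gamma>c]) (use s in auto)
          then have "(\<gamma> \<longlongrightarrow> \<gamma> s) (at s within {0..s})" using s unfolding continuous_on_def by auto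
          then show "(\<gamma> \<longlongrightarrow> \<gamma> s) (at_left s)" using s(1) by (simp add: at_within_Icc_at_left)
        qed
        then obtain p1 where p1: "p1 \<in> cball p0 R" "\<gamma> s = chart_inv c p1" by blast
        have "p1 \<notin> ball p0 R" using p1(2) s(3) by (auto simp: W_def)
        then have far: "R \<le> dist p0 p1" by simp
        have p1c: "p1 \<in> coords c" using p1 sub by auto
        have sp1: "snd c (\<gamma> s) = p1" "\<gamma> s \<in> fst c" using p1(2) chart(6,7)[OF c p1c] by auto
        have "ennreal ((1 - e) * sqrt (G (p1 - p) (p1 - p))) \<le> curve_length A g \<gamma>"
        proof (rule curve_length_lower[OF c G _ \<gamma>(1) s(1,2)])
          show "\<gamma> ` {0..s} \<subseteq> fst c"
          proof
            fix y assume "y \<in> \<gamma> ` {0..s}"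
            then obtain t where t: "0 \<le> t" "t \<le> s" "y = \<gamma> t" by auto
            then show "y \<in> fst c" using before[of t] inW[of t] sp1 by (cases "t = s") auto
          qed
          show "p1 - p = snd c (\<gamma> s) - snd c (\<gamma> 0)" by (simp add: snd0 sp1)
          show "(1 - e) * sqrt (G v v) \<le> sqrt (met c (snd c (\<gamma> t)) v v)" if "0 < t" "t < s" for t v
            using that by (intro low before) auto
        qed (use e in simp)
        moreover have "sqrt (G (q - p) (q - p)) \<le> sqrt (G (p1 - p) (p1 - p))"
        proof -
          have "norm (q - p) \<le> 2 * r" using p q dist_triangle[of p q p0] by (simp add: dist_norm[symmetric] dist_commute)
          then have "sqrt (G (q - p) (q - p)) \<le> b * (2 * r)"
            using ab(4)[of "q - p"] ab(2) by (meson mult_left_mono less_imp_le order_trans)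
          also have "\<dots> = a * (R - r)" by (rule rR)
          also have "\<dots> \<le> a * norm (p1 - p)"
            using far p dist_triangle[of p0 p1 p] ab(1) by (intro mult_left_mono) (auto simp: dist_norm[symmetric] dist_commute)
          also have "\<dots> \<le> sqrt (G (p1 - p) (p1 - p))" by (rule ab(3))
          finally show ?thesis .
        qed
        ultimately show ?thesis
          using e by (meson ennreal_leI mult_left_mono diff_ge_0_iff_ge less_imp_le order_trans)
      qed
    qed
    then show "(1 - e) * sqrt (G (q - p) (q - p)) \<le> dist ?x ?y"
      by (subst (asm) ennreal_le_iff) auto
  qed
  show ?thesis
    by (rule exI[of _ r]) (use r main bsub sub in \<open>auto simp: G_def\<close>)
qed

end

section \<open>The map in charts\<close>

locale smooth_local_diffeo = riemannian_distance A g
  for A :: "('m::metric_space, 'n::finite) chart set" and g +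
  fixes f :: "'m \<Rightarrow> 'm" and S :: "'m set"
  assumes f_continuous: "continuous_on UNIV f"
    and local_diffeo: "Ck_local_diffeo_on A 2 f (- S)"
begin

abbreviation rep :: "('m, 'n) chart \<Rightarrow> ('m, 'n) chart \<Rightarrow> real ^ 'n \<Rightarrow> real ^ 'n" where
  "rep c d \<equiv> snd d \<circ> f \<circ> chart_inv c"

definition drep :: "('m, 'n) chart \<Rightarrow> ('m, 'n) chart \<Rightarrow> real ^ 'n \<Rightarrow> real ^ 'n \<Rightarrow> real ^ 'n" where
  "drep c d p = frechet_derivative (rep c d) (at p)"

definition diffeo_nbhd :: "'m set \<Rightarrow> bool" where
  "diffeo_nbhd V \<longleftrightarrow> open V \<and> V \<subseteq> - S \<and> open (f ` V) \<and> inj_on f V \<and>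
     Ck_map_on A 2 f V \<and> Ck_map_on A 2 (inv_into V f) (f ` V)"

lemma ex_diffeo_nbhd: "x \<notin> S \<Longrightarrow> \<exists>V. diffeo_nbhd V \<and> x \<in> V"
  using local_diffeo unfolding Ck_local_diffeo_on_def diffeo_nbhd_def by blast

lemma f_isCont: "isCont f x"
  using f_continuous by (simp add: continuous_on_eq_continuous_at)

lemma open_preimage: "open W \<Longrightarrow> open (f -` W)"
  using open_vimage f_continuous by blast

lemma rep_domain_open:
  assumes "open V" "c \<in> A" "d \<in> A"
  shows "open (snd c ` (fst c \<inter> V \<inter> f -` fst d))"
  by (rule chart_image_open[OF assms(2)])
     (use assms chart(1)[OF assms(2)] open_preimage[OF chart(1)[OF assms(3)]] in auto)

lemma rep_Ck:
  assumes "diffeo_nbhd V" "c \<in> A" "d \<in> A"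
  shows "Ck_on 2 (rep c d) (snd c ` (fst c \<inter> V \<inter> f -` fst d))"
  using assms unfolding diffeo_nbhd_def Ck_map_on_def by blast

lemma rep_has_derivative:
  assumes x: "x \<notin> S" and c: "c \<in> A" "x \<in> fst c" and d: "d \<in> A" "f x \<in> fst d"
  shows "(rep c d has_derivative drep c d (snd c x)) (at (snd c x))"
proof -
  obtain V where V: "diffeo_nbhd V" "x \<in> V" using ex_diffeo_nbhd[OF x] by blast
  then have "open V" by (simp add: diffeo_nbhd_def)
  show ?thesis
    unfolding drep_def
    by (rule Ck_on_Suc_has_derivative[of 1, OF rep_Ck[OF V(1) c(1) d(1), unfolded numeral_2_eq_2 One_nat_def[symmetric]]
          rep_domain_open[OF \<open>open V\<close> c(1) d(1)]])
       (use V c d in auto)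
qed

lemma drep_linear:
  assumes "x \<notin> S" "c \<in> A" "x \<in> fst c" "d \<in> A" "f x \<in> fst d"
  shows "linear (drep c d (snd c x))"
  using rep_has_derivative[OF assms] has_derivative_linear by blast

text \<open>
  The local inverse of \<open>f\<close> is differentiable, so the derivative has a left inverse.
\<close>

lemma drep_eq_0:
  assumes x: "x \<notin> S" and c: "c \<in> A" "x \<in> fst c" and d: "d \<in> A" "f x \<in> fst d"
    and v: "drep c d (snd c x) v = 0"
  shows "v = 0"
proof -
  obtain V where V: "diffeo_nbhd V" "x \<in> V" using ex_diffeo_nbhd[OF x] by blast
  define k where "k = inv_into V f"
  have kV: "k (f y) = y" if "y \<in> V" for y using V that by (simp add: k_def diffeo_nbhd_def)
  have oV: "open V" "open (f ` V)" using V by (auto simp: diffeo_nbhd_def)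
  let ?G = "snd c \<circ> k \<circ> chart_inv d" and ?Q = "snd d ` (fst d \<inter> f ` V \<inter> k -` fst c)"
  have Gk: "Ck_on (Suc 1) ?G ?Q"
    using V c d unfolding diffeo_nbhd_def Ck_map_on_def k_def[symmetric] by (simp add: numeral_2_eq_2)
  have kc: "continuous_on (f ` V) k"
    using V unfolding diffeo_nbhd_def Ck_map_on_def k_def[symmetric] by blast
  have "open (f ` V \<inter> k -` fst c)"
    by (rule continuous_open_preimage[OF kc oV(2) chart(1)[OF c(1)]])
  then have oQ: "open ?Q"
    using chart(1)[OF d(1)] by (intro chart_image_open[OF d(1)]) (auto simp: Int_assoc)
  have pQ: "rep c d (snd c x) \<in> ?Q"
    using V(2) c d kV[OF V(2)] chart(5)[OF c] by auto
  have G': "(?G has_derivative frechet_derivative ?G (at (rep c d (snd c x)))) (at (rep c d (snd c x)))"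
    by (rule Ck_on_Suc_has_derivative[OF Gk oQ pQ])
  have "(?G \<circ> rep c d has_derivative frechet_derivative ?G (at (rep c d (snd c x))) \<circ> drep c d (snd c x)) (at (snd c x))"
    by (rule diff_chain_at[OF rep_has_derivative[OF x c d] G'])
  then have "((\<lambda>p. p) has_derivative frechet_derivative ?G (at (rep c d (snd c x))) \<circ> drep c d (snd c x)) (at (snd c x))"
  proof (rule has_derivative_transform_within_open[OF _ rep_domain_open[OF oV(1) c(1) d(1)]])
    show "snd c x \<in> snd c ` (fst c \<inter> V \<inter> f -` fst d)" using V c d by auto
    fix p assume "p \<in> snd c ` (fst c \<inter> V \<inter> f -` fst d)"
    then obtain y where y: "y \<in> fst c" "y \<in> V" "f y \<in> fst d" "p = snd c y" by auto
    show "(?G \<circ> rep c d) p = p"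
      using y kV chart(5)[OF c(1) y(1)] chart(5)[OF d(1) y(3)] by simp
  qed
  then have "frechet_derivative ?G (at (rep c d (snd c x))) \<circ> drep c d (snd c x) = (\<lambda>v. v)"
    using has_derivative_unique[OF _ has_derivative_ident] by blast
  then have "v = frechet_derivative ?G (at (rep c d (snd c x))) (drep c d (snd c x) v)"
    by (metis comp_apply)
  also have "\<dots> = 0" unfolding v using linear_0[OF has_derivative_linear[OF G']] .
  finally show ?thesis .
qed

text \<open>
  Chain rule. It allows the derivative of \<open>f\<close>, which is defined with the charts selected at \<open>x\<close> and
  \<open>f x\<close>, to be studied in any charts.
\<close>

lemma drep_change:
  assumes x: "x \<notin> S" and c: "c \<in> A" "x \<in> fst c" and d: "d \<in> A" "f x \<in> fst d"
    and c': "c' \<in> A" "x \<in> fst c'" and d': "d' \<in> A" "f x \<in> fst d'"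
  shows "drep c' d' (snd c' x) (trans c c' (snd c x) v) = trans d d' (snd d (f x)) (drep c d (snd c x) v)"
proof -
  have fx: "rep c d (snd c x) = snd d (f x)" and cx: "(snd c' \<circ> chart_inv c) (snd c x) = snd c' x"
    using chart(5)[OF c] by auto
  have 1: "(rep c' d' \<circ> (snd c' \<circ> chart_inv c) has_derivative drep c' d' (snd c' x) \<circ> trans c c' (snd c x)) (at (snd c x))"
    using trans_has_derivative[OF c(1) c'(1) c(2) c'(2)] rep_has_derivative[OF x c' d']
    by (intro diff_chain_at) (simp_all only: cx)
  have 2: "((snd d' \<circ> chart_inv d) \<circ> rep c d has_derivative trans d d' (snd d (f x)) \<circ> drep c d (snd c x)) (at (snd c x))"
    using trans_has_derivative[OF d(1) d'(1) d(2) d'(2)] rep_has_derivative[OF x c d]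
    by (intro diff_chain_at) (simp_all only: fx)
  have o: "open (snd c ` (fst c \<inter> (fst c' \<inter> f -` fst d') \<inter> f -` fst d))"
    by (intro rep_domain_open open_Int open_preimage chart c c' d d')
  have "(rep c d' has_derivative drep c' d' (snd c' x) \<circ> trans c c' (snd c x)) (at (snd c x))"
  proof (rule has_derivative_transform_within_open[OF 1 o])
    show "snd c x \<in> snd c ` (fst c \<inter> (fst c' \<inter> f -` fst d') \<inter> f -` fst d)" using c d c' d' by auto
    fix p assume "p \<in> snd c ` (fst c \<inter> (fst c' \<inter> f -` fst d') \<inter> f -` fst d)"
    then obtain y where y: "y \<in> fst c" "y \<in> fst c'" "p = snd c y" by auto
    show "(rep c' d' \<circ> (snd c' \<circ> chart_inv c)) p = rep c d' p"
      using y chart(5)[OF c(1) y(1)] chart(5)[OF c'(1) y(2)] by simp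
  qed
  moreover have "(rep c d' has_derivative trans d d' (snd d (f x)) \<circ> drep c d (snd c x)) (at (snd c x))"
  proof (rule has_derivative_transform_within_open[OF 2 o])
    show "snd c x \<in> snd c ` (fst c \<inter> (fst c' \<inter> f -` fst d') \<inter> f -` fst d)" using c d c' d' by auto
    fix p assume "p \<in> snd c ` (fst c \<inter> (fst c' \<inter> f -` fst d') \<inter> f -` fst d)"
    then obtain y where y: "y \<in> fst c" "f y \<in> fst d" "p = snd c y" by auto
    show "((snd d' \<circ> chart_inv d) \<circ> rep c d) p = rep c d' p"
      using y chart(5)[OF c(1) y(1)] chart(5)[OF d(1) y(2)] by simp
  qed
  ultimately show ?thesis using has_derivative_unique by (metis comp_apply)
qed

lemma differential_eq: "differential A f x = drep (chart_at A x) (chart_at A (f x)) (snd (chart_at A x) x)"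
  by (simp add: differential_def drep_def)

lemma differential_trans:
  assumes x: "x \<notin> S" and c: "c \<in> A" "x \<in> fst c" and d: "d \<in> A" "f x \<in> fst d"
  shows "differential A f x (trans c (chart_at A x) (snd c x) v)
     = trans d (chart_at A (f x)) (snd d (f x)) (drep c d (snd c x) v)"
  unfolding differential_eq by (rule drep_change[OF x c d chart_at chart_at])

lemma differential_inverse:
  assumes x: "x \<notin> S"
  shows "linear (differential A f x)" "linear (inv (differential A f x))"
    "inv (differential A f x) (differential A f x v) = v" "differential A f x (inv (differential A f x) v) = v"
    "differential A f x v = 0 \<Longrightarrow> v = 0"
proof -
  let ?D = "differential A f x"
  show lin: "linear ?D" unfolding differential_eq by (rule drep_linear[OF x chart_at chart_at])
  show z: "v = 0" if "?D v = 0" for v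
    using drep_eq_0[OF x chart_at chart_at, of v] that by (simp add: differential_eq)
  have "inj ?D" using z lin by (simp add: linear_injective_0)
  then obtain E where E: "linear E" "\<And>v. E (?D v) = v" "\<And>v. ?D (E v) = v"
    using linear_injective_isomorphism[OF lin] by auto
  have "inv ?D = E" by (rule inv_unique_comp) (auto simp: E)
  then show "linear (inv ?D)" "inv ?D (?D v) = v" "?D (inv ?D v) = v" using E by auto
qed

definition pullback :: "('m, 'n) chart \<Rightarrow> ('m, 'n) chart \<Rightarrow> 'm \<Rightarrow> real ^ 'n \<Rightarrow> real ^ 'n \<Rightarrow> real" where
  "pullback c d x v w = met d (snd d (f x)) (drep c d (snd c x) v) (drep c d (snd c x) w)"

lemma pullback_inner_form:
  assumes x: "x \<notin> S" and c: "c \<in> A" "x \<in> fst c" and d: "d \<in> A" "f x \<in> fst d"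
  shows "inner_form (pullback c d x)"
proof -
  have G: "inner_form (met d (snd d (f x)))" using d by (intro met_inner_form) auto
  have L: "linear (drep c d (snd c x))" by (rule drep_linear[OF x c d])
  have "bilinear (pullback c d x)"
    unfolding bilinear_def pullback_def
    by (auto simp: linear_iff inner_form_simps[OF G] linear_add[OF L] linear_cmul[OF L])
  moreover have "0 < pullback c d x v v" if "v \<noteq> 0" for v
    using drep_eq_0[OF x c d, of v] that G unfolding pullback_def inner_form_def by blast
  ultimately show ?thesis using G by (auto simp: inner_form_def pullback_def)
qed

text \<open>
  The operator norm of the inverse in arbitrary charts, written without the inverse and without the
  supremum. Both sides depend on the point through forms that vary continuously.
\<close>

lemma inv_deriv_norm_le_iff:
  assumes x: "x \<notin> S" and c: "c \<in> A" "x \<in> fst c" and d: "d \<in> A" "f x \<in> fst d"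
  shows "inv_deriv_norm A g f x \<le> l \<longleftrightarrow>
    (\<forall>v. sqrt (met c (snd c x) v v) \<le> l * sqrt (pullback c d x v v))"
proof -
  let ?D = "differential A f x" and ?T = "trans c (chart_at A x) (snd c x)" and ?N = "tangent_norm g"
  note D = differential_inverse[OF x]
  have G: "inner_form (g x)" "inner_form (g (f x))" by (rule g_inner_form)+
  have pos: "0 < ?N (f x) w" if "w \<noteq> 0" for w
    using that G(2) by (simp add: tangent_norm_def inner_form_def)
  have bdd: "bdd_above ((\<lambda>w. ?N x (inv ?D w) / ?N (f x) w) ` (- {0}))"
  proof -
    obtain b where b: "0 < b" "\<And>v. ?N x v \<le> b * norm v"
      using inner_form_norm_bounds[OF G(1)] unfolding tangent_norm_def by metis
    obtain a where a: "0 < a" "\<And>v. a * norm v \<le> ?N (f x) v"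
      using inner_form_norm_bounds[OF G(2)] unfolding tangent_norm_def by metis
    obtain B where B: "0 < B" "\<And>w. norm (inv ?D w) \<le> B * norm w"
      using linear_bounded_pos[OF D(2)] by blast
    show ?thesis
    proof (rule bdd_aboveI2)
      fix w :: "real ^ 'n" assume "w \<in> - {0}"
      then have w: "0 < ?N (f x) w" using pos by simp
      have "?N x (inv ?D w) \<le> b * (B * norm w)"
        using b(2)[of "inv ?D w"] B(2)[of w] b(1) by (meson mult_left_mono less_imp_le order_trans)
      also have "\<dots> = (b * B / a) * (a * norm w)" using a by simp
      also have "\<dots> \<le> (b * B / a) * ?N (f x) w" using a b B by (intro mult_left_mono) auto
      finally show "?N x (inv ?D w) / ?N (f x) w \<le> b * B / a" using w by (simp add: divide_le_eq)
    qed
  qed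
  have ne: "- {0 :: real ^ 'n} \<noteq> {}"
  proof -
    have "axis undefined 1 \<in> - {0 :: real ^ 'n}" by (simp add: axis_eq_0_iff)
    then show ?thesis by blast
  qed
  have conv: "?N x (?T v) = sqrt (met c (snd c x) v v)" "?N (f x) (?D (?T v)) = sqrt (pullback c d x v v)" for v
    unfolding tangent_norm_def differential_trans[OF x c d] pullback_def
    using met_chart[OF c] met_chart[OF d] by auto
  have "inv_deriv_norm A g f x \<le> l \<longleftrightarrow> (\<forall>w\<in>- {0}. ?N x (inv ?D w) / ?N (f x) w \<le> l)"
    unfolding inv_deriv_norm_def by (rule cSUP_le_iff[OF ne bdd])
  also have "\<dots> \<longleftrightarrow> (\<forall>v. sqrt (met c (snd c x) v v) \<le> l * sqrt (pullback c d x v v))"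
  proof (intro iffI allI ballI)
    fix v assume h: "\<forall>w\<in>- {0}. ?N x (inv ?D w) / ?N (f x) w \<le> l"
    show "sqrt (met c (snd c x) v v) \<le> l * sqrt (pullback c d x v v)"
    proof (cases "?D (?T v) = 0")
      case True
      then have "?T v = 0" by (rule D(5))
      then have "?N x (?T v) = 0" "?N (f x) (?D (?T v)) = 0"
        using True by (simp_all add: tangent_norm_def inner_form_simps[OF G(1)] inner_form_simps[OF G(2)])
      then show ?thesis unfolding conv by simp
    next
      case False
      then have "?N x (inv ?D (?D (?T v))) / ?N (f x) (?D (?T v)) \<le> l" using h by blast
      then show ?thesis using pos[OF False] unfolding D(3) conv by (simp add: divide_le_eq)
    qed
  next
    fix w :: "real ^ 'n" assume h: "\<forall>v. sqrt (met c (snd c x) v v) \<le> l * sqrt (pullback c d x v v)" and w: "w \<in> - {0}"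
    define v where "v = trans (chart_at A x) c (snd (chart_at A x) x) (inv ?D w)"
    have Tv: "?T v = inv ?D w" unfolding v_def by (rule trans_inverse[OF chart_at(1) c(1) chart_at(2) c(2)])
    then have "?D (?T v) = w" using D(4) by simp
    then show "?N x (inv ?D w) / ?N (f x) w \<le> l"
      using h[rule_format, of v] pos[of w] w unfolding conv[symmetric] Tv by (simp add: divide_le_eq D(4))
  qed
  finally show ?thesis .
qed

lemma inv_deriv_norm_pos:
  assumes x: "x \<notin> S"
  shows "0 < inv_deriv_norm A g f x"
proof -
  note c = chart_at[of x] and d = chart_at[of "f x"]
  define v :: "real ^ 'n" where "v = axis undefined 1"
  have v: "v \<noteq> 0" by (simp add: v_def axis_eq_0_iff)
  have "inner_form (met (chart_at A x) (snd (chart_at A x) x))" using c by (intro met_inner_form) auto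
  then have 1: "0 < sqrt (met (chart_at A x) (snd (chart_at A x) x) v v)" using v by (simp add: inner_form_def)
  have 2: "0 < sqrt (pullback (chart_at A x) (chart_at A (f x)) x v v)"
    using pullback_inner_form[OF x c d] v by (simp add: inner_form_def)
  have "sqrt (met (chart_at A x) (snd (chart_at A x) x) v v)
     \<le> inv_deriv_norm A g f x * sqrt (pullback (chart_at A x) (chart_at A (f x)) x v v)"
    using inv_deriv_norm_le_iff[OF x c d, of "inv_deriv_norm A g f x"] by blast
  then have "0 < inv_deriv_norm A g f x * sqrt (pullback (chart_at A x) (chart_at A (f x)) x v v)"
    using 1 by linarith
  then show ?thesis using 2 by (simp add: zero_less_mult_iff)
qed

text \<open>
  Under a change of coordinates the Gram determinant is multiplied by the square of the determinant of
  the coordinate change, so the coordinate changes cancel.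
\<close>

lemma inv_deriv_abs_det_in_charts:
  assumes x: "x \<notin> S" and c: "c \<in> A" "x \<in> fst c" and d: "d \<in> A" "f x \<in> fst d"
  shows "inv_deriv_abs_det A g f x * (\<bar>det (matrix (drep c d (snd c x)))\<bar> * sqrt (gram_det (met d (snd d (f x)))))
     = sqrt (gram_det (met c (snd c x)))"
proof -
  let ?D = "differential A f x" and ?T = "trans c (chart_at A x) (snd c x)"
    and ?T' = "trans d (chart_at A (f x)) (snd d (f x))" and ?F = "drep c d (snd c x)"
  note D = differential_inverse[OF x]
  have lin: "linear ?T" "linear ?T'" "linear ?F"
    using trans_linear[OF c(1) chart_at(1) c(2) chart_at(2)] trans_linear[OF d(1) chart_at(1) d(2) chart_at(2)]
      drep_linear[OF x c d] by auto
  have mc: "met c (snd c x) = (\<lambda>v w. g x (?T v) (?T w))" using met_chart[OF c] by (intro ext)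
  have md: "met d (snd d (f x)) = (\<lambda>v w. g (f x) (?T' v) (?T' w))" using met_chart[OF d] by (intro ext)
  have gc: "sqrt (gram_det (met c (snd c x))) = \<bar>det (matrix ?T)\<bar> * sqrt (gram_det (g x))"
    unfolding mc gram_det_pullback[OF inner_form_bilinear[OF g_inner_form] lin(1)] by (simp add: real_sqrt_mult)
  have gd: "sqrt (gram_det (met d (snd d (f x)))) = \<bar>det (matrix ?T')\<bar> * sqrt (gram_det (g (f x)))"
    unfolding md gram_det_pullback[OF inner_form_bilinear[OF g_inner_form] lin(2)] by (simp add: real_sqrt_mult)
  have "?D \<circ> ?T = ?T' \<circ> ?F" using differential_trans[OF x c d] by auto
  then have "matrix ?D ** matrix ?T = matrix ?T' ** matrix ?F"
    using matrix_compose[OF lin(1) D(1)] matrix_compose[OF lin(3) lin(2)] by metis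
  then have "det (matrix ?D) * det (matrix ?T) = det (matrix ?T') * det (matrix ?F)"
    by (metis det_mul)
  then have 1: "\<bar>det (matrix ?D)\<bar> * \<bar>det (matrix ?T)\<bar> = \<bar>det (matrix ?T')\<bar> * \<bar>det (matrix ?F)\<bar>"
    by (metis abs_mult)
  have "inv ?D \<circ> ?D = id" using D(3) by auto
  then have "det (matrix (inv ?D)) * det (matrix ?D) = 1"
    using matrix_compose[OF D(1,2)] by (simp only: det_mul[symmetric] matrix_id flip: matrix_compose[OF D(1,2)])
  then have 2: "\<bar>det (matrix (inv ?D))\<bar> * \<bar>det (matrix ?D)\<bar> = 1" by (metis abs_mult abs_one)
  have gp: "0 < sqrt (gram_det (g (f x)))" using gram_det_pos[OF g_inner_form] by simp
  have "inv_deriv_abs_det A g f x * (\<bar>det (matrix ?F)\<bar> * sqrt (gram_det (met d (snd d (f x)))))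
     = \<bar>det (matrix (inv ?D))\<bar> * (\<bar>det (matrix ?T')\<bar> * \<bar>det (matrix ?F)\<bar>) * sqrt (gram_det (g x))"
    unfolding inv_deriv_abs_det_def gd using gp by simp
  also have "\<dots> = (\<bar>det (matrix (inv ?D))\<bar> * \<bar>det (matrix ?D)\<bar>) * (\<bar>det (matrix ?T)\<bar> * sqrt (gram_det (g x)))"
    unfolding 1[symmetric] by simp
  also have "\<dots> = sqrt (gram_det (met c (snd c x)))" unfolding 2 gc by simp
  finally show ?thesis .
qed

lemma met_gram_pos: "c \<in> A \<Longrightarrow> p \<in> coords c \<Longrightarrow> 0 < gram_det (met c p)"
  by (intro gram_det_pos met_inner_form)

lemma inv_deriv_abs_det_pos:
  assumes x: "x \<notin> S"
  shows "0 < inv_deriv_abs_det A g f x" and "c \<in> A \<Longrightarrow> x \<in> fst c \<Longrightarrow> d \<in> A \<Longrightarrow> f x \<in> fst d \<Longrightarrow>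
    det (matrix (drep c d (snd c x))) \<noteq> 0"
proof -
  have key: "0 < inv_deriv_abs_det A g f x * (\<bar>det (matrix (drep c d (snd c x)))\<bar> * sqrt (gram_det (met d (snd d (f x)))))"
    if "c \<in> A" "x \<in> fst c" "d \<in> A" "f x \<in> fst d" for c d
    unfolding inv_deriv_abs_det_in_charts[OF x that] using that by (simp add: met_gram_pos)
  then show "det (matrix (drep c d (snd c x))) \<noteq> 0" if "c \<in> A" "x \<in> fst c" "d \<in> A" "f x \<in> fst d"
    using key[OF that] by auto
  have "0 \<le> inv_deriv_abs_det A g f x"
    unfolding inv_deriv_abs_det_def using gram_det_pos[OF g_inner_form] by (simp add: less_imp_le)
  then show "0 < inv_deriv_abs_det A g f x"
    using key[OF chart_at chart_at] by (auto simp: zero_less_mult_iff)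
qed

text \<open>
  To first order the distances of \<open>y\<close> to \<open>x\<close> and of \<open>f y\<close> to \<open>f x\<close> are the norms of the coordinate
  increments (\<open>dist_in_chart\<close>), and these are related by the derivative of \<open>f\<close> at \<open>x\<close>.
\<close>

theorem locally_expands:
  assumes x: "x \<notin> S" and l: "inv_deriv_norm A g f x < l"
  shows "\<forall>\<^sub>F y in nhds x. dist y x \<le> l * dist (f y) (f x)"
proof -
  define lam where "lam = inv_deriv_norm A g f x"
  have lam: "0 < lam" unfolding lam_def by (rule inv_deriv_norm_pos[OF x])
  define c where "c = chart_at A x"
  define d where "d = chart_at A (f x)"
  have c: "c \<in> A" "x \<in> fst c" and d: "d \<in> A" "f x \<in> fst d" unfolding c_def d_def by (rule chart_at)+
  define p0 where "p0 = snd c x"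
  define q0 where "q0 = snd d (f x)"
  have p0: "p0 \<in> coords c" and q0: "q0 \<in> coords d" using c d by (auto simp: p0_def q0_def)
  define N where "N v = sqrt (met c p0 v v)" for v
  define N' where "N' v = sqrt (met d q0 v v)" for v
  let ?F = "drep c d p0"
  have le: "N v \<le> lam * N' (?F v)" for v
    using inv_deriv_norm_le_iff[OF x c d, of lam] by (simp add: lam_def N_def N'_def p0_def q0_def pullback_def)
  obtain a where a: "0 < a" "\<And>v. a * norm v \<le> N v"
    using inner_form_norm_bounds[OF met_inner_form[OF c(1) p0]] unfolding N_def by metis
  obtain b where b: "0 < b" "\<And>v. N' v \<le> b * norm v"
    using inner_form_norm_bounds[OF met_inner_form[OF d(1) q0]] unfolding N'_def by metis
  \<comment> \<open>the errors of the three approximations are absorbed by the gap between the norm and \<open>l\<close>\<close>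
  have "((\<lambda>e. (1 + e) * lam / ((1 - e) * (1 - e))) \<longlongrightarrow> (1 + 0) * lam / ((1 - 0) * (1 - 0))) (at_right 0)"
    by (intro tendsto_intros) auto
  then have "\<forall>\<^sub>F e in at_right 0. (1 + e) * lam / ((1 - e) * (1 - e)) < l"
    using l by (intro order_tendstoD(2)) (auto simp: lam_def)
  moreover have "\<forall>\<^sub>F e in at_right (0::real). 0 < e \<and> e < 1"
    unfolding eventually_at_right_field by (rule exI[of _ 1]) auto
  ultimately have "\<forall>\<^sub>F e in at_right 0. (1 + e) * lam / ((1 - e) * (1 - e)) < l \<and> 0 < e \<and> e < (1::real)"
    by eventually_elim auto
  then obtain e where e: "(1 + e) * lam / ((1 - e) * (1 - e)) < l" "0 < e" "e < 1"
    using eventually_happens'[OF trivial_limit_at_right_real] by blast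
  obtain r where r: "0 < r" "ball p0 r \<subseteq> coords c" and
    rd: "\<And>p q. p \<in> ball p0 r \<Longrightarrow> q \<in> ball p0 r \<Longrightarrow> dist (chart_inv c p) (chart_inv c q) \<le> (1 + e) * N (q - p)"
    using dist_in_chart[OF c(1) p0 e(2,3)] unfolding N_def by metis
  obtain s where s: "0 < s" "ball q0 s \<subseteq> coords d" and
    sd: "\<And>p q. p \<in> ball q0 s \<Longrightarrow> q \<in> ball q0 s \<Longrightarrow> (1 - e) * N' (q - p) \<le> dist (chart_inv d p) (chart_inv d q)"
    using dist_in_chart[OF d(1) q0 e(2,3)] unfolding N'_def by metis
  define \<eta> where "\<eta> = e * a / (lam * b)"
  have \<eta>: "0 < \<eta>" using e a b lam by (simp add: \<eta>_def)
  have der: "(rep c d has_derivative ?F) (at p0)" unfolding p0_def by (rule rep_has_derivative[OF x c d])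
  obtain t where t: "0 < t" and tF: "\<And>p. norm (p - p0) < t \<Longrightarrow> norm (rep c d p - rep c d p0 - ?F (p - p0)) \<le> \<eta> * norm (p - p0)"
    using der \<eta> unfolding has_derivative_at_alt by blast
  have "\<forall>\<^sub>F y in nhds x. y \<in> fst c"
    using chart(1)[OF c(1)] c(2) by (rule eventually_nhds_in_open)
  moreover have "\<forall>\<^sub>F y in nhds x. f y \<in> fst d"
    using isCont_tendsto_nhds[OF f_isCont] chart(1)[OF d(1)] d(2) by (rule topological_tendstoD)
  moreover have "\<forall>\<^sub>F y in nhds x. snd c y \<in> ball p0 (min r t)"
    using isCont_tendsto_nhds[OF chart_isCont(1)[OF c]] r t
    by (intro topological_tendstoD[where l="snd c x"]) (auto simp: p0_def)
  moreover have "\<forall>\<^sub>F y in nhds x. snd d (f y) \<in> ball q0 s"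
  proof -
    have "isCont (\<lambda>y. snd d (f y)) x"
      using continuous_at_compose[OF f_isCont chart_isCont(1)[OF d]] by (simp add: o_def)
    from isCont_tendsto_nhds[OF this] show ?thesis using s
      by (intro topological_tendstoD[where l="snd d (f x)"]) (auto simp: q0_def)
  qed
  ultimately show ?thesis
  proof eventually_elim
    case (elim y)
    define p where "p = snd c y"
    define q where "q = snd d (f y)"
    have inv: "chart_inv c p = y" "chart_inv c p0 = x" "chart_inv d q = f y" "chart_inv d q0 = f x"
      using chart(5)[OF c(1)] chart(5)[OF d(1)] elim c d by (auto simp: p_def q_def p0_def q0_def)
    have rp: "rep c d p = q" "rep c d p0 = q0" using inv by (auto simp: q_def q0_def)
    have pb: "p \<in> ball p0 r" "norm (p - p0) < t" "q \<in> ball q0 s"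
      using elim by (auto simp: p_def q_def dist_norm norm_minus_commute)
    have 1: "dist y x \<le> (1 + e) * N (p - p0)"
      using rd[of p0 p] r(1) pb(1) by (simp add: inv dist_commute)
    have 2: "(1 - e) * N' (q - q0) \<le> dist (f y) (f x)"
      using sd[of q0 q] s(1) pb(3) by (simp add: inv dist_commute)
    have "N' (?F (p - p0)) \<le> N' (q - q0) + N' (?F (p - p0) - (q - q0))"
      using inner_form_triangle[OF met_inner_form[OF d(1) q0], of "q - q0" "?F (p - p0) - (q - q0)"]
      by (simp add: N'_def)
    also have "N' (?F (p - p0) - (q - q0)) \<le> b * (\<eta> * norm (p - p0))"
    proof -
      have "norm (?F (p - p0) - (q - q0)) \<le> \<eta> * norm (p - p0)"
        using tF[OF pb(2)] unfolding rp by (simp add: norm_minus_commute)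
      then show ?thesis using b by (meson mult_left_mono less_imp_le order_trans)
    qed
    finally have 3: "N' (?F (p - p0)) \<le> N' (q - q0) + b * (\<eta> * norm (p - p0))" by simp
    have "lam * (b * (\<eta> * norm (p - p0))) = e * (a * norm (p - p0))" using lam b by (simp add: \<eta>_def)
    also have "\<dots> \<le> e * N (p - p0)" using a e by (intro mult_left_mono) auto
    finally have "N (p - p0) \<le> lam * N' (q - q0) + e * N (p - p0)"
      using le[of "p - p0"] mult_left_mono[OF 3, of lam] lam by (simp add: algebra_simps)
    then have "(1 - e) * N (p - p0) \<le> lam * N' (q - q0)" by (simp add: algebra_simps)
    then have "(1 - e) * ((1 - e) * N (p - p0)) \<le> (1 - e) * (lam * N' (q - q0))"
      using e by (intro mult_left_mono) auto
    also have "\<dots> \<le> lam * dist (f y) (f x)"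
      using mult_left_mono[OF 2, of lam] lam by (simp add: mult.left_commute)
    finally have 4: "N (p - p0) \<le> lam * dist (f y) (f x) / ((1 - e) * (1 - e))"
      using e by (simp add: pos_le_divide_eq mult.commute mult.left_commute)
    have "dist y x \<le> (1 + e) * (lam * dist (f y) (f x) / ((1 - e) * (1 - e)))"
      using 1 4 e by (meson mult_left_mono add_nonneg_nonneg less_imp_le order_trans zero_le_one)
    also have "\<dots> = ((1 + e) * lam / ((1 - e) * (1 - e))) * dist (f y) (f x)" by simp
    also have "\<dots> \<le> l * dist (f y) (f x)" using e(1) by (intro mult_right_mono) auto
    finally show ?case .
  qed
qed

lemma f_local_homeo_at:
  assumes x: "x \<notin> S"
  shows "local_homeo_at f (- S) x"
proof -
  obtain V where V: "diffeo_nbhd V" "x \<in> V" using ex_diffeo_nbhd[OF x] by blast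
  define k where "k = inv_into V f"
  have oV: "open V" "V \<subseteq> - S" "inj_on f V" "open (f ` V)" using V by (auto simp: diffeo_nbhd_def)
  have kc: "continuous_on (f ` V) k"
    using V unfolding diffeo_nbhd_def Ck_map_on_def k_def[symmetric] by blast
  show ?thesis
    unfolding local_homeo_at_def
  proof (intro exI[of _ V] conjI allI impI oV V(2))
    show "continuous_on V f" using f_continuous continuous_on_subset by blast
    fix Z assume Z: "open Z" "Z \<subseteq> V"
    have "f ` Z = f ` V \<inter> k -` Z" using Z(2) oV(3) by (force simp: k_def)
    then show "open (f ` Z)" using continuous_open_preimage[OF kc oV(4) Z(1)] by simp
  qed
qed

end

section \<open>Riemannian volume\<close>

locale smooth_local_diffeo_volume = smooth_local_diffeo A g f S
  for A :: "('m::metric_space, 'n::finite) chart set" and g f S +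
  fixes m :: "'m measure"
  assumes volume: "normalized_riemannian_volume A g m"
begin

definition density_in :: "('m, 'n) chart \<Rightarrow> real ^ 'n \<Rightarrow> real" where
  "density_in c p = sqrt (gram_det (met c p))"

lemma density_in_pos: "c \<in> A \<Longrightarrow> p \<in> coords c \<Longrightarrow> 0 < density_in c p"
  by (simp add: density_in_def met_gram_pos)

lemma density_in_continuous: "c \<in> A \<Longrightarrow> continuous_on (coords c) (density_in c)"
  unfolding density_in_def gram_det_def det_def
  by (simp, intro continuous_intros Ck_on_continuous[OF met_Ck[of c 0]])

lemma sets_m: "sets m = sets borel" and m_UNIV: "emeasure m UNIV = 1"
  using volume by (auto simp: normalized_riemannian_volume_def)

lemma m_prob: "prob_space m"
  by (rule prob_spaceI) (use m_UNIV sets_eq_imp_space_eq[OF sets_m] in simp)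

lemma volume_in_chart:
  obtains K where "0 < K" "\<And>c X. c \<in> A \<Longrightarrow> X \<in> sets borel \<Longrightarrow> X \<subseteq> fst c \<Longrightarrow>
     emeasure m X = ennreal K * (\<integral>\<^sup>+p\<in>snd c ` X. ennreal (density_in c p) \<partial>lborel)"
  using volume unfolding normalized_riemannian_volume_def density_in_def by blast

lemma chart_image_borel:
  assumes c: "c \<in> A" and X: "X \<in> sets borel" "X \<subseteq> fst c"
  shows "snd c ` X \<in> sets borel"
proof -
  have "snd c ` X = coords c \<inter> chart_inv c -` X"
    using chart(5)[OF c] X(2) by force
  then show ?thesis using borel_preimage_of_continuous[OF chart(4,2)[OF c] X(1)] by simp
qed

lemma indicator_times_measurable:
  fixes h :: "real ^ 'n \<Rightarrow> real"
  assumes "continuous_on W h" "open W" "X \<in> sets borel" "X \<subseteq> W"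
  shows "(\<lambda>p. indicator X p * h p) \<in> borel_measurable borel"
proof -
  have "(\<lambda>p. indicator X p *\<^sub>R h p) \<in> borel_measurable borel"
    by (rule borel_measurable_continuous_on_indicator[OF assms(3) continuous_on_subset[OF assms(1,4)]])
  then show ?thesis by simp
qed

text \<open>
  In a chart the volume has a positive density, and nonempty open sets have positive Lebesgue measure.
\<close>

lemma volume_open_pos:
  assumes W: "open W" "W \<noteq> {}"
  shows "0 < emeasure m W"
proof (rule ccontr)
  assume "\<not> 0 < emeasure m W"
  then have m0: "emeasure m W = 0" by simp
  obtain x where x: "x \<in> W" using W by blast
  note c = chart_at[of x]
  let ?c = "chart_at A x"
  define Y where "Y = W \<inter> fst ?c"
  have Y: "open Y" "Y \<subseteq> fst ?c" "x \<in> Y" using W x c chart(1)[OF c(1)] by (auto simp: Y_def)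
  obtain K where K0: "0 < K" "\<And>c X. c \<in> A \<Longrightarrow> X \<in> sets borel \<Longrightarrow> X \<subseteq> fst c \<Longrightarrow>
     emeasure m X = ennreal K * (\<integral>\<^sup>+p\<in>snd c ` X. ennreal (density_in c p) \<partial>lborel)"
    by (rule volume_in_chart) (rule that)
  have K: "0 < K" "emeasure m Y = ennreal K * (\<integral>\<^sup>+p\<in>snd ?c ` Y. ennreal (density_in ?c p) \<partial>lborel)"
    using K0(1) K0(2)[OF c(1) borel_open[OF Y(1)] Y(2)] by auto
  have "emeasure m Y \<le> emeasure m W" using W by (intro emeasure_mono) (auto simp: Y_def sets_m)
  then have "(\<integral>\<^sup>+p\<in>snd ?c ` Y. ennreal (density_in ?c p) \<partial>lborel) = 0"
    using m0 K by (simp add: ennreal_eq_0_iff)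
  moreover have oc: "open (snd ?c ` Y)" by (rule chart_image_open[OF c(1) Y(1,2)])
  have sub: "snd ?c ` Y \<subseteq> coords ?c" using Y by auto
  have eq: "ennreal (density_in ?c p) * indicator (snd ?c ` Y) p = ennreal (indicator (snd ?c ` Y) p * density_in ?c p)" for p
    by (auto simp: indicator_def)
  have "(\<lambda>p. indicator (snd ?c ` Y) p * density_in ?c p) \<in> borel_measurable borel"
    by (rule indicator_times_measurable[OF density_in_continuous[OF c(1)] chart(2)[OF c(1)] _ sub]) (use oc in simp)
  ultimately have "emeasure lborel {p \<in> space lborel. ennreal (indicator (snd ?c ` Y) p * density_in ?c p) \<noteq> 0} = 0"
    unfolding eq by (subst (asm) nn_integral_0_iff) auto
  moreover have "{p \<in> space lborel. ennreal (indicator (snd ?c ` Y) p * density_in ?c p) \<noteq> 0} = snd ?c ` Y"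
    using density_in_pos[OF c(1)] sub by (auto simp: indicator_def ennreal_eq_0_iff) force+
  ultimately have "emeasure lborel (snd ?c ` Y) = 0" by simp
  then have "negligible (snd ?c ` Y)"
    using oc by (subst negligible_iff_emeasure0) auto
  then show False using open_not_negligible[OF oc] Y(3) by blast
qed

text \<open>
  Both \<open>m Y\<close> and \<open>m (f ` Y)\<close> as integrals over the same coordinate set. The density \<open>h\<close> of the second is the
  one that the change of variables formula gives for \<open>f\<close> in coordinates, and the density of the first
  is \<open>h\<close> times the absolute Jacobian of the inverse of \<open>Df\<close>.
\<close>

lemma change_of_volume:
  assumes x: "x \<notin> S"
  obtains V and c :: "('m, 'n) chart" and h :: "real ^ 'n \<Rightarrow> real" and K where "open V" "x \<in> V" "V \<subseteq> - S" "0 < K"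
    "\<And>Y. Y \<in> sets borel \<Longrightarrow> Y \<subseteq> V \<Longrightarrow> f ` Y \<in> sets borel"
    "\<And>Y. Y \<in> sets borel \<Longrightarrow> Y \<subseteq> V \<Longrightarrow> (\<lambda>p. indicator (snd c ` Y) p * h p) \<in> borel_measurable borel"
    "\<And>p. p \<in> snd c ` V \<Longrightarrow> 0 < h p"
    "\<And>p. p \<in> snd c ` V \<Longrightarrow> chart_inv c p \<in> V \<and> p = snd c (chart_inv c p)"
    "\<And>y. y \<in> V \<Longrightarrow> chart_inv c (snd c y) = y"
    "\<And>Y. Y \<in> sets borel \<Longrightarrow> Y \<subseteq> V \<Longrightarrow>
       emeasure m (f ` Y) = ennreal K * (\<integral>\<^sup>+p\<in>snd c ` Y. ennreal (h p) \<partial>lborel)"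
    "\<And>Y. Y \<in> sets borel \<Longrightarrow> Y \<subseteq> V \<Longrightarrow>
       emeasure m Y = ennreal K * (\<integral>\<^sup>+p\<in>snd c ` Y. ennreal (inv_deriv_abs_det A g f (chart_inv c p) * h p) \<partial>lborel)"
proof -
  let ?J = "inv_deriv_abs_det A g f"
  define c where "c = chart_at A x"
  define d where "d = chart_at A (f x)"
  have c: "c \<in> A" "x \<in> fst c" and d: "d \<in> A" "f x \<in> fst d" unfolding c_def d_def by (rule chart_at)+
  obtain V0 where V0: "diffeo_nbhd V0" "x \<in> V0" using ex_diffeo_nbhd[OF x] by blast
  have oV0: "open V0" "V0 \<subseteq> - S" "inj_on f V0" "open (f ` V0)" using V0 by (auto simp: diffeo_nbhd_def)
  define V where "V = fst c \<inter> V0 \<inter> f -` fst d"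
  have V: "open V" "x \<in> V" "V \<subseteq> - S" "V \<subseteq> fst c" "V \<subseteq> V0" "\<And>y. y \<in> V \<Longrightarrow> f y \<in> fst d" "inj_on f V"
    using c d V0 oV0 chart(1)[OF c(1)] open_preimage[OF chart(1)[OF d(1)]]
    by (auto simp: V_def intro: inj_on_subset)
  define \<Omega> where "\<Omega> = snd c ` V"
  have \<Omega>: "open \<Omega>" unfolding \<Omega>_def by (rule chart_image_open[OF c(1) V(1,4)])
  have \<Omega>V: "chart_inv c p \<in> V \<and> p = snd c (chart_inv c p)" if "p \<in> \<Omega>" for p
    using that V(4) chart(5)[OF c(1)] unfolding \<Omega>_def by force
  obtain K where K: "0 < K" "\<And>c X. c \<in> A \<Longrightarrow> X \<in> sets borel \<Longrightarrow> X \<subseteq> fst c \<Longrightarrow>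
     emeasure m X = ennreal K * (\<integral>\<^sup>+p\<in>snd c ` X. ennreal (density_in c p) \<partial>lborel)"
    by (rule volume_in_chart) (rule that)
  have Ck: "Ck_on (Suc 1) (rep c d) \<Omega>"
    using rep_Ck[OF V0(1) c(1) d(1)] by (simp add: \<Omega>_def V_def numeral_2_eq_2)
  have der: "(rep c d has_derivative drep c d p) (at p)" if "p \<in> \<Omega>" for p
    unfolding drep_def by (rule Ck_on_Suc_has_derivative[OF Ck \<Omega> that])
  define h where "h p = \<bar>det (matrix (drep c d p))\<bar> * density_in d (rep c d p)" for p
  have cV: "chart_inv c (snd c y) = y" if "y \<in> V" for y
    using that V(4) by (intro chart(5)[OF c(1)]) auto
  have repd: "rep c d p \<in> coords d" if "p \<in> \<Omega>" for p using \<Omega>V[OF that] V(6) by auto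
  have hcont: "continuous_on \<Omega> h"
    unfolding h_def
  proof (intro continuous_intros)
    show "continuous_on \<Omega> (\<lambda>p. det (matrix (drep c d p)))"
      unfolding det_def matrix_def drep_def
      by (simp, intro continuous_intros Ck_on_derivative_continuous[OF Ck])
    show "continuous_on \<Omega> (\<lambda>p. density_in d (rep c d p))"
      by (rule continuous_on_compose2[OF density_in_continuous[OF d(1)] Ck_on_continuous[OF Ck]]) (use repd in blast)
  qed
  have Jh: "?J (chart_inv c p) * h p = density_in c p" if "p \<in> \<Omega>" for p
  proof -
    define y where "y = chart_inv c p"
    have y: "y \<in> V" "p = snd c y" using \<Omega>V[OF that] by (auto simp: y_def)
    then have yc: "y \<in> fst c" "f y \<in> fst d" "y \<notin> S" using V by auto
    show ?thesis
      using inv_deriv_abs_det_in_charts[OF yc(3) c(1) yc(1) d(1) yc(2)]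
      by (simp add: h_def density_in_def y(2) chart(5)[OF c(1) yc(1)])
  qed
  have hpos: "0 < h p" if "p \<in> \<Omega>" for p
  proof -
    define y where "y = chart_inv c p"
    have y: "y \<in> V" "p = snd c y" using \<Omega>V[OF that] by (auto simp: y_def)
    then have yc: "y \<in> fst c" "f y \<in> fst d" "y \<notin> S" using V by auto
    have "det (matrix (drep c d p)) \<noteq> 0"
      unfolding y(2) by (rule inv_deriv_abs_det_pos(2)[OF yc(3) c(1) yc(1) d(1) yc(2)])
    then show ?thesis using density_in_pos[OF d(1) repd[OF that]] by (simp add: h_def)
  qed
  define k where "k = inv_into V0 f"
  have kc: "continuous_on (f ` V0) k"
    using V0 unfolding diffeo_nbhd_def Ck_map_on_def k_def[symmetric] by blast
  have fY: "f ` Y \<in> sets borel" if "Y \<in> sets borel" "Y \<subseteq> V" for Y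
  proof -
    have "f ` Y = f ` V0 \<inter> k -` Y" using that V(5) oV0(3) by (force simp: k_def)
    then show ?thesis using borel_preimage_of_continuous[OF kc oV0(4) that(1)] by simp
  qed
  have sub: "snd c ` Y \<subseteq> \<Omega>" if "Y \<subseteq> V" for Y using that by (auto simp: \<Omega>_def)
  have cY: "snd c ` Y \<in> sets borel" if "Y \<in> sets borel" "Y \<subseteq> V" for Y
    using that V(4) by (intro chart_image_borel c) auto
  have hm: "(\<lambda>p. indicator (snd c ` Y) p * h p) \<in> borel_measurable borel" if "Y \<in> sets borel" "Y \<subseteq> V" for Y
    by (rule indicator_times_measurable[OF hcont \<Omega> cY[OF that] sub[OF that(2)]])
  have img: "rep c d ` snd c ` Y = snd d ` f ` Y" if "Y \<subseteq> V" for Y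
    using that V(4) chart(5)[OF c(1)] by (force simp: image_image)
  have mfY: "emeasure m (f ` Y) = ennreal K * (\<integral>\<^sup>+p\<in>snd c ` Y. ennreal (h p) \<partial>lborel)"
    if Y: "Y \<in> sets borel" "Y \<subseteq> V" for Y
  proof -
    have fYd: "f ` Y \<subseteq> fst d" using Y(2) V(6) by auto
    have dfY: "snd d ` f ` Y \<in> sets borel" by (rule chart_image_borel[OF d(1) fY[OF Y] fYd])
    have eq: "emeasure m (f ` Y) = ennreal K * (\<integral>\<^sup>+p\<in>snd d ` f ` Y. ennreal (density_in d p) \<partial>lborel)"
      by (rule K(2)[OF d(1) fY[OF Y] fYd])
    have "emeasure m (f ` Y) \<le> 1"
      using prob_space.emeasure_le_1[OF m_prob] .
    then have fin: "(\<integral>\<^sup>+p\<in>snd d ` f ` Y. ennreal (density_in d p) \<partial>lborel) < \<infinity>"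
      unfolding eq using K(1) by (auto simp: less_top[symmetric] ennreal_mult_eq_top_iff top_unique)
    have subd: "snd d ` f ` Y \<subseteq> coords d" using fYd by auto
    have "(\<integral>\<^sup>+p\<in>snd c ` Y. ennreal (\<bar>det (matrix (drep c d p))\<bar> * density_in d (rep c d p)) \<partial>lborel)
        = (\<integral>\<^sup>+q\<in>rep c d ` snd c ` Y. ennreal (density_in d q) \<partial>lborel)"
    proof (rule nn_integral_change_of_variables[OF cY[OF Y]])
      show "rep c d ` snd c ` Y \<in> sets borel" using dfY img[OF Y(2)] by simp
      show "(rep c d has_derivative drep c d p) (at p within snd c ` Y)" if "p \<in> snd c ` Y" for p
        by (rule has_derivative_at_withinI[OF der]) (use that sub[OF Y(2)] in blast)
      show "inj_on (rep c d) (snd c ` Y)"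
      proof (rule inj_onI)
        fix p q assume "p \<in> snd c ` Y" "q \<in> snd c ` Y" and e: "rep c d p = rep c d q"
        then obtain u v where uv: "u \<in> Y" "v \<in> Y" "p = snd c u" "q = snd c v" by blast
        have i: "chart_inv c p = u" "chart_inv c q = v"
          using uv Y(2) V(4) by (auto intro!: chart(5)[OF c(1)])
        have "f u \<in> fst d" "f v \<in> fst d" "u \<in> V" "v \<in> V" using uv Y V by auto
        moreover have "snd d (f u) = snd d (f v)" using e by (simp add: i)
        ultimately have "f u = f v" using chart(5)[OF d(1)] by metis
        then show "p = q" using inj_onD[OF V(7)] \<open>u \<in> V\<close> \<open>v \<in> V\<close> uv by blast
      qed
      show "0 \<le> density_in d y" if "y \<in> rep c d ` snd c ` Y" for y
        using density_in_pos[OF d(1), of y] that subd img[OF Y(2)] by (auto intro: less_imp_le)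
      show "(\<lambda>y. indicator (rep c d ` snd c ` Y) y * density_in d y) \<in> borel_measurable borel"
        unfolding img[OF Y(2)] by (rule indicator_times_measurable[OF density_in_continuous[OF d(1)] chart(2)[OF d(1)] dfY subd])
      show "(\<lambda>p. indicator (snd c ` Y) p * (\<bar>det (matrix (drep c d p))\<bar> * density_in d (rep c d p))) \<in> borel_measurable borel"
        using hm[OF Y] by (simp add: h_def)
      show "(\<integral>\<^sup>+q\<in>rep c d ` snd c ` Y. ennreal (density_in d q) \<partial>lborel) < \<infinity>"
        unfolding img[OF Y(2)] by (rule fin)
    qed
    then show ?thesis unfolding eq img[OF Y(2)] h_def by simp
  qed
  have mY: "emeasure m Y = ennreal K * (\<integral>\<^sup>+p\<in>snd c ` Y. ennreal (?J (chart_inv c p) * h p) \<partial>lborel)"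
    if Y: "Y \<in> sets borel" "Y \<subseteq> V" for Y
  proof -
    have "emeasure m Y = ennreal K * (\<integral>\<^sup>+p\<in>snd c ` Y. ennreal (density_in c p) \<partial>lborel)"
      using Y V(4) by (intro K(2) c) auto
    also have "(\<integral>\<^sup>+p\<in>snd c ` Y. ennreal (density_in c p) \<partial>lborel)
        = (\<integral>\<^sup>+p\<in>snd c ` Y. ennreal (?J (chart_inv c p) * h p) \<partial>lborel)"
      by (rule nn_integral_cong) (use Jh sub[OF Y(2)] in \<open>auto simp: indicator_def\<close>)
    finally show ?thesis .
  qed
  show thesis
    by (rule that[where V=V and c=c and h=h and K=K, OF V(1,2,3) K(1) fY hm hpos[unfolded \<Omega>_def]
          \<Omega>V[unfolded \<Omega>_def] cV mfY mY])
qed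

text \<open>
  Comparison of the two integrals of \<open>change_of_volume\<close>. In the second part, positivity of the density
  \<open>h\<close> shows that \<open>m (f ` Y) = 0\<close> forces \<open>m Y = 0\<close>.
\<close>

lemma local_jacobian_bounds:
  assumes x: "x \<notin> S"
  shows "\<exists>V. open V \<and> x \<in> V \<and> jacobian_bounds m f (inv_deriv_abs_det A g f) V"
    and "\<exists>V. open V \<and> x \<in> V \<and> (\<forall>X\<in>null_sets m. f -` X \<inter> V \<in> null_sets m)"
proof -
  let ?J = "inv_deriv_abs_det A g f"
  obtain V and c :: "('m, 'n) chart" and h :: "real ^ 'n \<Rightarrow> real" and K where V: "open V" "x \<in> V" "V \<subseteq> - S" and K: "0 < K"
    and fY: "\<And>Y. Y \<in> sets borel \<Longrightarrow> Y \<subseteq> V \<Longrightarrow> f ` Y \<in> sets borel"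
    and hm: "\<And>Y. Y \<in> sets borel \<Longrightarrow> Y \<subseteq> V \<Longrightarrow> (\<lambda>p. indicator (snd c ` Y) p * h p) \<in> borel_measurable borel"
    and hpos: "\<And>p. p \<in> snd c ` V \<Longrightarrow> 0 < h p"
    and "\<And>p. p \<in> snd c ` V \<Longrightarrow> chart_inv c p \<in> V \<and> p = snd c (chart_inv c p)"
    and inv: "\<And>y. y \<in> V \<Longrightarrow> chart_inv c (snd c y) = y"
    and mfY: "\<And>Y. Y \<in> sets borel \<Longrightarrow> Y \<subseteq> V \<Longrightarrow>
       emeasure m (f ` Y) = ennreal K * (\<integral>\<^sup>+p\<in>snd c ` Y. ennreal (h p) \<partial>lborel)"
    and mY: "\<And>Y. Y \<in> sets borel \<Longrightarrow> Y \<subseteq> V \<Longrightarrow>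
       emeasure m Y = ennreal K * (\<integral>\<^sup>+p\<in>snd c ` Y. ennreal (?J (chart_inv c p) * h p) \<partial>lborel)"
    by (rule change_of_volume[OF x]) (rule that)
  have eq: "ennreal (h p) * indicator Z p = ennreal (indicator Z p * h p)" for p and Z :: "(real ^ 'n) set"
    by (auto simp: indicator_def)
  have "jacobian_bounds m f ?J V"
    unfolding jacobian_bounds_def
  proof (intro ballI impI allI conjI)
    fix Y and a :: real assume Y: "Y \<in> sets borel" "Y \<subseteq> V" and a: "0 < a"
    have amf: "ennreal a * emeasure m (f ` Y) = ennreal K * (\<integral>\<^sup>+p\<in>snd c ` Y. ennreal (a * h p) \<partial>lborel)"
    proof -
      have "(\<integral>\<^sup>+p\<in>snd c ` Y. ennreal (a * h p) \<partial>lborel) = (\<integral>\<^sup>+p. ennreal a * ennreal (indicator (snd c ` Y) p * h p) \<partial>lborel)"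
        by (rule nn_integral_cong) (use a in \<open>auto simp: indicator_def ennreal_mult'\<close>)
      also have "\<dots> = ennreal a * (\<integral>\<^sup>+p. ennreal (indicator (snd c ` Y) p * h p) \<partial>lborel)"
        by (rule nn_integral_cmult) (use hm[OF Y] in simp)
      finally show ?thesis unfolding mfY[OF Y] eq by (simp add: mult.left_commute)
    qed
    have J: "?J (chart_inv c p) = ?J y" "0 \<le> h p" if "y \<in> Y" "p = snd c y" for y p
      using that Y(2) inv hpos[of p] by (auto simp: less_imp_le)
    show "emeasure m Y \<le> ennreal a * emeasure m (f ` Y)" if le: "\<forall>y\<in>Y. ?J y \<le> a"
      unfolding mY[OF Y] amf
    proof (intro mult_left_mono nn_integral_mono)
      fix p
      show "ennreal (?J (chart_inv c p) * h p) * indicator (snd c ` Y) p \<le> ennreal (a * h p) * indicator (snd c ` Y) p"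
      proof (cases "p \<in> snd c ` Y")
        case True
        then obtain y where y: "y \<in> Y" "p = snd c y" by blast
        then have "?J (chart_inv c p) * h p \<le> a * h p" using J[OF y] le y(1) by (intro mult_right_mono) auto
        then show ?thesis using True by (simp add: ennreal_leI)
      qed simp
    qed simp
    show "ennreal a * emeasure m (f ` Y) \<le> emeasure m Y" if le: "\<forall>y\<in>Y. a \<le> ?J y"
      unfolding mY[OF Y] amf
    proof (intro mult_left_mono nn_integral_mono)
      fix p
      show "ennreal (a * h p) * indicator (snd c ` Y) p \<le> ennreal (?J (chart_inv c p) * h p) * indicator (snd c ` Y) p"
      proof (cases "p \<in> snd c ` Y")
        case True
        then obtain y where y: "y \<in> Y" "p = snd c y" by blast
        then have "a * h p \<le> ?J (chart_inv c p) * h p" using J[OF y] le y(1) by (intro mult_right_mono) auto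
        then show ?thesis using True by (simp add: ennreal_leI)
      qed simp
    qed simp
  qed
  then show "\<exists>V. open V \<and> x \<in> V \<and> jacobian_bounds m f ?J V" using V by blast
  have "f -` X \<inter> V \<in> null_sets m" if X: "X \<in> null_sets m" for X
  proof -
    define Y where "Y = f -` X \<inter> V"
    have Xb: "X \<in> sets borel" using X by (simp add: null_sets_def sets_m)
    have "f -` X \<in> sets borel"
      using measurable_sets_borel[OF borel_measurable_continuous_onI[OF f_continuous] Xb] .
    then have Y: "Y \<in> sets borel" "Y \<subseteq> V" using V(1) by (auto simp: Y_def)
    have "emeasure m (f ` Y) \<le> emeasure m X"
      using Xb by (intro emeasure_mono) (auto simp: Y_def sets_m)
    also have "\<dots> = 0" using X by auto
    finally have "(\<integral>\<^sup>+p\<in>snd c ` Y. ennreal (h p) \<partial>lborel) = 0"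
      using K unfolding mfY[OF Y] by (simp add: ennreal_eq_0_iff)
    then have ae: "AE p in lborel. ennreal (indicator (snd c ` Y) p * h p) = 0"
      unfolding eq by (subst (asm) nn_integral_0_iff_AE) (use hm[OF Y] in auto)
    have "(\<integral>\<^sup>+p\<in>snd c ` Y. ennreal (?J (chart_inv c p) * h p) \<partial>lborel) = (\<integral>\<^sup>+p. 0 \<partial>(lborel :: (real ^ 'n) measure))"
    proof (rule nn_integral_cong_AE)
      show "AE p in lborel. ennreal (?J (chart_inv c p) * h p) * indicator (snd c ` Y) p = 0"
        using ae
      proof eventually_elim
        case (elim p)
        have "p \<notin> snd c ` Y"
        proof
          assume p: "p \<in> snd c ` Y"
          then have "0 < h p" using hpos[of p] Y(2) by blast
          then show False using elim p by (simp add: ennreal_eq_0_iff)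
        qed
        then show ?case by simp
      qed
    qed
    then have "emeasure m Y = 0" unfolding mY[OF Y] by simp
    then show ?thesis unfolding Y_def[symmetric] using Y by (simp add: null_sets_def sets_m)
  qed
  then show "\<exists>V. open V \<and> x \<in> V \<and> (\<forall>X\<in>null_sets m. f -` X \<inter> V \<in> null_sets m)" using V by blast
qed

end

section \<open>Locally Lipschitz functions\<close>

text \<open>
  A class of functions that is closed under the operations by which the Jacobian is formed: sums,
  products, determinants, logarithms at positive values, and composition.
\<close>

definition lipschitz_near :: "('a::metric_space \<Rightarrow> 'b::metric_space) \<Rightarrow> 'a \<Rightarrow> bool" where
  "lipschitz_near h p \<longleftrightarrow> (\<exists>r>0. \<exists>L\<ge>0. \<forall>x\<in>ball p r. \<forall>y\<in>ball p r. dist (h x) (h y) \<le> L * dist x y)"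

lemma lipschitz_nearI:
  assumes "0 < r" "0 \<le> L" "\<And>x y. dist p x < r \<Longrightarrow> dist p y < r \<Longrightarrow> dist (h x) (h y) \<le> L * dist x y"
  shows "lipschitz_near h p"
  using assms unfolding lipschitz_near_def by (intro exI[of _ r] conjI exI[of _ L]) auto

lemma lipschitz_nearE:
  assumes "lipschitz_near h p"
  obtains r L where "0 < r" "0 \<le> L" "\<And>x y. dist p x < r \<Longrightarrow> dist p y < r \<Longrightarrow> dist (h x) (h y) \<le> L * dist x y"
proof -
  obtain r L where "0 < r" "0 \<le> L" "\<forall>x\<in>ball p r. \<forall>y\<in>ball p r. dist (h x) (h y) \<le> L * dist x y"
    using assms unfolding lipschitz_near_def by blast
  then show thesis by (intro that[of r L]) auto
qed

lemma lipschitz_near_const: "lipschitz_near (\<lambda>_. a) p"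
  by (rule lipschitz_nearI[of 1 0]) auto

lemma lipschitz_near_compose:
  assumes g: "lipschitz_near g p" and h: "lipschitz_near h (g p)"
  shows "lipschitz_near (\<lambda>x. h (g x)) p"
proof -
  obtain r L where r: "0 < r" "0 \<le> L" "\<And>x y. dist p x < r \<Longrightarrow> dist p y < r \<Longrightarrow> dist (g x) (g y) \<le> L * dist x y"
    using lipschitz_nearE[OF g] by blast
  obtain s K where s: "0 < s" "0 \<le> K" "\<And>x y. dist (g p) x < s \<Longrightarrow> dist (g p) y < s \<Longrightarrow> dist (h x) (h y) \<le> K * dist x y"
    using lipschitz_nearE[OF h] by blast
  have near: "dist (g p) (g x) < s" if "dist p x < min r (s / (L + 1))" for x
  proof -
    have "dist (g p) (g x) \<le> L * dist p x" using r(1) that by (intro r(3)) auto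
    also have "\<dots> \<le> (L + 1) * dist p x" by (intro mult_right_mono) auto
    also have "\<dots> < (L + 1) * (s / (L + 1))" using that r(2) by (intro mult_strict_left_mono) auto
    also have "\<dots> = s" using r(2) by simp
    finally show ?thesis .
  qed
  show ?thesis
  proof (rule lipschitz_nearI[of "min r (s / (L + 1))" "K * L"])
    fix x y assume xy: "dist p x < min r (s / (L + 1))" "dist p y < min r (s / (L + 1))"
    have "dist (h (g x)) (h (g y)) \<le> K * dist (g x) (g y)" by (rule s(3)[OF near near]) (use xy in auto)
    also have "\<dots> \<le> K * (L * dist x y)" using xy s(2) by (intro mult_left_mono r(3)) auto
    finally show "dist (h (g x)) (h (g y)) \<le> K * L * dist x y" by (simp add: mult.assoc)
  qed (use r s in auto)
qed

lemma lipschitz_near_add: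
  fixes g h :: "'a::metric_space \<Rightarrow> real"
  assumes g: "lipschitz_near g p" and h: "lipschitz_near h p"
  shows "lipschitz_near (\<lambda>x. g x + h x) p"
proof -
  obtain r L where r: "0 < r" "0 \<le> L" "\<And>x y. dist p x < r \<Longrightarrow> dist p y < r \<Longrightarrow> dist (g x) (g y) \<le> L * dist x y"
    using lipschitz_nearE[OF g] by blast
  obtain s K where s: "0 < s" "0 \<le> K" "\<And>x y. dist p x < s \<Longrightarrow> dist p y < s \<Longrightarrow> dist (h x) (h y) \<le> K * dist x y"
    using lipschitz_nearE[OF h] by blast
  show ?thesis
  proof (rule lipschitz_nearI[of "min r s" "L + K"])
    fix x y assume xy: "dist p x < min r s" "dist p y < min r s"
    have "dist (g x + h x) (g y + h y) \<le> dist (g x) (g y) + dist (h x) (h y)" by (rule dist_triangle_add)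
    also have "\<dots> \<le> L * dist x y + K * dist x y" using xy by (intro add_mono r s) auto
    finally show "dist (g x + h x) (g y + h y) \<le> (L + K) * dist x y" by (simp add: distrib_right)
  qed (use r s in auto)
qed

lemma lipschitz_near_mult:
  fixes g h :: "'a::metric_space \<Rightarrow> real"
  assumes g: "lipschitz_near g p" and h: "lipschitz_near h p"
  shows "lipschitz_near (\<lambda>x. g x * h x) p"
proof -
  obtain r L where r: "0 < r" "0 \<le> L" "\<And>x y. dist p x < r \<Longrightarrow> dist p y < r \<Longrightarrow> dist (g x) (g y) \<le> L * dist x y"
    using lipschitz_nearE[OF g] by blast
  obtain s K where s: "0 < s" "0 \<le> K" "\<And>x y. dist p x < s \<Longrightarrow> dist p y < s \<Longrightarrow> dist (h x) (h y) \<le> K * dist x y"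
    using lipschitz_nearE[OF h] by blast
  have bd: "\<bar>g x\<bar> \<le> \<bar>g p\<bar> + L * r" if "dist p x < r" for x
  proof -
    have "dist (g p) (g x) \<le> L * dist p x" using r(1) that by (intro r(3)) auto
    also have "\<dots> \<le> L * r" using that r(2) by (intro mult_left_mono) auto
    finally show ?thesis by (simp add: dist_real_def)
  qed
  have bd': "\<bar>h x\<bar> \<le> \<bar>h p\<bar> + K * s" if "dist p x < s" for x
  proof -
    have "dist (h p) (h x) \<le> K * dist p x" using s(1) that by (intro s(3)) auto
    also have "\<dots> \<le> K * s" using that s(2) by (intro mult_left_mono) auto
    finally show ?thesis by (simp add: dist_real_def)
  qed
  show ?thesis
  proof (rule lipschitz_nearI[of "min r s" "(\<bar>g p\<bar> + L * r) * K + (\<bar>h p\<bar> + K * s) * L"])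
    fix x y assume xy: "dist p x < min r s" "dist p y < min r s"
    have "g x * h x - g y * h y = g x * (h x - h y) + h y * (g x - g y)" by (simp add: algebra_simps)
    then have "dist (g x * h x) (g y * h y) \<le> \<bar>g x\<bar> * dist (h x) (h y) + \<bar>h y\<bar> * dist (g x) (g y)"
      using abs_triangle_ineq[of "g x * (h x - h y)" "h y * (g x - g y)"] by (simp add: dist_real_def abs_mult)
    also have "\<dots> \<le> (\<bar>g p\<bar> + L * r) * (K * dist x y) + (\<bar>h p\<bar> + K * s) * (L * dist x y)"
      using xy r s by (intro add_mono mult_mono bd bd' r(3) s(3)) auto
    finally show "dist (g x * h x) (g y * h y) \<le> ((\<bar>g p\<bar> + L * r) * K + (\<bar>h p\<bar> + K * s) * L) * dist x y"
      by (simp add: algebra_simps)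
  qed (use r s in auto)
qed

lemma lipschitz_near_sum:
  fixes h :: "'i \<Rightarrow> 'a::metric_space \<Rightarrow> real"
  shows "(\<And>i. i \<in> I \<Longrightarrow> lipschitz_near (h i) p) \<Longrightarrow> lipschitz_near (\<lambda>x. \<Sum>i\<in>I. h i x) p"
  by (induction I rule: infinite_finite_induct) (auto intro: lipschitz_near_const lipschitz_near_add)

lemma lipschitz_near_prod:
  fixes h :: "'i \<Rightarrow> 'a::metric_space \<Rightarrow> real"
  shows "(\<And>i. i \<in> I \<Longrightarrow> lipschitz_near (h i) p) \<Longrightarrow> lipschitz_near (\<lambda>x. \<Prod>i\<in>I. h i x) p"
  by (induction I rule: infinite_finite_induct) (auto intro: lipschitz_near_const lipschitz_near_mult)

lemma lipschitz_near_det: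
  fixes M :: "'a::metric_space \<Rightarrow> real ^ 'n::finite ^ 'n"
  assumes "\<And>i j. lipschitz_near (\<lambda>x. M x $ i $ j) p"
  shows "lipschitz_near (\<lambda>x. det (M x)) p"
  unfolding det_def
  by (intro lipschitz_near_sum lipschitz_near_mult lipschitz_near_prod lipschitz_near_const assms)

lemma lipschitz_near_abs: "lipschitz_near (abs :: real \<Rightarrow> real) t"
  by (rule lipschitz_nearI[of 1 1]) (auto simp: dist_real_def)

lemma lipschitz_near_ln:
  assumes "0 < t"
  shows "lipschitz_near (ln :: real \<Rightarrow> real) t"
proof (rule lipschitz_nearI[of "t / 2" "2 / t"])
  have le: "ln x - ln y \<le> 2 / t * \<bar>x - y\<bar>" if "t / 2 < x" "t / 2 < y" for x y :: real
  proof -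
    have xy: "0 < x" "0 < y" using that assms by linarith+
    have "ln x - ln y = ln (x / y)" using xy by (simp add: ln_div)
    also have "\<dots> \<le> x / y - 1" using xy by (intro ln_le_minus_one) simp
    also have "\<dots> = (x - y) / y" using xy by (simp add: diff_divide_distrib)
    also have "\<dots> \<le> \<bar>x - y\<bar> / y" using xy by (intro divide_right_mono) auto
    also have "\<dots> \<le> \<bar>x - y\<bar> / (t / 2)" using that assms by (intro divide_left_mono) auto
    finally show ?thesis by (simp add: mult.commute)
  qed
  fix x y assume "dist t x < t / 2" "dist t y < t / 2"
  then have "t / 2 < x" "t / 2 < y" by (auto simp: dist_real_def abs_if split: if_splits)
  then show "dist (ln x) (ln y) \<le> 2 / t * dist x y"
    using le[of x y] le[of y x] by (auto simp: dist_real_def abs_le_iff abs_minus_commute)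
qed (use assms in auto)

lemma lipschitz_near_component: "lipschitz_near (\<lambda>v :: real ^ 'n::finite. v $ i) w"
  by (rule lipschitz_nearI[of 1 1]) (auto simp: dist_vec_nth_le)

text \<open>
  On a compact ball the derivative is bounded, since its values on basis vectors are continuous.
\<close>

lemma lipschitz_near_Ck:
  fixes F :: "'a::euclidean_space \<Rightarrow> 'b::euclidean_space"
  assumes F: "Ck_on (Suc k) F U" and U: "open U" "p \<in> U"
  shows "lipschitz_near F p"
proof -
  let ?D = "\<lambda>q. frechet_derivative F (at q)"
  obtain r where r: "0 < r" "cball p r \<subseteq> U" using U by (meson open_contains_cball)
  have "\<exists>M. \<forall>q\<in>cball p r. norm (?D q b) \<le> M" for b
  proof -
    have "continuous_on (cball p r) (\<lambda>q. ?D q b)"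
      using Ck_on_derivative_continuous[OF F] r(2) by (rule continuous_on_subset)
    then have "bounded ((\<lambda>q. ?D q b) ` cball p r)"
      by (intro compact_imp_bounded compact_continuous_image compact_cball)
    then show ?thesis unfolding bounded_iff by blast
  qed
  then obtain M where M: "\<And>b q. q \<in> cball p r \<Longrightarrow> norm (?D q b) \<le> M b" by metis
  define L where "L = (\<Sum>b\<in>Basis. M b)"
  have pr: "p \<in> cball p r" using r by simp
  have M0: "0 \<le> M b" for b by (rule order_trans[OF norm_ge_zero M[OF pr]])
  have der: "(F has_derivative ?D q) (at q)" if "q \<in> cball p r" for q
    using Ck_on_Suc_has_derivative[OF F U(1), of q] r(2) that by blast
  have "norm (?D q v) \<le> L * norm v" if q: "q \<in> cball p r" for q v
  proof -
    have lin: "linear (?D q)" by (rule has_derivative_linear[OF der[OF q]])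
    have "?D q v = ?D q (\<Sum>b\<in>Basis. (v \<bullet> b) *\<^sub>R b)" by (simp add: euclidean_representation)
    also have "\<dots> = (\<Sum>b\<in>Basis. (v \<bullet> b) *\<^sub>R ?D q b)" by (simp add: linear_sum[OF lin] linear_cmul[OF lin])
    also have "norm \<dots> \<le> (\<Sum>b\<in>Basis. norm v * M b)"
    proof (rule sum_norm_le)
      fix b :: 'a assume b: "b \<in> Basis"
      show "norm ((v \<bullet> b) *\<^sub>R ?D q b) \<le> norm v * M b"
        using Basis_le_norm[OF b, of v] M[OF q, of b] M0[of b] by (simp add: mult_mono)
    qed
    finally show ?thesis by (simp add: L_def sum_distrib_left mult.commute)
  qed
  then have on: "onorm (?D q) \<le> L" if "q \<in> cball p r" for q using that by (intro onorm_le) auto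
  have L0: "0 \<le> L" unfolding L_def by (intro sum_nonneg M0)
  show ?thesis
  proof (rule lipschitz_nearI[OF r(1) L0])
    fix x y assume xy: "dist p x < r" "dist p y < r"
    have "norm (F x - F y) \<le> L * norm (x - y)"
    proof (rule differentiable_bound[OF convex_cball[of p r] _ on])
      show "(F has_derivative ?D q) (at q within cball p r)" if "q \<in> cball p r" for q
        by (rule has_derivative_at_withinI[OF der[OF that]])
    qed (use xy in auto)
    then show "dist (F x) (F y) \<le> L * dist x y" by (simp add: dist_norm)
  qed
qed

section \<open>Regularity of the derivative\<close>

context smooth_local_diffeo
begin

lemma rep_near:
  assumes x: "x \<notin> S" and c: "c \<in> A" "x \<in> fst c" and d: "d \<in> A" "f x \<in> fst d"
  obtains \<Omega> where "open \<Omega>" "snd c x \<in> \<Omega>" "Ck_on 2 (rep c d) \<Omega>"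
    "\<And>p. p \<in> \<Omega> \<Longrightarrow> p \<in> coords c \<and> chart_inv c p \<notin> S \<and> f (chart_inv c p) \<in> fst d \<and> rep c d p \<in> coords d"
proof -
  obtain V where V: "diffeo_nbhd V" "x \<in> V" using ex_diffeo_nbhd[OF x] by blast
  then have oV: "open V" "V \<subseteq> - S" by (auto simp: diffeo_nbhd_def)
  show thesis
  proof (rule that[OF rep_domain_open[OF oV(1) c(1) d(1)] _ rep_Ck[OF V(1) c(1) d(1)]])
    show "snd c x \<in> snd c ` (fst c \<inter> V \<inter> f -` fst d)" using V c d by auto
    fix p assume "p \<in> snd c ` (fst c \<inter> V \<inter> f -` fst d)"
    then obtain y where y: "y \<in> fst c" "y \<in> V" "f y \<in> fst d" "p = snd c y" by auto
    then have "chart_inv c p = y" using chart(5)[OF c(1)] by simp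
    then show "p \<in> coords c \<and> chart_inv c p \<notin> S \<and> f (chart_inv c p) \<in> fst d \<and> rep c d p \<in> coords d"
      using y oV by auto
  qed
qed

text \<open>
  In fixed charts the metric at \<open>x\<close> and the pulled back metric of \<open>f x\<close> both vary continuously, so
  their norms change by factors close to one near \<open>x0\<close>; by \<open>inv_deriv_norm_le_iff\<close> the operator norm
  changes by at most the square of the quotient of such factors.
\<close>

lemma inv_deriv_norm_almost_constant:
  assumes x0: "x0 \<notin> S" and \<theta>: "1 < \<theta>"
  shows "\<exists>N. open N \<and> x0 \<in> N \<and> (\<forall>x\<in>N. \<forall>y\<in>N. inv_deriv_norm A g f y \<le> \<theta> * inv_deriv_norm A g f x)"
proof -
  define c where "c = chart_at A x0"
  define d where "d = chart_at A (f x0)"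
  have c: "c \<in> A" "x0 \<in> fst c" and d: "d \<in> A" "f x0 \<in> fst d" unfolding c_def d_def by (rule chart_at)+
  obtain \<Omega> where \<Omega>: "open \<Omega>" "snd c x0 \<in> \<Omega>" "Ck_on 2 (rep c d) \<Omega>" and
    \<Omega>': "\<And>p. p \<in> \<Omega> \<Longrightarrow> p \<in> coords c \<and> chart_inv c p \<notin> S \<and> f (chart_inv c p) \<in> fst d \<and> rep c d p \<in> coords d"
    using rep_near[OF x0 c d] by blast
  define p0 where "p0 = snd c x0"
  have p0: "p0 \<in> coords c" "p0 \<in> \<Omega>" using c \<Omega> by (auto simp: p0_def)
  define H where "H p v w = met d (rep c d p) (drep c d p v) (drep c d p w)" for p v w
  have pb: "pullback c d y = H (snd c y)" if "y \<in> fst c" for y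
    using chart(5)[OF c(1) that] by (intro ext) (simp add: pullback_def H_def)
  have Hform: "inner_form (H p)" if p: "p \<in> \<Omega>" for p
  proof -
    define y where "y = chart_inv c p"
    have y: "y \<in> fst c" "p = snd c y" using \<Omega>'[OF p] chart(6,7)[OF c(1)] by (auto simp: y_def)
    have yS: "y \<notin> S" "f y \<in> fst d" using \<Omega>'[OF p] by (simp_all add: y_def)
    show ?thesis
      using pullback_inner_form[OF yS(1) c(1) y(1) d(1) yS(2)] pb[OF y(1)] y(2) by simp
  qed
  have Hcont: "continuous_on \<Omega> (\<lambda>p. H p v w)" for v w
  proof -
    have "H p v w = (\<Sum>a\<in>Basis. \<Sum>b\<in>Basis. (drep c d p v \<bullet> a) * (drep c d p w \<bullet> b) * met d (rep c d p) a b)"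
      if "p \<in> \<Omega>" for p
      unfolding H_def by (rule bilinear_expand[OF inner_form_bilinear[OF met_inner_form[OF d(1)]]]) (use \<Omega>'[OF that] in blast)
    moreover have "continuous_on \<Omega> (\<lambda>p. \<Sum>a\<in>Basis. \<Sum>b\<in>Basis. (drep c d p v \<bullet> a) * (drep c d p w \<bullet> b) * met d (rep c d p) a b)"
    proof -
      have "continuous_on \<Omega> (\<lambda>p. drep c d p u)" for u
        unfolding drep_def using \<Omega>(3) by (intro Ck_on_derivative_continuous[of 1]) (simp add: numeral_2_eq_2)
      moreover have "continuous_on \<Omega> (\<lambda>p. met d (rep c d p) a b)" for a b
        by (rule continuous_on_compose2[OF Ck_on_continuous[OF met_Ck[OF d(1), of 0]] Ck_on_continuous[OF \<Omega>(3)]])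
           (use \<Omega>' in blast)
      ultimately show ?thesis by (intro continuous_intros)
    qed
    ultimately show ?thesis using continuous_on_cong by (metis (no_types, lifting))
  qed
  have "((\<lambda>e. ((1 + e) / (1 - e))\<^sup>2) \<longlongrightarrow> ((1 + 0) / (1 - 0))\<^sup>2) (at_right (0::real))"
    by (intro tendsto_intros) auto
  then have "\<forall>\<^sub>F e in at_right (0::real). ((1 + e) / (1 - e))\<^sup>2 < \<theta>"
    using \<theta> by (intro order_tendstoD(2)) auto
  moreover have "\<forall>\<^sub>F e in at_right (0::real). 0 < e \<and> e < 1"
    unfolding eventually_at_right_field by (rule exI[of _ 1]) auto
  ultimately have "\<forall>\<^sub>F e in at_right (0::real). ((1 + e) / (1 - e))\<^sup>2 < \<theta> \<and> 0 < e \<and> e < 1"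
    by eventually_elim auto
  then obtain e :: real where e: "((1 + e) / (1 - e))\<^sup>2 < \<theta>" "0 < e" "e < 1"
    using eventually_happens'[OF trivial_limit_at_right_real] by blast
  define near where "near p \<longleftrightarrow> p \<in> \<Omega> \<and> (\<forall>v. (1 - e) * sqrt (met c p0 v v) \<le> sqrt (met c p v v) \<and>
      sqrt (met c p v v) \<le> (1 + e) * sqrt (met c p0 v v)) \<and> (\<forall>v. (1 - e) * sqrt (H p0 v v) \<le> sqrt (H p v v) \<and>
      sqrt (H p v v) \<le> (1 + e) * sqrt (H p0 v v))" for p
  have in\<Omega>: "\<forall>\<^sub>F p in nhds p0. p \<in> \<Omega>" using \<Omega>(1) p0(2) by (rule eventually_nhds_in_open)
  have "\<forall>\<^sub>F p in nhds p0. \<forall>v. (1 - e) * sqrt (H p0 v v) \<le> sqrt (H p v v) \<and> sqrt (H p v v) \<le> (1 + e) * sqrt (H p0 v v)"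
  proof (rule forms_converge_uniformly[where H=H, OF Hform[OF p0(2)] _ _ e(2)])
    show "\<forall>\<^sub>F p in nhds p0. bilinear (H p)"
      using in\<Omega> by eventually_elim (rule inner_form_bilinear[OF Hform])
    show "((\<lambda>p. H p v w) \<longlongrightarrow> H p0 v w) (nhds p0)" for v w
      by (rule isCont_tendsto_nhds, rule continuous_on_eq_continuous_at[THEN iffD1, rule_format, OF \<Omega>(1) Hcont p0(2)])
  qed
  with in\<Omega> met_near[OF c(1) p0(1) e(2)] have "\<forall>\<^sub>F p in nhds p0. near p"
    by eventually_elim (auto simp: near_def)
  moreover have "filterlim (snd c) (nhds p0) (nhds x0)"
    unfolding p0_def by (rule isCont_tendsto_nhds[OF chart_isCont(1)[OF c]])
  ultimately have 1: "\<forall>\<^sub>F x in nhds x0. near (snd c x)"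
    by (rule eventually_compose_filterlim)
  have 2: "\<forall>\<^sub>F x in nhds x0. x \<in> fst c"
    using chart(1)[OF c(1)] c(2) by (rule eventually_nhds_in_open)
  have main: "inv_deriv_norm A g f y \<le> \<theta> * inv_deriv_norm A g f x"
    if x: "near (snd c x)" "x \<in> fst c" and y: "near (snd c y)" "y \<in> fst c" for x y
  proof -
    let ?lam = "inv_deriv_norm A g f"
    have xS: "x \<notin> S" "f x \<in> fst d" and yS: "y \<notin> S" "f y \<in> fst d"
      using x y \<Omega>'[of "snd c x"] \<Omega>'[of "snd c y"] chart(5)[OF c(1)] by (auto simp: near_def)
    have lam: "0 < ?lam x" by (rule inv_deriv_norm_pos[OF xS(1)])
    have nn: "0 \<le> sqrt (met c p0 v v)" "0 \<le> sqrt (H p0 v v)" for v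
      using inner_form_nonneg[OF met_inner_form[OF c(1) p0(1)]] inner_form_nonneg[OF Hform[OF p0(2)]] by auto
    show ?thesis
    proof (subst inv_deriv_norm_le_iff[OF yS(1) c(1) y(2) d(1) yS(2)], intro allI)
      fix v
      have a: "sqrt (met c (snd c y) v v) \<le> (1 + e) * sqrt (met c p0 v v)" using y(1) by (simp add: near_def)
      have b: "(1 - e) * sqrt (met c p0 v v) \<le> sqrt (met c (snd c x) v v)" using x(1) by (simp add: near_def)
      have c': "sqrt (met c (snd c x) v v) \<le> ?lam x * sqrt (H (snd c x) v v)"
        using inv_deriv_norm_le_iff[OF xS(1) c(1) x(2) d(1) xS(2), of "?lam x"] pb[OF x(2)] by simp
      have d': "sqrt (H (snd c x) v v) \<le> (1 + e) * sqrt (H p0 v v)" using x(1) by (simp add: near_def)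
      have e': "(1 - e) * sqrt (H p0 v v) \<le> sqrt (H (snd c y) v v)" using y(1) by (simp add: near_def)
      have "(1 - e) * ((1 - e) * sqrt (met c (snd c y) v v)) \<le> (1 - e) * ((1 - e) * ((1 + e) * sqrt (met c p0 v v)))"
        using a e by (intro mult_left_mono) auto
      also have "\<dots> = (1 - e) * ((1 + e) * ((1 - e) * sqrt (met c p0 v v)))" by simp
      also have "\<dots> \<le> (1 - e) * ((1 + e) * (?lam x * ((1 + e) * sqrt (H p0 v v))))"
        using b c' d' e lam by (intro mult_left_mono) (auto intro: order_trans mult_left_mono)
      also have "\<dots> = (1 + e) * ((1 + e) * (?lam x * ((1 - e) * sqrt (H p0 v v))))" by simp
      also have "\<dots> \<le> (1 + e) * ((1 + e) * (?lam x * sqrt (H (snd c y) v v)))"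
        using e' e lam by (intro mult_left_mono) auto
      finally have "sqrt (met c (snd c y) v v) \<le> ((1 + e) * ((1 + e) * (?lam x * sqrt (H (snd c y) v v)))) / ((1 - e) * (1 - e))"
        using e by (simp add: pos_le_divide_eq mult_ac)
      also have "\<dots> = ((1 + e) / (1 - e))\<^sup>2 * (?lam x * sqrt (H (snd c y) v v))"
        by (simp add: power2_eq_square)
      also have "\<dots> \<le> \<theta> * (?lam x * sqrt (H (snd c y) v v))"
      proof (intro mult_right_mono mult_nonneg_nonneg)
        show "0 \<le> sqrt (H (snd c y) v v)" using e' nn(2)[of v] e by (meson diff_ge_0_iff_ge less_imp_le mult_nonneg_nonneg order_trans)
      qed (use e lam in auto)
      finally show "sqrt (met c (snd c y) v v) \<le> \<theta> * ?lam x * sqrt (pullback c d y v v)"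
        using pb[OF y(2)] by (simp add: mult.assoc)
    qed
  qed
  from 1 2 have ev: "\<forall>\<^sub>F x in nhds x0. near (snd c x) \<and> x \<in> fst c" by eventually_elim auto
  then obtain N where "open N" "x0 \<in> N" "\<And>x. x \<in> N \<Longrightarrow> near (snd c x) \<and> x \<in> fst c"
    unfolding eventually_nhds by blast
  then show ?thesis using main by (intro exI[of _ N]) blast
qed

lemma lipschitz_near_gram:
  assumes "c \<in> A" "p \<in> coords c"
  shows "lipschitz_near (\<lambda>q. gram_det (met c q)) p"
  unfolding gram_det_def
proof (rule lipschitz_near_det)
  fix i j
  have "lipschitz_near (\<lambda>q. met c q (axis i 1) (axis j 1)) p"
    by (rule lipschitz_near_Ck[OF met_Ck[OF assms(1)] chart(2)[OF assms(1)] assms(2)])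
  then show "lipschitz_near (\<lambda>q. (\<chi> i j. met c q (axis i 1) (axis j 1)) $ i $ j) p" by simp
qed

text \<open>
  In charts, \<open>ln |det Df\<^sup>-\<^sup>1|\<close> is composed of the first derivatives of \<open>f\<close>, which are of class C1, and
  the coefficients of the metric. Coordinates are Lipschitz functions of the point by \<open>dist_in_chart\<close>.
\<close>

lemma ln_inv_deriv_abs_det_lipschitz:
  assumes x0: "x0 \<notin> S"
  shows "lipschitz_near (\<lambda>x. ln (inv_deriv_abs_det A g f x)) x0"
proof -
  let ?J = "inv_deriv_abs_det A g f"
  define c where "c = chart_at A x0"
  define d where "d = chart_at A (f x0)"
  have c: "c \<in> A" "x0 \<in> fst c" and d: "d \<in> A" "f x0 \<in> fst d" unfolding c_def d_def by (rule chart_at)+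
  obtain \<Omega> where \<Omega>: "open \<Omega>" "snd c x0 \<in> \<Omega>" "Ck_on 2 (rep c d) \<Omega>" and
    \<Omega>': "\<And>p. p \<in> \<Omega> \<Longrightarrow> p \<in> coords c \<and> chart_inv c p \<notin> S \<and> f (chart_inv c p) \<in> fst d \<and> rep c d p \<in> coords d"
    using rep_near[OF x0 c d] by blast
  define p0 where "p0 = snd c x0"
  have p0: "p0 \<in> coords c" "p0 \<in> \<Omega>" "rep c d p0 \<in> coords d" using c \<Omega> \<Omega>'[OF \<Omega>(2)] by (auto simp: p0_def)
  define \<Phi> where "\<Phi> p = (1 / 2) * ln (gram_det (met c p)) + (- 1) * ln \<bar>det (matrix (drep c d p))\<bar>
      + (- 1 / 2) * ln (gram_det (met d (rep c d p)))" for p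
  have detnz: "det (matrix (drep c d p)) \<noteq> 0" and \<Phi>: "ln (?J (chart_inv c p)) = \<Phi> p" if p: "p \<in> \<Omega>" for p
  proof -
    define y where "y = chart_inv c p"
    have y: "y \<in> fst c" "p = snd c y" "y \<notin> S" "f y \<in> fst d"
      using \<Omega>'[OF p] chart(6,7)[OF c(1)] by (auto simp: y_def)
    show nz: "det (matrix (drep c d p)) \<noteq> 0"
      unfolding y(2) by (rule inv_deriv_abs_det_pos(2)[OF y(3) c(1) y(1) d(1) y(4)])
    have ry: "rep c d p = snd d (f y)" using y chart(5)[OF c(1) y(1)] by simp
    have J: "0 < ?J y" by (rule inv_deriv_abs_det_pos(1)[OF y(3)])
    have gc: "0 < gram_det (met c p)" using \<Omega>'[OF p] by (intro met_gram_pos c) auto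
    have gd: "0 < gram_det (met d (rep c d p))" using \<Omega>'[OF p] by (intro met_gram_pos d) auto
    have "?J y * (\<bar>det (matrix (drep c d p))\<bar> * sqrt (gram_det (met d (rep c d p)))) = sqrt (gram_det (met c p))"
      using inv_deriv_abs_det_in_charts[OF y(3) c(1) y(1) d(1) y(4)] unfolding ry y(2)[symmetric] .
    then have "ln (?J y) + (ln \<bar>det (matrix (drep c d p))\<bar> + ln (sqrt (gram_det (met d (rep c d p))))) = ln (sqrt (gram_det (met c p)))"
      using J nz gd by (metis ln_mult_pos mult_pos_pos real_sqrt_gt_0_iff zero_less_abs_iff)
    then show "ln (?J (chart_inv c p)) = \<Phi> p"
      using gc gd by (simp add: \<Phi>_def y_def[symmetric] ln_sqrt)
  qed
  have "lipschitz_near \<Phi> p0"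
    unfolding \<Phi>_def
  proof (intro lipschitz_near_add lipschitz_near_mult lipschitz_near_const)
    show "lipschitz_near (\<lambda>p. ln (gram_det (met c p))) p0"
      by (rule lipschitz_near_compose[where h=ln and g="\<lambda>p. gram_det (met c p)", OF lipschitz_near_gram[OF c(1) p0(1)] lipschitz_near_ln[OF met_gram_pos[OF c(1) p0(1)]]])
    have rl: "lipschitz_near (rep c d) p0"
      using \<Omega>(3) by (intro lipschitz_near_Ck[of 1, OF _ \<Omega>(1) p0(2)]) (simp add: numeral_2_eq_2)
    have "lipschitz_near (\<lambda>p. gram_det (met d (rep c d p))) p0"
      by (rule lipschitz_near_compose[where h="\<lambda>q. gram_det (met d q)" and g="rep c d", OF rl lipschitz_near_gram[OF d(1) p0(3)]])
    then show "lipschitz_near (\<lambda>p. ln (gram_det (met d (rep c d p)))) p0"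
      by (rule lipschitz_near_compose[where h=ln and g="\<lambda>p. gram_det (met d (rep c d p))", OF _ lipschitz_near_ln[OF met_gram_pos[OF d(1) p0(3)]]])
    have "lipschitz_near (\<lambda>p. det (matrix (drep c d p))) p0"
    proof (rule lipschitz_near_det)
      fix i j
      have "Ck_on (Suc 0) (\<lambda>p. drep c d p (axis j 1)) \<Omega>"
        using \<Omega>(3) unfolding drep_def numeral_2_eq_2 by (simp only: Ck_on.simps) blast
      then have "lipschitz_near (\<lambda>p. drep c d p (axis j 1)) p0" by (rule lipschitz_near_Ck[OF _ \<Omega>(1) p0(2)])
      from lipschitz_near_compose[where h="\<lambda>v. v $ i", OF this lipschitz_near_component]
      show "lipschitz_near (\<lambda>p. matrix (drep c d p) $ i $ j) p0" by (simp add: matrix_def)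
    qed
    from lipschitz_near_compose[where h=abs, OF this lipschitz_near_abs]
    have "lipschitz_near (\<lambda>p. \<bar>det (matrix (drep c d p))\<bar>) p0" .
    moreover have "0 < \<bar>det (matrix (drep c d p0))\<bar>" using detnz[OF p0(2)] by simp
    ultimately show "lipschitz_near (\<lambda>p. ln \<bar>det (matrix (drep c d p))\<bar>) p0"
      by (intro lipschitz_near_compose[where h=ln and g="\<lambda>p. \<bar>det (matrix (drep c d p))\<bar>"] lipschitz_near_ln)
  qed
  then obtain r L where r: "0 < r" "0 \<le> L" "\<And>p q. dist p0 p < r \<Longrightarrow> dist p0 q < r \<Longrightarrow> dist (\<Phi> p) (\<Phi> q) \<le> L * dist p q"
    using lipschitz_nearE by blast
  obtain a where a: "0 < a" "\<And>v. a * norm v \<le> sqrt (met c p0 v v)"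
    using inner_form_norm_bounds[OF met_inner_form[OF c(1) p0(1)]] by metis
  obtain s where s: "0 < s" "\<And>p q. p \<in> ball p0 s \<Longrightarrow> q \<in> ball p0 s \<Longrightarrow>
      (1 - 1 / 2) * sqrt (met c p0 (q - p) (q - p)) \<le> dist (chart_inv c p) (chart_inv c q)"
    using dist_in_chart[OF c(1) p0(1), of "1 / 2"] by auto
  have "\<forall>\<^sub>F x in nhds x0. snd c x \<in> ball p0 (min r s) \<inter> \<Omega>"
    using isCont_tendsto_nhds[OF chart_isCont(1)[OF c]] p0(2) r s \<Omega>(1)
    by (intro topological_tendstoD[where l="snd c x0"]) (auto simp: p0_def)
  moreover have "\<forall>\<^sub>F x in nhds x0. x \<in> fst c"
    using chart(1)[OF c(1)] c(2) by (rule eventually_nhds_in_open)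
  ultimately have "\<forall>\<^sub>F x in nhds x0. snd c x \<in> ball p0 (min r s) \<inter> \<Omega> \<and> x \<in> fst c"
    by eventually_elim auto
  then obtain t where t: "0 < t" "\<And>x. dist x x0 < t \<Longrightarrow> snd c x \<in> ball p0 (min r s) \<inter> \<Omega> \<and> x \<in> fst c"
    unfolding eventually_nhds_metric by blast
  show ?thesis
  proof (rule lipschitz_nearI[OF t(1)])
    fix x y assume xy: "dist x0 x < t" "dist x0 y < t"
    define p where "p = snd c x"
    define q where "q = snd c y"
    have px: "p \<in> ball p0 r" "p \<in> ball p0 s" "p \<in> \<Omega>" "chart_inv c p = x"
      using t(2)[of x] xy chart(5)[OF c(1)] by (auto simp: p_def dist_commute)
    have qy: "q \<in> ball p0 r" "q \<in> ball p0 s" "q \<in> \<Omega>" "chart_inv c q = y"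
      using t(2)[of y] xy chart(5)[OF c(1)] by (auto simp: q_def dist_commute)
    have "a * norm (q - p) \<le> 2 * dist x y"
      using s(2)[OF px(2) qy(2)] a(2)[of "q - p"] px(4) qy(4) by simp
    then have pq: "dist p q \<le> 2 * dist x y / a"
      using a(1) by (simp add: pos_le_divide_eq dist_norm norm_minus_commute mult.commute)
    have "dist (ln (?J x)) (ln (?J y)) = dist (\<Phi> p) (\<Phi> q)"
      using \<Phi>[OF px(3)] \<Phi>[OF qy(3)] px(4) qy(4) by simp
    also have "\<dots> \<le> L * dist p q" using px(1) qy(1) by (intro r(3)) auto
    also have "\<dots> \<le> L * (2 * dist x y / a)" by (rule mult_left_mono[OF pq r(2)])
    finally show "dist (ln (?J x)) (ln (?J y)) \<le> (L * (2 / a)) * dist x y" by simp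
  next
    show "0 \<le> L * (2 / a)" using r a by simp
  qed
qed

end

section \<open>Hyperbolic times of the map\<close>

text \<open>
  The Lebesgue number lemma.
\<close>

lemma uniform_of_local_compact:
  fixes P :: "'m::metric_space \<Rightarrow> 'm \<Rightarrow> bool"
  assumes K: "compact (UNIV :: 'm set)" and loc: "\<And>x. \<exists>N. open N \<and> x \<in> N \<and> (\<forall>y\<in>N. \<forall>z\<in>N. P y z)"
  obtains r where "0 < r" "\<And>y z. dist y z < r \<Longrightarrow> P y z"
proof -
  let ?\<N> = "{N. open N \<and> (\<forall>y\<in>N. \<forall>z\<in>N. P y z)}"
  have cov: "UNIV \<subseteq> \<Union>?\<N>"
  proof
    fix x
    obtain N where "open N \<and> x \<in> N \<and> (\<forall>y\<in>N. \<forall>z\<in>N. P y z)" using loc[of x] by (rule exE)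
    then show "x \<in> \<Union>?\<N>" by (intro UnionI[of N]) auto
  qed
  obtain r where r: "0 < r" "\<forall>x\<in>UNIV. \<exists>N\<in>?\<N>. ball x r \<subseteq> N"
    by (rule Heine_Borel_lemma[OF K cov]) auto
  show thesis
  proof (rule that[OF r(1)])
    fix y z :: 'm assume "dist y z < r"
    then have "y \<in> ball y r" "z \<in> ball y r" using r(1) by auto
    moreover obtain N where "N \<in> ?\<N>" "ball y r \<subseteq> N" using r(2) by (meson UNIV_I)
    ultimately show "P y z" by blast
  qed
qed

text \<open>
  A finite subcover provides a common Lipschitz constant, and its Lebesgue number a common radius.
\<close>

lemma uniform_lipschitz_of_compact:
  fixes h :: "'m::metric_space \<Rightarrow> real"
  assumes K: "compact (UNIV :: 'm set)" and loc: "\<And>x. lipschitz_near h x"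
  obtains r L where "0 < r" "0 \<le> L" "\<And>y z. dist y z < r \<Longrightarrow> \<bar>h y - h z\<bar> \<le> L * dist y z"
proof -
  let ?ok = "\<lambda>L N. open N \<and> 0 \<le> L \<and> (\<forall>y\<in>N. \<forall>z\<in>N. \<bar>h y - h z\<bar> \<le> L * dist y z)"
  have ex: "\<exists>N L. ?ok L N \<and> x \<in> N" for x
  proof -
    obtain r L where "0 < r" "0 \<le> L" "\<And>y z. dist x y < r \<Longrightarrow> dist x z < r \<Longrightarrow> dist (h y) (h z) \<le> L * dist y z"
      using lipschitz_nearE[OF loc] by blast
    then show ?thesis by (intro exI[of _ "ball x r"] exI[of _ L]) (auto simp: dist_real_def)
  qed
  obtain \<N> :: "'m set set" where \<N>: "\<N> \<subseteq> {N. \<exists>L. ?ok L N}" "finite \<N>" "UNIV \<subseteq> \<Union>\<N>"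
  proof (rule compactE[OF K, of "{N. \<exists>L. ?ok L N}"])
    show "UNIV \<subseteq> \<Union>{N. \<exists>L. ?ok L N}"
    proof
      fix x
      obtain N L where "?ok L N \<and> x \<in> N" using ex[of x] by (elim exE)
      then show "x \<in> \<Union>{N. \<exists>L. ?ok L N}" by (intro UnionI[of N] CollectI exI[of _ L]) auto
    qed
  qed (auto intro: that)
  have "\<forall>N\<in>\<N>. \<exists>L. ?ok L N" using \<N>(1) by blast
  then obtain l where l: "\<forall>N\<in>\<N>. ?ok (l N) N" by (rule bchoice[THEN exE])
  define L where "L = (\<Sum>N\<in>\<N>. l N)"
  have lL: "l N \<le> L" if "N \<in> \<N>" for N
    unfolding L_def using l that \<N>(2) by (intro member_le_sum) auto
  have L0: "0 \<le> L" unfolding L_def using l by (intro sum_nonneg) auto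
  obtain r where r: "0 < r" "\<And>y z. dist y z < r \<Longrightarrow> \<bar>h y - h z\<bar> \<le> L * dist y z"
  proof (rule uniform_of_local_compact[OF K, of "\<lambda>y z. \<bar>h y - h z\<bar> \<le> L * dist y z"])
    fix x
    obtain N where N: "N \<in> \<N>" "x \<in> N" using \<N>(3) by blast
    have "\<bar>h y - h z\<bar> \<le> L * dist y z" if "y \<in> N" "z \<in> N" for y z
    proof -
      have "\<bar>h y - h z\<bar> \<le> l N * dist y z" using l N(1) that by blast
      also have "\<dots> \<le> L * dist y z" by (intro mult_right_mono lL N) auto
      finally show ?thesis .
    qed
    then show "\<exists>N. open N \<and> x \<in> N \<and> (\<forall>y\<in>N. \<forall>z\<in>N. \<bar>h y - h z\<bar> \<le> L * dist y z)"
      using l N by blast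
  qed (rule that)
  show thesis by (rule that[OF r(1) L0 r(2)])
qed

lemma hyperbolic_timeD:
  assumes "hyperbolic_time A g f S b \<sigma> \<delta> x n"
  shows "0 < n" "1 \<le> k \<Longrightarrow> k \<le> n \<Longrightarrow> (\<Prod>j=n-k..<n. inv_deriv_norm A g f ((f ^^ j) x)) \<le> \<sigma> ^ k"
    "1 \<le> k \<Longrightarrow> k \<le> n \<Longrightarrow> S \<noteq> {} \<Longrightarrow> \<sigma> powr (b * real k) \<le> trunc_dist \<delta> ((f ^^ (n - k)) x) S"
  using assms unfolding hyperbolic_time_def by auto

lemma hyperbolic_time_outside:
  assumes H: "hyperbolic_time A g f S b \<sigma> \<delta> x n" and j: "j < n" and pos: "0 < \<sigma>" "0 < \<delta>"
  shows "(f ^^ j) x \<notin> S"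
proof
  assume S: "(f ^^ j) x \<in> S"
  have "n - (n - j) = j" "1 \<le> n - j" "n - j \<le> n" using j by auto
  then have "\<sigma> powr (b * real (n - j)) \<le> trunc_dist \<delta> ((f ^^ j) x) S"
    using hyperbolic_timeD(3)[OF H, of "n - j"] S by auto
  moreover have "trunc_dist \<delta> ((f ^^ j) x) S = 0" using S pos by (simp add: trunc_dist_def)
  moreover have "0 < \<sigma> powr (b * real (n - j))" using pos by simp
  ultimately show False by linarith
qed

context smooth_local_diffeo
begin

text \<open>
  For \<open>l \<le> k\<close> the conditions are those of the second hyperbolic time. For \<open>l = l' + k\<close> the product
  splits into one for each of the two, and the distance condition of the first, for \<open>l'\<close>, is stronger
  than the one for \<open>l\<close>.
\<close>

lemma hyperbolic_time_concat:
  assumes \<sigma>: "0 < \<sigma>" "\<sigma> < 1" and b: "0 < b" and \<delta>: "0 < \<delta>"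
    and H1: "hyperbolic_time A g f S b \<sigma> \<delta> x n" and H2: "hyperbolic_time A g f S b \<sigma> \<delta> ((f ^^ n) x) k"
  shows "hyperbolic_time A g f S b \<sigma> \<delta> x (n + k)"
proof -
  let ?lam = "\<lambda>j. inv_deriv_norm A g f ((f ^^ j) x)"
  have shift: "(f ^^ i) ((f ^^ n) x) = (f ^^ (i + n)) x" for i by (simp add: funpow_add)
  have lam: "0 \<le> ?lam j" if "j < n + k" for j
  proof -
    have "(f ^^ j) x \<notin> S"
    proof (cases "j < n")
      case False
      then have "(f ^^ (j - n)) ((f ^^ n) x) \<notin> S"
        using that by (intro hyperbolic_time_outside[OF H2 _ \<sigma>(1) \<delta>]) auto
      then show ?thesis using False by (simp add: shift)
    qed (rule hyperbolic_time_outside[OF H1 _ \<sigma>(1) \<delta>])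
    then show ?thesis using inv_deriv_norm_pos less_imp_le by blast
  qed
  have tail: "(\<Prod>j=n+k-l..<n+k. ?lam j) \<le> \<sigma> ^ l" if l: "1 \<le> l" "l \<le> k" for l
  proof -
    have "(\<Prod>j=n+k-l..<n+k. ?lam j) = (\<Prod>j=(k-l)+n..<k+n. ?lam j)" using l by (simp add: add.commute)
    also have "\<dots> = (\<Prod>i=k-l..<k. ?lam (i + n))" by (rule prod.shift_bounds_nat_ivl)
    also have "\<dots> \<le> \<sigma> ^ l" using hyperbolic_timeD(2)[OF H2 l] unfolding shift .
    finally show ?thesis .
  qed
  show ?thesis
    unfolding hyperbolic_time_def
  proof (intro conjI ballI impI)
    show "1 \<le> n + k" using hyperbolic_timeD(1)[OF H1] by simp
    fix l assume "l \<in> {1..n + k}"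
    then have l: "1 \<le> l" "l \<le> n + k" by auto
    show "(\<Prod>j=n+k-l..<n+k. ?lam j) \<le> \<sigma> ^ l"
    proof (cases "l \<le> k")
      case False
      define l' where "l' = l - k"
      have l': "l = l' + k" "1 \<le> l'" "l' \<le> n" using False l by (auto simp: l'_def)
      have k: "1 \<le> k" using hyperbolic_timeD(1)[OF H2] by simp
      have "(\<Prod>j=n+k-l..<n+k. ?lam j) = (\<Prod>j=n-l'..<n. ?lam j) * (\<Prod>j=n..<n+k. ?lam j)"
        using l' by (simp add: prod.atLeastLessThan_concat)
      also have "\<dots> \<le> \<sigma> ^ l' * \<sigma> ^ k"
      proof (rule mult_mono)
        show "(\<Prod>j=n-l'..<n. ?lam j) \<le> \<sigma> ^ l'" by (rule hyperbolic_timeD(2)[OF H1 l'(2,3)])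
        show "(\<Prod>j=n..<n+k. ?lam j) \<le> \<sigma> ^ k" using tail[OF k order_refl] by simp
        show "0 \<le> \<sigma> ^ l'" using \<sigma> by simp
        show "0 \<le> (\<Prod>j=n..<n+k. ?lam j)" by (intro prod_nonneg) (use lam in auto)
      qed
      finally show ?thesis by (simp add: l'(1) power_add)
    qed (rule tail[OF l(1)])
    assume S: "S \<noteq> {}"
    show "\<sigma> powr (b * real l) \<le> trunc_dist \<delta> ((f ^^ (n + k - l)) x) S"
    proof (cases "l \<le> k")
      case True
      then have "(f ^^ (n + k - l)) x = (f ^^ (k - l)) ((f ^^ n) x)" by (simp add: shift add.commute)
      then show ?thesis using hyperbolic_timeD(3)[OF H2 l(1) True S] by simp
    next
      case False
      define l' where "l' = l - k"
      have l': "l = l' + k" "1 \<le> l'" "l' \<le> n" using False l by (auto simp: l'_def)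
      have "\<sigma> powr (b * real l) \<le> \<sigma> powr (b * real l')"
        using \<sigma> b l'(1) by (intro powr_mono') (auto intro: mult_left_mono)
      also have "\<dots> \<le> trunc_dist \<delta> ((f ^^ (n - l')) x) S" by (rule hyperbolic_timeD(3)[OF H1 l'(2,3) S])
      finally show ?thesis using l' by simp
    qed
  qed
qed

text \<open>
  Let \<open>z = f\<^sup>n\<^sup>-\<^sup>k(x)\<close> and let \<open>t\<close> be its distance to \<open>S\<close>. If \<open>t \<le> \<delta>\<close>, then \<open>t \<ge> \<sigma>\<^sup>b\<^sup>k\<close>; as \<open>b < 1/2\<close>, the
  ball of radius \<open>\<rho> \<sigma>\<^sup>k\<^sup>/\<^sup>2\<close> about \<open>z\<close> is small compared to \<open>t\<close>, and as \<open>b < 1/(4\<beta>)\<close>, the variation of the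
  logarithms on it is at most a multiple of \<open>\<rho> \<sigma>\<^sup>k\<^sup>/\<^sup>2 \<sigma>\<^sup>-\<^sup>b\<^sup>\<beta>\<^sup>k \<le> \<rho> \<sigma>\<^sup>k\<^sup>/\<^sup>4\<close>. If \<open>t > \<delta>\<close>, the power \<open>t\<^sup>-\<^sup>\<beta>\<close> is at
  most \<open>\<delta>\<^sup>-\<^sup>\<beta>\<close>. A small \<open>\<rho>\<close> makes the variation of \<open>ln \<parallel>Df\<^sup>-\<^sup>1\<parallel>\<close> less than \<open>ln \<sigma>\<^sup>-\<^sup>1\<^sup>/\<^sup>2\<close>. For empty \<open>S\<close> the
  same bounds follow from uniform continuity of \<open>ln \<parallel>Df\<^sup>-\<^sup>1\<parallel>\<close> and the Lipschitz property of the
  logarithmic Jacobian on the compact space.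
\<close>

lemma control_along_hyperbolic_time:
  assumes K: "compact (UNIV :: 'm set)"
    and \<sigma>: "0 < \<sigma>" "\<sigma> < 1" and \<delta>: "0 < \<delta>" and B: "1 < B" and \<beta>: "0 < \<beta>"
    and b: "0 < b" "b < min (1 / 2) (1 / (4 * \<beta>))" and power: "behaves_like_power_of_dist A g f S B \<beta>"
  obtains \<rho> C where "0 < \<rho>" "0 \<le> C"
    "\<And>x n k y. hyperbolic_time A g f S b \<sigma> \<delta> x n \<Longrightarrow> 1 \<le> k \<Longrightarrow> k \<le> n \<Longrightarrow>
       dist ((f ^^ (n - k)) x) y < \<rho> * \<sigma> powr (real k / 2) \<Longrightarrow>
       y \<notin> S \<and> inv_deriv_norm A g f y \<le> \<sigma> powr (- (1 / 2)) * inv_deriv_norm A g f ((f ^^ (n - k)) x) \<and>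
       \<bar>ln (inv_deriv_abs_det A g f y) - ln (inv_deriv_abs_det A g f ((f ^^ (n - k)) x))\<bar> \<le> C * (\<sigma> powr (1 / 4)) ^ k"
proof -
  let ?lam = "inv_deriv_norm A g f" and ?J = "inv_deriv_abs_det A g f"
  define \<theta> where "\<theta> = \<sigma> powr (- (1 / 2))"
  have \<theta>: "1 < \<theta>"
    using \<sigma> powr_less_mono'[of \<sigma> "- (1 / 2)" 0] by (simp add: \<theta>_def)
  have pk: "(\<sigma> powr (1 / 4)) ^ k = \<sigma> powr (real k / 4)" for k
    using \<sigma> by (simp add: powr_power)
  have pk1: "\<sigma> powr (real k / 2) \<le> \<sigma> powr (real k / 4)" "\<sigma> powr (real k / 4) \<le> 1" for k
    using \<sigma> powr_mono'[of "real k / 4" "real k / 2" \<sigma>] powr_mono'[of 0 "real k / 4" \<sigma>] by auto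
  show thesis
  proof (cases "S = {}")
    case True
    obtain r1 L where r1: "0 < r1" "0 \<le> L" "\<And>y z. dist y z < r1 \<Longrightarrow> \<bar>ln (?J y) - ln (?J z)\<bar> \<le> L * dist y z"
      using uniform_lipschitz_of_compact[OF K ln_inv_deriv_abs_det_lipschitz] True by auto
    obtain r2 where r2: "0 < r2" "\<And>y z. dist y z < r2 \<Longrightarrow> ?lam z \<le> \<theta> * ?lam y"
    proof (rule uniform_of_local_compact[OF K, of "\<lambda>y z. ?lam z \<le> \<theta> * ?lam y"])
      show "\<exists>N. open N \<and> x \<in> N \<and> (\<forall>y\<in>N. \<forall>z\<in>N. ?lam z \<le> \<theta> * ?lam y)" for x
        using inv_deriv_norm_almost_constant[OF _ \<theta>, of x] True by simp
    qed (rule that)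
    define \<rho> where "\<rho> = min r1 r2"
    have \<rho>: "0 < \<rho>" using r1 r2 by (simp add: \<rho>_def)
    show thesis
    proof (rule that[OF \<rho>, of "L * \<rho>"])
      show "0 \<le> L * \<rho>" using r1 \<rho> by simp
      fix x n k y
      define z where "z = (f ^^ (n - k)) x"
      assume "dist ((f ^^ (n - k)) x) y < \<rho> * \<sigma> powr (real k / 2)"
      then have d: "dist z y < \<rho> * \<sigma> powr (real k / 2)" by (simp add: z_def)
      have "\<rho> * \<sigma> powr (real k / 2) \<le> \<rho> * \<sigma> powr (real k / 4)" using pk1(1)[of k] \<rho> by (intro mult_left_mono) auto
      then have d4: "dist z y \<le> \<rho> * \<sigma> powr (real k / 4)" using d by simp
      have "\<rho> * \<sigma> powr (real k / 4) \<le> \<rho> * 1" using pk1(2)[of k] \<rho> by (intro mult_left_mono) auto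
      moreover have "\<rho> * \<sigma> powr (real k / 2) \<le> \<rho> * \<sigma> powr (real k / 4)" using pk1(1)[of k] \<rho> by (intro mult_left_mono) auto
      ultimately have "dist z y < \<rho>" using d by simp
      then have dz: "dist z y < r1" "dist z y < r2" by (auto simp: \<rho>_def)
      have "\<bar>ln (?J y) - ln (?J z)\<bar> = \<bar>ln (?J z) - ln (?J y)\<bar>" by (rule abs_minus_commute)
      also have "\<dots> \<le> L * dist z y" by (rule r1(3)[OF dz(1)])
      also have "\<dots> \<le> L * (\<rho> * \<sigma> powr (real k / 4))" by (rule mult_left_mono[OF d4 r1(2)])
      finally have "\<bar>ln (?J y) - ln (?J z)\<bar> \<le> L * \<rho> * (\<sigma> powr (1 / 4)) ^ k" by (simp add: pk mult.assoc)
      then show "y \<notin> S \<and> ?lam y \<le> \<sigma> powr (- (1 / 2)) * ?lam ((f ^^ (n - k)) x) \<and>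
         \<bar>ln (?J y) - ln (?J ((f ^^ (n - k)) x))\<bar> \<le> L * \<rho> * (\<sigma> powr (1 / 4)) ^ k"
        using r2(2)[OF dz(2)] True by (simp add: z_def \<theta>_def)
    qed
  next
    case False
    define c0 where "c0 = max 1 (\<delta> powr (- \<beta>))"
    have c0: "1 \<le> c0" "\<delta> powr (- \<beta>) \<le> c0" by (auto simp: c0_def)
    define \<rho> where "\<rho> = min (1 / 4) (min (\<delta> / 4) (ln \<theta> / (B * c0)))"
    have \<rho>: "0 < \<rho>" using \<delta> \<theta> B c0 by (simp add: \<rho>_def)
    have "\<rho> \<le> 1 / 4" unfolding \<rho>_def by (rule min.cobounded1)
    moreover have "\<rho> \<le> \<delta> / 4"
      unfolding \<rho>_def by (rule order_trans[OF min.cobounded2 min.cobounded1])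
    ultimately have \<rho>le: "\<rho> < 1 / 2" "\<rho> < \<delta> / 2" using \<delta> by linarith+
    have "\<rho> \<le> ln \<theta> / (B * c0)" by (simp add: \<rho>_def)
    then have \<rho>\<theta>: "B * c0 * \<rho> \<le> ln \<theta>" using B c0 by (simp add: pos_le_divide_eq mult.commute)
    show thesis
    proof (rule that[OF \<rho>, of "B * c0 * \<rho>"])
      show "0 \<le> B * c0 * \<rho>" using B c0 \<rho> by simp
      fix x n k y
      assume H: "hyperbolic_time A g f S b \<sigma> \<delta> x n" and k: "1 \<le> k" "k \<le> n"
        and "dist ((f ^^ (n - k)) x) y < \<rho> * \<sigma> powr (real k / 2)"
      define z where "z = (f ^^ (n - k)) x"
      have d: "dist z y < \<rho> * \<sigma> powr (real k / 2)" using \<open>dist ((f ^^ (n - k)) x) y < _\<close> by (simp add: z_def)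
      have zS: "z \<notin> S" unfolding z_def by (rule hyperbolic_time_outside[OF H _ \<sigma>(1) \<delta>]) (use k in simp)
      define t where "t = infdist z S"
      have tr: "\<sigma> powr (b * real k) \<le> trunc_dist \<delta> z S" unfolding z_def by (rule hyperbolic_timeD(3)[OF H k False])
      have s1: "\<sigma> powr (real k / 2) \<le> 1" using pk1[of k] by linarith
      have key: "\<rho> * \<sigma> powr (real k / 2) \<le> t / 2 \<and> 0 < t \<and> \<sigma> powr (real k / 2) / t powr \<beta> \<le> c0 * \<sigma> powr (real k / 4)"
      proof (cases "t \<le> \<delta>")
        case True
        then have tb: "\<sigma> powr (b * real k) \<le> t" using tr by (simp add: trunc_dist_def t_def)
        have "0 < \<sigma> powr (b * real k)" using \<sigma> by simp
        then have t0: "0 < t" using tb by linarith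
        have "\<sigma> powr (real k / 2) \<le> \<sigma> powr (b * real k)"
          using \<sigma> b mult_right_mono[of b "1 / 2" "real k"] by (intro powr_mono') auto
        then have "\<rho> * \<sigma> powr (real k / 2) \<le> 1 / 2 * t"
          using tb \<rho>le \<rho> by (intro mult_mono) auto
        moreover have "\<sigma> powr (real k / 2) / t powr \<beta> \<le> \<sigma> powr (real k / 4)"
        proof -
          have b\<beta>: "b * \<beta> \<le> 1 / 4" using b \<beta> by (simp add: pos_less_divide_eq mult.commute mult.left_commute)
          have "(\<sigma> powr (b * real k)) powr \<beta> \<le> t powr \<beta>" using tb \<beta> by (intro powr_mono2) auto
          then have "\<sigma> powr (b * real k * \<beta>) \<le> t powr \<beta>" by (simp add: powr_powr)
          then have "\<sigma> powr (real k / 2) / t powr \<beta> \<le> \<sigma> powr (real k / 2) / \<sigma> powr (b * real k * \<beta>)"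
            using \<sigma> t0 by (intro divide_left_mono) auto
          also have "\<dots> = \<sigma> powr (real k / 2 - b * real k * \<beta>)" by (simp add: powr_diff)
          also have "\<dots> \<le> \<sigma> powr (real k / 4)"
          proof (intro powr_mono')
            have "(b * \<beta>) * real k \<le> (1 / 4) * real k" using b\<beta> by (intro mult_right_mono) auto
            then show "real k / 4 \<le> real k / 2 - b * real k * \<beta>" by (simp add: mult.commute mult.left_commute)
          qed (use \<sigma> in auto)
          finally show ?thesis .
        qed
        moreover have "\<sigma> powr (real k / 4) \<le> c0 * \<sigma> powr (real k / 4)" using mult_right_mono[OF c0(1), of "\<sigma> powr (real k / 4)"] by simp
        ultimately show ?thesis using t0 by linarith
      next
        case False
        then have t0: "0 < t" "\<delta> < t" using \<delta> by auto
        have "\<rho> * \<sigma> powr (real k / 2) \<le> \<rho> * 1" using s1 \<rho> by (intro mult_left_mono) auto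
        moreover have "\<sigma> powr (real k / 2) / t powr \<beta> \<le> c0 * \<sigma> powr (real k / 4)"
        proof -
          have "\<sigma> powr (real k / 2) / t powr \<beta> = t powr (- \<beta>) * \<sigma> powr (real k / 2)"
            by (simp add: powr_minus_divide)
          also have "\<dots> \<le> c0 * \<sigma> powr (real k / 4)"
          proof (rule mult_mono)
            have "t powr (- \<beta>) \<le> \<delta> powr (- \<beta>)" using t0 \<delta> \<beta> by (intro powr_mono2') auto
            then show "t powr (- \<beta>) \<le> c0" using c0(2) by linarith
          qed (use pk1(1) c0 in auto)
          finally show ?thesis .
        qed
        ultimately show ?thesis using t0 \<rho>le by linarith
      qed
      have dt: "dist z y < t / 2" using d key by linarith
      have yS: "y \<notin> S"
      proof
        assume "y \<in> S"
        then have "t \<le> dist z y" unfolding t_def by (rule infdist_le)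
        then show False using dt key by linarith
      qed
      have q: "dist z y / t powr \<beta> \<le> \<rho> * (c0 * \<sigma> powr (real k / 4))"
      proof -
        have "dist z y / t powr \<beta> \<le> \<rho> * \<sigma> powr (real k / 2) / t powr \<beta>"
          using d by (intro divide_right_mono) auto
        also have "\<dots> = \<rho> * (\<sigma> powr (real k / 2) / t powr \<beta>)" by simp
        also have "\<dots> \<le> \<rho> * (c0 * \<sigma> powr (real k / 4))" using key \<rho> by (intro mult_left_mono) auto
        finally show ?thesis .
      qed
      have v: "axis undefined 1 \<noteq> (0 :: real ^ 'n)" by (simp add: axis_eq_0_iff)
      note pw = power[unfolded behaves_like_power_of_dist_def, rule_format, of z y "axis undefined 1"]
      have pw': "\<bar>ln (?lam z) - ln (?lam y)\<bar> \<le> B * (dist z y / t powr \<beta>)"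
          "\<bar>ln (?J z) - ln (?J y)\<bar> \<le> B * (dist z y / t powr \<beta>)"
        using pw zS yS dt v by (auto simp: t_def)
      have bound: "B * (dist z y / t powr \<beta>) \<le> B * c0 * \<rho> * \<sigma> powr (real k / 4)"
        using mult_left_mono[OF q, of B] B by (simp add: mult_ac)
      have "B * c0 * \<rho> * \<sigma> powr (real k / 4) \<le> B * c0 * \<rho> * 1"
        using B c0 \<rho> pk1(2)[of k] by (intro mult_left_mono) auto
      then have "\<bar>ln (?lam z) - ln (?lam y)\<bar> \<le> ln \<theta>" using pw'(1) bound \<rho>\<theta> by linarith
      then have "ln (?lam y) \<le> ln \<theta> + ln (?lam z)" by linarith
      also have "\<dots> = ln (\<theta> * ?lam z)" using \<theta> inv_deriv_norm_pos[OF zS] by (simp add: ln_mult_pos)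
      finally have "?lam y \<le> \<theta> * ?lam z"
        using \<theta> inv_deriv_norm_pos[OF zS] inv_deriv_norm_pos[OF yS] by (subst (asm) ln_le_cancel_iff) auto
      moreover have "\<bar>ln (?J y) - ln (?J z)\<bar> \<le> B * c0 * \<rho> * (\<sigma> powr (1 / 4)) ^ k"
        using pw'(2) bound unfolding pk by linarith
      ultimately show "y \<notin> S \<and> ?lam y \<le> \<sigma> powr (- (1 / 2)) * ?lam ((f ^^ (n - k)) x) \<and>
         \<bar>ln (?J y) - ln (?J ((f ^^ (n - k)) x))\<bar> \<le> B * c0 * \<rho> * (\<sigma> powr (1 / 4)) ^ k"
        using yS unfolding \<theta>_def z_def by blast
    qed
  qed
qed

lemma small_chart_balls:
  assumes \<rho>: "0 < \<rho>"
  shows "\<exists>(U :: (real ^ 'n) set) Q \<psi> \<phi> K. open U \<and> convex U \<and> open Q \<and> (z :: 'm) \<in> Q \<and> homeomorphism U Q \<psi> \<phi> \<and> 0 \<le> K \<and>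
       (\<forall>u\<in>U. \<forall>v\<in>U. dist (\<psi> u) (\<psi> v) \<le> K * dist u v \<and> K * dist u v < \<rho>)"
proof -
  define c where "c = chart_at A z"
  have c: "c \<in> A" "z \<in> fst c" unfolding c_def by (rule chart_at)+
  define p0 where "p0 = snd c z"
  have p0: "p0 \<in> coords c" using c by (auto simp: p0_def)
  obtain b where b: "0 < b" "\<And>v. sqrt (met c p0 v v) \<le> b * norm v"
    using inner_form_norm_bounds[OF met_inner_form[OF c(1) p0]] by metis
  obtain s where s: "0 < s" "ball p0 s \<subseteq> coords c" "\<And>p q. p \<in> ball p0 s \<Longrightarrow> q \<in> ball p0 s \<Longrightarrow>
      dist (chart_inv c p) (chart_inv c q) \<le> (1 + 1 / 2) * sqrt (met c p0 (q - p) (q - p))"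
    using dist_in_chart[OF c(1) p0, of "1 / 2"] by auto
  define K where "K = 3 / 2 * b"
  have K: "0 < K" using b by (simp add: K_def)
  define r where "r = min s (\<rho> / (2 * K))"
  have r: "0 < r" "r \<le> s" "K * (2 * r) \<le> \<rho>" using s \<rho> K by (auto simp: r_def min_def pos_le_divide_eq field_simps)
  have sub: "ball p0 r \<subseteq> coords c" using s(2) r(2) by auto
  show ?thesis
  proof (intro exI conjI ballI)
    show "open (ball p0 r)" "convex (ball p0 r)" by auto
    show "open (chart_inv c ` ball p0 r)" by (rule chart_inv_image_open[OF c(1) open_ball sub])
    show "z \<in> chart_inv c ` ball p0 r"
      using chart(5)[OF c] r(1) by (intro image_eqI[of _ _ p0]) (auto simp: p0_def)
    show "homeomorphism (ball p0 r) (chart_inv c ` ball p0 r) (chart_inv c) (snd c)"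
      by (rule homeomorphism_of_subsets[OF homeomorphism_symD[OF chart(8)[OF c(1)]] sub])
         (use sub chart(7)[OF c(1)] in auto)
    show "0 \<le> K" using K by simp
    fix u v assume uv: "u \<in> ball p0 r" "v \<in> ball p0 r"
    have "dist (chart_inv c u) (chart_inv c v) \<le> (1 + 1 / 2) * sqrt (met c p0 (v - u) (v - u))"
      using uv r(2) by (intro s(3)) auto
    also have "\<dots> \<le> (1 + 1 / 2) * (b * norm (v - u))" by (intro mult_left_mono b) auto
    also have "\<dots> = K * dist u v" by (simp add: K_def dist_norm norm_minus_commute)
    finally show "dist (chart_inv c u) (chart_inv c v) \<le> K * dist u v" .
    have "dist u v < 2 * r" using uv dist_triangle[of u v p0] by (simp add: dist_commute)
    then have "K * dist u v < K * (2 * r)" using K by simp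
    then show "K * dist u v < \<rho>" using r(3) by linarith
  qed
qed

end

theorem theorem2:
  fixes A :: "('m::metric_space, 'n::finite) chart set"
    and g :: "('m, 'n) metric_field"
    and m :: "'m measure"
    and S :: "'m set"
    and f :: "'m \<Rightarrow> 'm"
    and d :: nat
    and B \<beta> b \<sigma> \<delta> :: real
  assumes "compact (UNIV :: 'm set)"
    and "smooth_atlas A"
    and "riemannian_metric A g"
    and "induced_distance A g"
    and "normalized_riemannian_volume A g m"
    and "compact S"
    and "embedded_submanifold A d S"
    and "d < CARD('n)"
    and "continuous_on UNIV f"
    and "Ck_local_diffeo_on A 2 f (- S)"
    and "B > 1"
    and "\<beta> > 0"
    and "behaves_like_power_of_dist A g f S B \<beta>"
    and "0 < b"
    and "b < min (1 / 2) (1 / (4 * \<beta>))"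
    and "0 < \<sigma>"
    and "\<sigma> < 1"
    and "\<delta> > 0"
    and "AE x in m. \<exists>n. hyperbolic_time A g f S b \<sigma> \<delta> x n"
    and "integrable m (\<lambda>x. real (first_hyperbolic_time A g f S b \<sigma> \<delta> x))"
  shows "\<exists>\<mu> :: 'm measure.
    prob_space \<mu> \<and> sets \<mu> = sets borel \<and> absolutely_continuous m \<mu> \<and> distr \<mu> \<mu> f = \<mu>"
proof -
  interpret M: smooth_local_diffeo_volume A g f S m
    by unfold_locales (use assms in auto)
  obtain \<rho> C where \<rho>: "0 < \<rho>" and C: "0 \<le> C" and control:
    "\<And>x n k y. hyperbolic_time A g f S b \<sigma> \<delta> x n \<Longrightarrow> 1 \<le> k \<Longrightarrow> k \<le> n \<Longrightarrow>
       dist ((f ^^ (n - k)) x) y < \<rho> * \<sigma> powr (real k / 2) \<Longrightarrow>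
       y \<notin> S \<and> inv_deriv_norm A g f y \<le> \<sigma> powr (- (1 / 2)) * inv_deriv_norm A g f ((f ^^ (n - k)) x) \<and>
       \<bar>ln (inv_deriv_abs_det A g f y) - ln (inv_deriv_abs_det A g f ((f ^^ (n - k)) x))\<bar> \<le> C * (\<sigma> powr (1 / 4)) ^ k"
    by (rule M.control_along_hyperbolic_time[OF assms(1,16,17,18,11,12,14,15,13)]) (rule that)
  interpret P: prob_space m by (rule M.m_prob)
  interpret H: abstract_hyperbolic_times f S "inv_deriv_norm A g f" m "inv_deriv_abs_det A g f"
    "hyperbolic_time A g f S b \<sigma> \<delta>" \<sigma> \<rho> C "\<sigma> powr (1 / 4)" "TYPE(real ^ 'n)"
  proof
    show "compact (UNIV :: 'm set)" "continuous_on UNIV f" by fact+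
    show "sets m = sets borel" by (rule M.sets_m)
    show "0 < \<sigma>" "0 < \<rho>" "0 \<le> C" by fact+
    show "0 < \<sigma> powr (1 / 4)" using \<open>0 < \<sigma>\<close> by simp
    show "\<sigma> powr (1 / 4) < 1" using powr_less_mono'[of \<sigma> 0 "1 / 4"] \<open>0 < \<sigma>\<close> \<open>\<sigma> < 1\<close> by simp
    show "local_homeo_at f (- S) x" if "x \<notin> S" for x by (rule M.f_local_homeo_at[OF that])
    show "0 < inv_deriv_norm A g f x" if "x \<notin> S" for x by (rule M.inv_deriv_norm_pos[OF that])
    show "\<forall>\<^sub>F y in nhds x. dist y x \<le> l * dist (f y) (f x)" if "x \<notin> S" "inv_deriv_norm A g f x < l" for x l
      by (rule M.locally_expands[OF that])
    show "0 < emeasure m W" if "open W" "W \<noteq> {}" for W by (rule M.volume_open_pos[OF that])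
    show "0 < inv_deriv_abs_det A g f x" if "x \<notin> S" for x by (rule M.inv_deriv_abs_det_pos(1)[OF that])
    show "\<exists>V. open V \<and> x \<in> V \<and> jacobian_bounds m f (inv_deriv_abs_det A g f) V" if "x \<notin> S" for x
      by (rule M.local_jacobian_bounds(1)[OF that])
    show "\<exists>V. open V \<and> x \<in> V \<and> (\<forall>X\<in>null_sets m. f -` X \<inter> V \<in> null_sets m)" if "x \<notin> S" for x
      by (rule M.local_jacobian_bounds(2)[OF that])
    show "0 < n" if "hyperbolic_time A g f S b \<sigma> \<delta> x n" for x n by (rule hyperbolic_timeD(1)[OF that])
    show "hyperbolic_time A g f S b \<sigma> \<delta> x (n + k)"
      if "hyperbolic_time A g f S b \<sigma> \<delta> x n" "hyperbolic_time A g f S b \<sigma> \<delta> ((f ^^ n) x) k" for x n k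
      by (rule M.hyperbolic_time_concat[OF assms(16,17,14,18) that])
    show "(\<Prod>j=n-k..<n. inv_deriv_norm A g f ((f ^^ j) x)) \<le> \<sigma> ^ k"
      if "hyperbolic_time A g f S b \<sigma> \<delta> x n" "1 \<le> k" "k \<le> n" for x n k
      by (rule hyperbolic_timeD(2)[OF that])
    show "y \<notin> S \<and> inv_deriv_norm A g f y \<le> \<sigma> powr (- (1 / 2)) * inv_deriv_norm A g f ((f ^^ (n - k)) x) \<and>
       \<bar>ln (inv_deriv_abs_det A g f y) - ln (inv_deriv_abs_det A g f ((f ^^ (n - k)) x))\<bar> \<le> C * (\<sigma> powr (1 / 4)) ^ k"
      if "hyperbolic_time A g f S b \<sigma> \<delta> x n" "1 \<le> k" "k \<le> n" "dist ((f ^^ (n - k)) x) y < \<rho> * \<sigma> powr (real k / 2)"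
      for x n k y
      by (rule control[OF that])
    show "\<exists>(U :: (real ^ 'n) set) Q \<psi> \<phi> K. open U \<and> convex U \<and> open Q \<and> (z :: 'm) \<in> Q \<and> homeomorphism U Q \<psi> \<phi> \<and> 0 \<le> K \<and>
       (\<forall>u\<in>U. \<forall>v\<in>U. dist (\<psi> u) (\<psi> v) \<le> K * dist u v \<and> K * dist u v < \<rho>)" for z
      by (rule M.small_chart_balls[OF \<rho>])
  qed
  show ?thesis
    by (rule H.invariant_measure) (use assms(19,20) in \<open>simp_all add: first_hyperbolic_time_def\<close>)
qed

end
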